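(* Let $(\mathbb M^{n+m},\mathcal F,g_0)$ be a smooth, connected, complete manifold with a Riemannian foliation $\mathcal F$ having $m$-dimensional totally geodesic leaves and bundle-like metric $g_0$. Let $g(t)=g_{\mathcal H}(t)\oplus g_{\mathcal V}$ be a solution of the transverse flow $\frac{\partial}{\partial t}g_{\mathcal H}(t)=h(t)$, $\frac{\partial}{\partial t}g_{\mathcal V}=0$, $g(0)=g_0$, where $h(t)$ is a symmetric $(0,2)$ tensor with $h(X,Z)=0$ whenever $X$ or $Z$ is vertical. Let $x\in\mathbb M$. Then around $x$, at any time $t$, there exist a local $g(t)$-orthonormal horizontal frame $\{X_1(t),\dots,X_n(t)\}$ and a local orthonormal vertical frame $\{Z_1,\dots,Z_m\}$ such that $$[X_i(t),X_j(t)]=\sum_{k=1}^n\omega_{ij}^k(t)X_k(t)+\sum_{k=1}^m\gamma_{ij}^k(t)Z_k,\qquad [X_i(t),Z_k]=\sum_{j=1}^m\beta_{ik}^j(t)Z_j,$$ where $\omega_{ij}^k(t),\gamma_{ij}^k(t),\beta_{ik}^j(t)$ are smooth functions in space and time with $$\beta_{ik}^j(t)=-\beta_{ij}^k(t).$$ Moreover, at $x$ one has $\omega_{ij}^k(t)=0$ and $\beta_{ij}^k(t)=0$.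
   Context: $\mathcal V\subset T\mathbb M$ is the bundle of vectors tangent to the leaves (vertical, rank $m$) and $\mathcal H=\mathcal V^\perp$ (horizontal, rank $n$, assumed bracket generating); $g_{\mathcal H},g_{\mathcal V}$ are the restrictions of $g$ to $\mathcal H,\mathcal V$. A vector field $X$ is foliate if $[X,Z]$ is vertical for every vertical $Z$. A metric $g$ is bundle-like if for every open $U$ and all horizontal foliate $X,Y$ on $U$, $Z\,g(X,Y)=0$ for all vertical $Z$. The vertical frame $\{Z_1,\dots,Z_m\}$ does not depend on $t$.
   Formalization: It is additionally assumed that g(t) is bundle-like at every time t, not only at t = 0; without this the claim fails (Heisenberg group, h = f·g_H with f non-constant along the leaves), and the claim itself forces it. *)

theory Defs
  imports "HOL-Analysis.Analysis"
begin

section \<open>Smoothness in Euclidean space\<close>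

primrec Ck_on :: "nat \<Rightarrow> 'a::real_normed_vector set \<Rightarrow> ('a \<Rightarrow> 'b::real_normed_vector) \<Rightarrow> bool" where
  "Ck_on 0 W f \<longleftrightarrow> continuous_on W f"
| "Ck_on (Suc k) W f \<longleftrightarrow>
     (\<forall>x\<in>W. f differentiable at x) \<and> (\<forall>v. Ck_on k W (\<lambda>x. frechet_derivative f (at x) v))"

text \<open>Smoothness on an arbitrary set means that there are local smooth extensions to open sets.
  On open sets this is the usual notion; the general form is needed for domains \<open>I \<times> V\<close> with an
  interval \<open>I\<close> that may contain its end points.\<close>

definition smooth_on :: "'a::real_normed_vector set \<Rightarrow> ('a \<Rightarrow> 'b::real_normed_vector) \<Rightarrow> bool" where
  "smooth_on S f \<longleftrightarrow>
     (\<forall>x\<in>S. \<exists>W F. open W \<and> x \<in> W \<and> (\<forall>k. Ck_on k W F) \<and> (\<forall>y\<in>W \<inter> S. F y = f y))"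


section \<open>Foliated manifolds\<close>

text \<open>The manifold is the whole type \<open>'a\<close>, of dimension \<open>CARD('n) + CARD('m)\<close>. A chart is a pair
  of its domain and its coordinate map; the first block of coordinates is transverse to the leaves,
  and the second block consists of coordinates along the leaves.\<close>

type_synonym ('a, 'n, 'm) fchart = "'a set \<times> ('a \<Rightarrow> (real ^ 'n) \<times> (real ^ 'm))"

abbreviation cdom :: "('a, 'n, 'm) fchart \<Rightarrow> 'a set" where
  "cdom c \<equiv> fst c"

abbreviation cmap :: "('a, 'n, 'm) fchart \<Rightarrow> 'a \<Rightarrow> (real ^ 'n) \<times> (real ^ 'm)" where
  "cmap c \<equiv> snd c"

abbreviation cinv :: "('a, 'n, 'm) fchart \<Rightarrow> (real ^ 'n) \<times> (real ^ 'm) \<Rightarrow> 'a" where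
  "cinv c \<equiv> inv_into (fst c) (snd c)"

definition is_chart :: "('a::topological_space, 'n::finite, 'm::finite) fchart \<Rightarrow> bool" where
  "is_chart c \<longleftrightarrow> open (cdom c) \<and> open (cmap c ` cdom c) \<and>
     homeomorphism (cdom c) (cmap c ` cdom c) (cmap c) (cinv c)"

text \<open>Coordinate changes are smooth and locally of the form \<open>(y, z) \<mapsto> (a y, b (y, z))\<close>. Such an atlas
  determines both the smooth structure and the foliation, whose leaves have dimension \<open>CARD('m)\<close>:
  the plaques \<open>y = const\<close> of the charts are the open pieces of the leaves.\<close>

definition foliated_atlas :: "('a::topological_space, 'n::finite, 'm::finite) fchart set \<Rightarrow> bool" where
  "foliated_atlas A \<longleftrightarrow>
     (\<Union>c\<in>A. cdom c) = UNIV \<and> (\<forall>c\<in>A. is_chart c) \<and>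
     (\<forall>c\<in>A. \<forall>d\<in>A.
        smooth_on (cmap c ` (cdom c \<inter> cdom d)) (cmap d \<circ> cinv c) \<and>
        (\<forall>p \<in> cmap c ` (cdom c \<inter> cdom d). \<exists>W. open W \<and> p \<in> W \<and> W \<subseteq> cmap c ` (cdom c \<inter> cdom d) \<and>
           (\<forall>u\<in>W. \<forall>v\<in>W. fst u = fst v \<longrightarrow> fst (cmap d (cinv c u)) = fst (cmap d (cinv c v)))))"

definition smooth_fun ::
  "('a::topological_space, 'n::finite, 'm::finite) fchart set \<Rightarrow> 'a set \<Rightarrow> ('a \<Rightarrow> real) \<Rightarrow> bool" where
  "smooth_fun A U f \<longleftrightarrow> (\<forall>c\<in>A. smooth_on (cmap c ` (cdom c \<inter> U)) (f \<circ> cinv c))"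

definition smooth_near ::
  "('a::topological_space, 'n::finite, 'm::finite) fchart set \<Rightarrow> 'a \<Rightarrow> ('a \<Rightarrow> real) \<Rightarrow> bool" where
  "smooth_near A q f \<longleftrightarrow> (\<exists>W. open W \<and> q \<in> W \<and> smooth_fun A W f)"

text \<open>Joint smoothness in \<open>t \<in> I\<close> and \<open>q \<in> U\<close>.\<close>

definition smooth_in_time ::
  "('a::topological_space, 'n::finite, 'm::finite) fchart set \<Rightarrow> real set \<Rightarrow> 'a set
     \<Rightarrow> (real \<Rightarrow> 'a \<Rightarrow> real) \<Rightarrow> bool" where
  "smooth_in_time A I U F \<longleftrightarrow>
     (\<forall>c\<in>A. smooth_on (I \<times> cmap c ` (cdom c \<inter> U)) (\<lambda>(t, u). F t (cinv c u)))"


section \<open>Tangent vectors and vector fields\<close>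

text \<open>A tangent vector at \<open>q\<close> is identified with its directional derivative operator on functions that
  are smooth near \<open>q\<close>; it is set to \<open>0\<close> on all other functions, so that equality of tangent vectors is
  equality of operators.\<close>

type_synonym 'a tvec = "('a \<Rightarrow> real) \<Rightarrow> real"

type_synonym 'a tfield = "'a \<Rightarrow> 'a tvec"

text \<open>The tangent vector at \<open>q\<close> with components \<open>w\<close> in the chart \<open>c\<close>.\<close>

definition coord_vec ::
  "('a::topological_space, 'n::finite, 'm::finite) fchart set \<Rightarrow> ('a, 'n, 'm) fchart \<Rightarrow> 'a
     \<Rightarrow> (real ^ 'n) \<times> (real ^ 'm) \<Rightarrow> 'a tvec" where
  "coord_vec A c q w =
     (\<lambda>f. if smooth_near A q f then frechet_derivative (f \<circ> cinv c) (at (cmap c q)) w else 0)"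

definition tangent_space ::
  "('a::topological_space, 'n::finite, 'm::finite) fchart set \<Rightarrow> 'a \<Rightarrow> 'a tvec set" where
  "tangent_space A q = {coord_vec A c q w |c w. c \<in> A \<and> q \<in> cdom c}"

text \<open>The fibre at \<open>q\<close> of the bundle of vectors tangent to the leaves.\<close>

definition vertical ::
  "('a::topological_space, 'n::finite, 'm::finite) fchart set \<Rightarrow> 'a \<Rightarrow> 'a tvec set" where
  "vertical A q = {coord_vec A c q (0, w) |c w. c \<in> A \<and> q \<in> cdom c}"

abbreviation lincomb :: "real \<Rightarrow> 'a tvec \<Rightarrow> real \<Rightarrow> 'a tvec \<Rightarrow> 'a tvec" where
  "lincomb a v b w \<equiv> (\<lambda>f. a * v f + b * w f)"

text \<open>Smooth vector fields on an open set \<open>U\<close>; only the values at points of \<open>U\<close> matter.\<close>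

definition vector_fields ::
  "('a::topological_space, 'n::finite, 'm::finite) fchart set \<Rightarrow> 'a set \<Rightarrow> 'a tfield set" where
  "vector_fields A U = {X. (\<forall>q\<in>U. X q \<in> tangent_space A q) \<and>
     (\<forall>W f. open W \<and> W \<subseteq> U \<and> smooth_fun A W f \<longrightarrow> smooth_fun A W (\<lambda>q. X q f))}"

definition vertical_fields ::
  "('a::topological_space, 'n::finite, 'm::finite) fchart set \<Rightarrow> 'a set \<Rightarrow> 'a tfield set" where
  "vertical_fields A U = {Z \<in> vector_fields A U. \<forall>q\<in>U. Z q \<in> vertical A q}"

text \<open>Time-dependent vector fields on \<open>U\<close> that are smooth in space and time.\<close>

definition vector_field_families ::
  "('a::topological_space, 'n::finite, 'm::finite) fchart set \<Rightarrow> real set \<Rightarrow> 'a set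
     \<Rightarrow> (real \<Rightarrow> 'a tfield) set" where
  "vector_field_families A I U = {X. (\<forall>t\<in>I. X t \<in> vector_fields A U) \<and>
     (\<forall>W f. open W \<and> W \<subseteq> U \<and> smooth_fun A W f \<longrightarrow> smooth_in_time A I W (\<lambda>t q. X t q f))}"

definition lie_bracket ::
  "('a::topological_space, 'n::finite, 'm::finite) fchart set \<Rightarrow> 'a tfield \<Rightarrow> 'a tfield \<Rightarrow> 'a tfield" where
  "lie_bracket A X Y q =
     (\<lambda>f. if smooth_near A q f then X q (\<lambda>r. Y r f) - Y q (\<lambda>r. X r f) else 0)"


section \<open>Metrics\<close>

type_synonym 'a tensor2 = "'a \<Rightarrow> 'a tvec \<Rightarrow> 'a tvec \<Rightarrow> real"

definition symmetric_tensor2 ::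
  "('a::topological_space, 'n::finite, 'm::finite) fchart set \<Rightarrow> 'a tensor2 \<Rightarrow> bool" where
  "symmetric_tensor2 A h \<longleftrightarrow>
     (\<forall>q. \<forall>u\<in>tangent_space A q. \<forall>v\<in>tangent_space A q.
        h q u v = h q v u \<and>
        (\<forall>w\<in>tangent_space A q. \<forall>a b. h q (lincomb a u b v) w = a * h q u w + b * h q v w)) \<and>
     (\<forall>U. open U \<longrightarrow> (\<forall>X\<in>vector_fields A U. \<forall>Y\<in>vector_fields A U.
        smooth_fun A U (\<lambda>q. h q (X q) (Y q))))"

definition riemannian_metric ::
  "('a::topological_space, 'n::finite, 'm::finite) fchart set \<Rightarrow> 'a tensor2 \<Rightarrow> bool" where
  "riemannian_metric A g \<longleftrightarrow> symmetric_tensor2 A g \<and>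
     (\<forall>q. \<forall>v\<in>tangent_space A q. v \<noteq> (\<lambda>f. 0) \<longrightarrow> 0 < g q v v)"

definition smooth_metric_family ::
  "('a::topological_space, 'n::finite, 'm::finite) fchart set \<Rightarrow> real set \<Rightarrow> (real \<Rightarrow> 'a tensor2) \<Rightarrow> bool"
  where
  "smooth_metric_family A I g \<longleftrightarrow> (\<forall>t\<in>I. riemannian_metric A (g t)) \<and>
     (\<forall>U. open U \<longrightarrow> (\<forall>X\<in>vector_fields A U. \<forall>Y\<in>vector_fields A U.
        smooth_in_time A I U (\<lambda>t q. g t q (X q) (Y q))))"

definition horizontal ::
  "('a::topological_space, 'n::finite, 'm::finite) fchart set \<Rightarrow> 'a tensor2 \<Rightarrow> 'a \<Rightarrow> 'a tvec set" where
  "horizontal A g q = {v \<in> tangent_space A q. \<forall>w\<in>vertical A q. g q v w = 0}"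

definition horizontal_fields ::
  "('a::topological_space, 'n::finite, 'm::finite) fchart set \<Rightarrow> 'a tensor2 \<Rightarrow> 'a set \<Rightarrow> 'a tfield set"
  where
  "horizontal_fields A g U = {X \<in> vector_fields A U. \<forall>q\<in>U. X q \<in> horizontal A g q}"

definition foliate ::
  "('a::topological_space, 'n::finite, 'm::finite) fchart set \<Rightarrow> 'a set \<Rightarrow> 'a tfield \<Rightarrow> bool" where
  "foliate A U X \<longleftrightarrow> X \<in> vector_fields A U \<and>
     (\<forall>Z\<in>vertical_fields A U. lie_bracket A X Z \<in> vertical_fields A U)"

definition bundle_like ::
  "('a::topological_space, 'n::finite, 'm::finite) fchart set \<Rightarrow> 'a tensor2 \<Rightarrow> bool" where
  "bundle_like A g \<longleftrightarrow>
     (\<forall>U. open U \<longrightarrow> (\<forall>X\<in>horizontal_fields A g U. \<forall>Y\<in>horizontal_fields A g U.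
        foliate A U X \<and> foliate A U Y \<longrightarrow>
        (\<forall>Z\<in>vertical_fields A U. \<forall>q\<in>U. Z q (\<lambda>r. g r (X r) (Y r)) = 0)))"

text \<open>The Lie algebra of vector fields on \<open>U\<close> generated by the horizontal ones.\<close>

inductive_set horizontal_algebra ::
  "('a::topological_space, 'n::finite, 'm::finite) fchart set \<Rightarrow> 'a tensor2 \<Rightarrow> 'a set \<Rightarrow> 'a tfield set"
  for A g U where
  base: "X \<in> horizontal_fields A g U \<Longrightarrow> X \<in> horizontal_algebra A g U"
| lincomb: "X \<in> horizontal_algebra A g U \<Longrightarrow> Y \<in> horizontal_algebra A g U \<Longrightarrow>
    (\<lambda>q. lincomb a (X q) b (Y q)) \<in> horizontal_algebra A g U"
| bracket: "X \<in> horizontal_algebra A g U \<Longrightarrow> Y \<in> horizontal_algebra A g U \<Longrightarrow>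
    lie_bracket A X Y \<in> horizontal_algebra A g U"

definition bracket_generating ::
  "('a::topological_space, 'n::finite, 'm::finite) fchart set \<Rightarrow> 'a tensor2 \<Rightarrow> bool" where
  "bracket_generating A g \<longleftrightarrow>
     (\<forall>q. \<forall>v\<in>tangent_space A q. \<exists>U. open U \<and> q \<in> U \<and> (\<exists>X\<in>horizontal_algebra A g U. X q = v))"


section \<open>Totally geodesic leaves\<close>

text \<open>\<open>D\<close> is the Levi-Civita connection of \<open>g\<close> on the open set \<open>U\<close>.\<close>

definition levi_civita ::
  "('a::topological_space, 'n::finite, 'm::finite) fchart set \<Rightarrow> 'a tensor2 \<Rightarrow> 'a set
     \<Rightarrow> ('a tfield \<Rightarrow> 'a tfield \<Rightarrow> 'a tfield) \<Rightarrow> bool" where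
  "levi_civita A g U D \<longleftrightarrow>
     (\<forall>X\<in>vector_fields A U. \<forall>Y\<in>vector_fields A U. D X Y \<in> vector_fields A U) \<and>
     (\<forall>X\<in>vector_fields A U. \<forall>Y\<in>vector_fields A U. \<forall>W\<in>vector_fields A U. \<forall>q\<in>U.
        (\<forall>a b. smooth_fun A U a \<and> smooth_fun A U b \<longrightarrow>
           D (\<lambda>r. lincomb (a r) (X r) (b r) (Y r)) W q = lincomb (a q) (D X W q) (b q) (D Y W q)) \<and>
        D X (\<lambda>r. lincomb 1 (Y r) 1 (W r)) q = lincomb 1 (D X Y q) 1 (D X W q) \<and>
        (\<forall>a. smooth_fun A U a \<longrightarrow>
           D X (\<lambda>r f. a r * Y r f) q = lincomb (X q a) (Y q) (a q) (D X Y q)) \<and>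
        X q (\<lambda>r. g r (Y r) (W r)) = g q (D X Y q) (W q) + g q (Y q) (D X W q) \<and>
        lincomb 1 (D X Y q) (-1) (D Y X q) = lie_bracket A X Y q)"

text \<open>The second fundamental form of the leaves vanishes. The connection \<open>D\<close> exists and is unique
  on \<open>U\<close>, so the existential quantifier merely refers to it.\<close>

definition totally_geodesic_leaves ::
  "('a::topological_space, 'n::finite, 'm::finite) fchart set \<Rightarrow> 'a tensor2 \<Rightarrow> bool" where
  "totally_geodesic_leaves A g \<longleftrightarrow>
     (\<forall>U. open U \<longrightarrow> (\<exists>D. levi_civita A g U D \<and>
        (\<forall>Z\<in>vertical_fields A U. \<forall>W\<in>vertical_fields A U. D Z W \<in> vertical_fields A U)))"


section \<open>Completeness\<close>

definition smooth_curve ::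
  "('a::topological_space, 'n::finite, 'm::finite) fchart set \<Rightarrow> real \<Rightarrow> real \<Rightarrow> (real \<Rightarrow> 'a) \<Rightarrow> bool" where
  "smooth_curve A a b \<gamma> \<longleftrightarrow> continuous_on {a..b} \<gamma> \<and>
     (\<forall>c\<in>A. smooth_on {s \<in> {a..b}. \<gamma> s \<in> cdom c} (cmap c \<circ> \<gamma>))"

definition velocity ::
  "('a::topological_space, 'n::finite, 'm::finite) fchart set \<Rightarrow> real \<Rightarrow> real \<Rightarrow> (real \<Rightarrow> 'a)
     \<Rightarrow> real \<Rightarrow> 'a tvec" where
  "velocity A a b \<gamma> s =
     (\<lambda>f. if smooth_near A (\<gamma> s) f then vector_derivative (f \<circ> \<gamma>) (at s within {a..b}) else 0)"

definition curve_length ::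
  "('a::topological_space, 'n::finite, 'm::finite) fchart set \<Rightarrow> 'a tensor2 \<Rightarrow> real \<Rightarrow> real
     \<Rightarrow> (real \<Rightarrow> 'a) \<Rightarrow> real" where
  "curve_length A g a b \<gamma> =
     integral {a..b} (\<lambda>s. sqrt (g (\<gamma> s) (velocity A a b \<gamma> s) (velocity A a b \<gamma> s)))"

text \<open>There is a piecewise smooth curve, that is, a finite concatenation of smooth curves, from \<open>p\<close>
  to \<open>q\<close> of the given length.\<close>

inductive joined ::
  "('a::topological_space, 'n::finite, 'm::finite) fchart set \<Rightarrow> 'a tensor2 \<Rightarrow> 'a \<Rightarrow> 'a \<Rightarrow> real \<Rightarrow> bool"
  for A g where
  smooth: "a < b \<Longrightarrow> smooth_curve A a b \<gamma> \<Longrightarrow> joined A g (\<gamma> a) (\<gamma> b) (curve_length A g a b \<gamma>)"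
| concat: "joined A g p q k \<Longrightarrow> joined A g q r l \<Longrightarrow> joined A g p r (k + l)"

definition riemannian_dist ::
  "('a::topological_space, 'n::finite, 'm::finite) fchart set \<Rightarrow> 'a tensor2 \<Rightarrow> 'a \<Rightarrow> 'a \<Rightarrow> real" where
  "riemannian_dist A g p q = Inf {l. joined A g p q l}"

definition complete_metric ::
  "('a::topological_space, 'n::finite, 'm::finite) fchart set \<Rightarrow> 'a tensor2 \<Rightarrow> bool" where
  "complete_metric A g \<longleftrightarrow>
     (\<forall>s :: nat \<Rightarrow> 'a.
        (\<forall>e>0. \<exists>N. \<forall>i\<ge>N. \<forall>j\<ge>N. riemannian_dist A g (s i) (s j) < e) \<longrightarrow> (\<exists>p. s \<longlonglongrightarrow> p))"


section \<open>The transverse flow\<close>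

text \<open>The horizontal bundle is that of the initial metric \<open>g0\<close>, and \<open>g t\<close> splits along it. The
  derivative is taken within \<open>I\<close>, hence is one-sided at an end point of \<open>I\<close>.\<close>

definition transverse_flow ::
  "('a::topological_space, 'n::finite, 'm::finite) fchart set \<Rightarrow> 'a tensor2 \<Rightarrow> real set
     \<Rightarrow> (real \<Rightarrow> 'a tensor2) \<Rightarrow> (real \<Rightarrow> 'a tensor2) \<Rightarrow> bool" where
  "transverse_flow A g0 I g h \<longleftrightarrow>
     smooth_metric_family A I g \<and>
     (\<forall>q. \<forall>v\<in>tangent_space A q. \<forall>w\<in>tangent_space A q. g 0 q v w = g0 q v w) \<and>
     (\<forall>t\<in>I. symmetric_tensor2 A (h t) \<and>
       (\<forall>q. \<forall>v\<in>tangent_space A q. \<forall>w\<in>tangent_space A q.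
          v \<in> vertical A q \<or> w \<in> vertical A q \<longrightarrow> h t q v w = 0)) \<and>
     (\<forall>t\<in>I. \<forall>q.
       (\<forall>v\<in>horizontal A g0 q. \<forall>w\<in>vertical A q. g t q v w = 0) \<and>
       (\<forall>v\<in>horizontal A g0 q. \<forall>w\<in>horizontal A g0 q.
          ((\<lambda>s. g s q v w) has_real_derivative h t q v w) (at t within I)) \<and>
       (\<forall>v\<in>vertical A q. \<forall>w\<in>vertical A q.
          ((\<lambda>s. g s q v w) has_real_derivative 0) (at t within I)))"

end

theory Submission
  imports Defs
begin

text \<open>Work in a foliated chart whose image is a product with convex plaques, and let \<open>lift u y\<close> be the
  horizontal lift of the transverse vector \<open>y\<close>. The horizontal bundle and the vertical metric do not
  depend on time. Since \<open>g(t)\<close> is bundle-like, the Gram matrix of the lifted transverse coordinate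
  fields depends on \<open>t\<close> and the transverse coordinates only, so Gram--Schmidt yields a foliate
  orthonormal horizontal frame; brackets of foliate with vertical fields are vertical, and total
  geodesy makes them skew in an orthonormal vertical frame. Finally both frames are rotated by
  orthogonal matrices that are the identity at \<open>x\<close> and whose first derivative there cancels the
  structure functions: for the vertical frame it is read off the brackets with the lifts of the
  coordinate fields, which makes it independent of \<open>t\<close>, and for the horizontal frame it is given by
  the Koszul formula of the transverse metric.\<close>

section \<open>Calculus of smooth maps\<close>

text \<open>One obstacle is that the vertical frame must not depend on \<open>t\<close>, although
  its brackets with every X_i(t) have to vanish at x for all \<open>t\<close>. Write X_i(t) as the
  sum over a of B_ia lift(e_a). The coefficients B_ia are constant along the leaves, so [X_i, Z] is
  the sum of B_ia [lift(e_a), Z], and it is enough to kill finitely many brackets that do not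
  involve time. The two corrections exist for different reasons. In the vertical case the bracket
  coefficients generate a rotation only because total geodesy makes them skew. In the horizontal
  case the structure functions are merely skew in their first two indices, and they are absorbed as
  the torsion of a metric connection is. Frames must stay exactly orthonormal near x and be jointly
  smooth in time and space. Rotations are therefore built from Gram--Schmidt instead of the
  exponential series: the calculus then involves only products and inverse square roots. Local
  extensions are used throughout, since \<open>I\<close> may have end points and positive definite
  matrices need not form an open set of matrices.\<close>

lemma Ck_on_cong:
  assumes "open W" "\<And>x. x \<in> W \<Longrightarrow> f x = g x"
  shows "Ck_on k W f \<longleftrightarrow> Ck_on k W g"
  using assms(2)
proof (induction k arbitrary: f g)
  case 0
  then show ?case by (auto cong: continuous_on_cong)
next
  case (Suc k)
  have *: "Ck_on (Suc k) W g" if eq: "\<And>x. x \<in> W \<Longrightarrow> f x = g x" and f: "Ck_on (Suc k) W f"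
    for f g :: "'a \<Rightarrow> 'b"
  proof -
    have d: "(g has_derivative frechet_derivative f (at x)) (at x)" if "x \<in> W" for x
    proof (rule has_derivative_transform_within_open[OF _ assms(1) that eq])
      show "(f has_derivative frechet_derivative f (at x)) (at x)"
        using f that by (auto simp: frechet_derivative_works[symmetric])
    qed
    then have "frechet_derivative g (at x) = frechet_derivative f (at x)" if "x \<in> W" for x
      using frechet_derivative_at that by metis
    then have "Ck_on k W (\<lambda>x. frechet_derivative g (at x) v)" for v
      using f Suc.IH[of "\<lambda>x. frechet_derivative g (at x) v" "\<lambda>x. frechet_derivative f (at x) v"]
      by auto
    with d show ?thesis by (auto simp: differentiable_def)
  qed
  show ?case using *[of f g] *[of g f] Suc.prems by metis
qed

lemma Ck_on_subset: "Ck_on k W f \<Longrightarrow> W' \<subseteq> W \<Longrightarrow> Ck_on k W' f"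
  by (induction k arbitrary: f) (auto intro: continuous_on_subset)

text \<open>\<open>Ck_on\<close> is phrased with \<open>frechet_derivative\<close>; this rule lets
  later inductions work with an explicit formula for the derivative.\<close>

lemma Ck_on_SucI:
  assumes "open W" "\<And>x. x \<in> W \<Longrightarrow> (f has_derivative f' x) (at x)"
    and "\<And>v. Ck_on k W (\<lambda>x. f' x v)"
  shows "Ck_on (Suc k) W f"
proof -
  have "frechet_derivative f (at x) = f' x" if "x \<in> W" for x
    using frechet_derivative_at assms(2)[OF that] by metis
  then have "Ck_on k W (\<lambda>x. frechet_derivative f (at x) v)" for v
    using assms(3)[of v] Ck_on_cong[OF assms(1), of "\<lambda>x. frechet_derivative f (at x) v" "\<lambda>x. f' x v"]
    by auto
  then show ?thesis using assms(2) by (auto simp: differentiable_def)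
qed

lemma Ck_on_SucD:
  assumes "Ck_on (Suc k) W f" "x \<in> W"
  shows "(f has_derivative frechet_derivative f (at x)) (at x)"
  using assms by (auto simp: frechet_derivative_works[symmetric])

lemma Ck_on_Suc_imp: "Ck_on (Suc k) W f \<Longrightarrow> Ck_on k W f"
proof (induction k arbitrary: f)
  case 0
  then show ?case
    by (auto intro!: continuous_at_imp_continuous_on differentiable_imp_continuous_within)
next
  case (Suc k)
  from Suc.prems have "\<forall>v. Ck_on (Suc k) W (\<lambda>x. frechet_derivative f (at x) v)" by simp
  then have "\<forall>v. Ck_on k W (\<lambda>x. frechet_derivative f (at x) v)" using Suc.IH by blast
  with Suc.prems show ?case by simp
qed

lemma Ck_on_const: "Ck_on k W (\<lambda>x. c)"
  by (induction k arbitrary: c) auto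

lemma Ck_on_add:
  assumes W: "open W"
  shows "Ck_on k W f \<Longrightarrow> Ck_on k W g \<Longrightarrow> Ck_on k W (\<lambda>x. f x + g x)"
proof (induction k arbitrary: f g)
  case 0
  then show ?case by (auto intro: continuous_intros)
next
  case (Suc k)
  show ?case
  proof (rule Ck_on_SucI[OF W])
    show "((\<lambda>x. f x + g x) has_derivative
        (\<lambda>v. frechet_derivative f (at x) v + frechet_derivative g (at x) v)) (at x)" if "x \<in> W" for x
      using Ck_on_SucD[OF Suc.prems(1) that] Ck_on_SucD[OF Suc.prems(2) that]
      by (rule has_derivative_add)
  qed (use Suc in auto)
qed

lemma Ck_on_bilinear:
  assumes W: "open W" and h: "bounded_bilinear h"
  shows "Ck_on k W f \<Longrightarrow> Ck_on k W g \<Longrightarrow> Ck_on k W (\<lambda>x. h (f x) (g x))"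
proof (induction k arbitrary: f g)
  case 0
  then show ?case by (auto intro: bounded_bilinear.continuous_on[OF h])
next
  case (Suc k)
  show ?case
  proof (rule Ck_on_SucI[OF W])
    show "((\<lambda>x. h (f x) (g x)) has_derivative
        (\<lambda>v. h (f x) (frechet_derivative g (at x) v) + h (frechet_derivative f (at x) v) (g x))) (at x)"
      if "x \<in> W" for x
      using bounded_bilinear.FDERIV[OF h Ck_on_SucD[OF Suc.prems(1) that] Ck_on_SucD[OF Suc.prems(2) that]] .
  next
    fix v
    show "Ck_on k W (\<lambda>x. h (f x) (frechet_derivative g (at x) v) + h (frechet_derivative f (at x) v) (g x))"
      using Suc.prems Suc.prems[THEN Ck_on_Suc_imp] by (intro Ck_on_add[OF W] Suc.IH) auto
  qed
qed

lemma Ck_on_bounded_linear: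
  assumes W: "open W" and h: "bounded_linear h"
  shows "Ck_on k W h"
proof (cases k)
  case 0
  then show ?thesis using bounded_linear.continuous_on[OF h continuous_on_id] by simp
next
  case (Suc j)
  show ?thesis unfolding Suc
    by (rule Ck_on_SucI[OF W, where f' = "\<lambda>x. h"])
      (auto intro: bounded_linear.has_derivative[OF h] Ck_on_const bounded_linear_imp_has_derivative h)
qed

lemma Ck_on_sum:
  assumes W: "open W"
  shows "(\<And>i. i \<in> J \<Longrightarrow> Ck_on k W (f i)) \<Longrightarrow> Ck_on k W (\<lambda>x. \<Sum>i\<in>J. f i x)"
  by (induction J rule: infinite_finite_induct) (auto intro: Ck_on_const Ck_on_add[OF W])

text \<open>Expanding the inner derivative in \<open>Basis\<close> turns the chain rule into a sum
  of products of \<open>f' x v \<bullet> b\<close> and \<open>g' (f x) b\<close>. The second factor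
  is again a composite with the same \<open>f\<close>, which is why the induction varies only
  \<open>g\<close> and the middle space is Euclidean.\<close>

lemma Ck_on_compose:
  fixes f :: "'a::real_normed_vector \<Rightarrow> 'b::euclidean_space"
    and g :: "'b \<Rightarrow> 'c::real_normed_vector"
  assumes W: "open W" and W': "open W'" and sub: "f ` W \<subseteq> W'"
  shows "Ck_on k W f \<Longrightarrow> Ck_on k W' g \<Longrightarrow> Ck_on k W (\<lambda>x. g (f x))"
  using sub
proof (induction k arbitrary: g)
  case 0
  then show ?case by (auto intro: continuous_on_compose2)
next
  case (Suc k)
  define f' where "f' x = frechet_derivative f (at x)" for x
  define g' where "g' x = frechet_derivative g (at x)" for x
  have g': "(g has_derivative g' y) (at y)" if "y \<in> W'" for y
    unfolding g'_def using Ck_on_SucD[OF Suc.prems(2) that] .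
  have eq: "g' y v = (\<Sum>b\<in>Basis. (v \<bullet> b) *\<^sub>R g' y b)" if "y \<in> W'" for y v
  proof -
    interpret linear "g' y" using g'[OF that] by (rule has_derivative_linear)
    have "g' y v = g' y (\<Sum>b\<in>Basis. (v \<bullet> b) *\<^sub>R b)" by (simp add: euclidean_representation)
    then show ?thesis by (simp add: sum scale)
  qed
  show ?case
  proof (rule Ck_on_SucI[OF W, where f' = "\<lambda>x v. \<Sum>b\<in>Basis. (f' x v \<bullet> b) *\<^sub>R g' (f x) b"])
    fix x assume x: "x \<in> W"
    then have "((\<lambda>x. g (f x)) has_derivative (\<lambda>v. g' (f x) (f' x v))) (at x)"
      unfolding f'_def
      using diff_chain_at[OF Ck_on_SucD[OF Suc.prems(1) x] g'] sub by (auto simp: o_def)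
    moreover have "(\<lambda>v. g' (f x) (f' x v)) = (\<lambda>v. \<Sum>b\<in>Basis. (f' x v \<bullet> b) *\<^sub>R g' (f x) b)"
      using eq x sub by blast
    ultimately show "((\<lambda>x. g (f x)) has_derivative
      (\<lambda>v. \<Sum>b\<in>Basis. (f' x v \<bullet> b) *\<^sub>R g' (f x) b)) (at x)" by simp
  next
    fix v
    have 1: "Ck_on k W (\<lambda>x. f' x v \<bullet> b)" for b
      unfolding f'_def using Suc.prems
      by (intro Ck_on_bilinear[OF W bounded_bilinear_inner] Ck_on_const) auto
    have 2: "Ck_on k W (\<lambda>x. g' (f x) b)" for b
      unfolding g'_def using Suc.prems Ck_on_Suc_imp
      by (intro Suc.IH) (auto simp del: Ck_on.simps(2) simp: Ck_on.simps(2)[of k _ g])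
    show "Ck_on k W (\<lambda>x. \<Sum>b\<in>Basis. (f' x v \<bullet> b) *\<^sub>R g' (f x) b)"
      by (intro Ck_on_sum[OF W] Ck_on_bilinear[OF W bounded_bilinear_scaleR] 1 2)
  qed
qed

definition rsqrt :: "real \<Rightarrow> real" where
  "rsqrt x = inverse (sqrt x)"

text \<open>The derivative of \<open>rsqrt\<close> is -1/2 times its cube, a polynomial in
  \<open>rsqrt\<close> itself, so the product rule closes the induction. Normalising vectors in
  Gram--Schmidt uses no other non-polynomial function.\<close>

lemma Ck_on_rsqrt: "Ck_on k {0<..} rsqrt"
proof (induction k)
  case 0
  then show ?case by (auto simp: rsqrt_def intro!: continuous_intros)
next
  case (Suc k)
  have W: "open {0::real<..}" by simp
  show ?case
  proof (rule Ck_on_SucI[OF W])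
    show "(rsqrt has_derivative (\<lambda>v. (-1/2 * v) * (rsqrt x * (rsqrt x * rsqrt x)))) (at x)"
      if "x \<in> {0<..}" for x
    proof -
      have "(rsqrt has_real_derivative - (inverse (sqrt x) * (inverse (sqrt x) / 2) * inverse (sqrt x))) (at x)"
        unfolding rsqrt_def using that by (auto intro!: derivative_eq_intros)
      then show ?thesis
        unfolding has_field_derivative_def
        by (rule has_derivative_eq_rhs) (simp add: fun_eq_iff rsqrt_def)
    qed
    show "Ck_on k {0<..} (\<lambda>x. (-1/2 * v) * (rsqrt x * (rsqrt x * rsqrt x)))" for v
      by (intro Ck_on_bilinear[OF W bounded_bilinear_mult] Suc Ck_on_const)
  qed
qed

section \<open>Smooth maps on arbitrary sets, through local extensions\<close>

definition Cinf_on :: "'a::real_normed_vector set \<Rightarrow> ('a \<Rightarrow> 'b::real_normed_vector) \<Rightarrow> bool" where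
  "Cinf_on W f \<longleftrightarrow> open W \<and> (\<forall>k. Ck_on k W f)"

lemma smooth_on_Cinf:
  "smooth_on S f \<longleftrightarrow> (\<forall>x\<in>S. \<exists>W F. x \<in> W \<and> Cinf_on W F \<and> (\<forall>y\<in>W \<inter> S. F y = f y))"
  unfolding smooth_on_def Cinf_on_def by (intro ball_cong refl ex_cong1) auto

lemma Cinf_on_has_derivative:
  "Cinf_on W f \<Longrightarrow> x \<in> W \<Longrightarrow> (f has_derivative frechet_derivative f (at x)) (at x)"
  unfolding Cinf_on_def using Ck_on_SucD by blast

lemma Cinf_on_derivative:
  assumes "Cinf_on W f" shows "Cinf_on W (\<lambda>x. frechet_derivative f (at x) v)"
  unfolding Cinf_on_def
proof safe
  show "open W" using assms by (simp add: Cinf_on_def)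
  show "Ck_on k W (\<lambda>x. frechet_derivative f (at x) v)" for k
    using assms[unfolded Cinf_on_def, THEN conjunct2, rule_format, of "Suc k"] by simp
qed

lemma smooth_onI_open: "Cinf_on S f \<Longrightarrow> smooth_on S f"
  unfolding smooth_on_Cinf by blast

lemma smooth_on_cong: "(\<And>x. x \<in> S \<Longrightarrow> f x = g x) \<Longrightarrow> smooth_on S f \<longleftrightarrow> smooth_on S g"
  unfolding smooth_on_def by (intro ball_cong refl ex_cong1) auto

lemma smooth_on_subset: "smooth_on S f \<Longrightarrow> T \<subseteq> S \<Longrightarrow> smooth_on T f"
  unfolding smooth_on_Cinf by (meson IntD1 IntD2 IntI subsetD)

lemma smooth_on_const [intro]: "smooth_on S (\<lambda>x. c)"
  by (rule smooth_on_subset[of UNIV]) (auto intro!: smooth_onI_open simp: Cinf_on_def Ck_on_const)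

lemma smooth_on_bounded_linear: "bounded_linear h \<Longrightarrow> smooth_on S h"
  by (rule smooth_on_subset[of UNIV])
    (auto intro!: smooth_onI_open simp: Cinf_on_def Ck_on_bounded_linear)

lemma smooth_on_bilinear:
  assumes "bounded_bilinear h" "smooth_on S f" "smooth_on S g"
  shows "smooth_on S (\<lambda>x. h (f x) (g x))"
  unfolding smooth_on_Cinf
proof
  fix x assume x: "x \<in> S"
  obtain W F where F: "x \<in> W" "Cinf_on W F" "\<forall>y\<in>W \<inter> S. F y = f y"
    using assms(2) x unfolding smooth_on_Cinf by blast
  obtain W' G where G: "x \<in> W'" "Cinf_on W' G" "\<forall>y\<in>W' \<inter> S. G y = g y"
    using assms(3) x unfolding smooth_on_Cinf by blast
  have "Cinf_on (W \<inter> W') (\<lambda>x. h (F x) (G x))"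
    unfolding Cinf_on_def
  proof safe
    fix k
    have "Ck_on k (W \<inter> W') F" "Ck_on k (W \<inter> W') G" "open (W \<inter> W')"
      using F(2) G(2) unfolding Cinf_on_def by (meson Ck_on_subset Int_lower1 Int_lower2 open_Int)+
    then show "open (W \<inter> W')" "Ck_on k (W \<inter> W') (\<lambda>x. h (F x) (G x))"
      by (simp, intro Ck_on_bilinear[OF _ assms(1)])
  qed
  then show "\<exists>W F. x \<in> W \<and> Cinf_on W F \<and> (\<forall>y\<in>W \<inter> S. F y = h (f y) (g y))"
    using F G by (intro exI[of _ "W \<inter> W'"] exI[of _ "\<lambda>x. h (F x) (G x)"]) auto
qed

lemmas smooth_on_mult = smooth_on_bilinear[OF bounded_bilinear_mult]
lemmas smooth_on_scaleR = smooth_on_bilinear[OF bounded_bilinear_scaleR]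
lemmas smooth_on_inner = smooth_on_bilinear[OF bounded_bilinear_inner]

lemma smooth_on_add:
  assumes "smooth_on S f" "smooth_on S g"
  shows "smooth_on S (\<lambda>x. f x + g x)"
  unfolding smooth_on_Cinf
proof
  fix x assume x: "x \<in> S"
  obtain W F where F: "x \<in> W" "Cinf_on W F" "\<forall>y\<in>W \<inter> S. F y = f y"
    using assms(1) x unfolding smooth_on_Cinf by blast
  obtain W' G where G: "x \<in> W'" "Cinf_on W' G" "\<forall>y\<in>W' \<inter> S. G y = g y"
    using assms(2) x unfolding smooth_on_Cinf by blast
  have "Cinf_on (W \<inter> W') (\<lambda>x. F x + G x)"
    unfolding Cinf_on_def
  proof safe
    fix k
    have "Ck_on k (W \<inter> W') F" "Ck_on k (W \<inter> W') G" "open (W \<inter> W')"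
      using F(2) G(2) unfolding Cinf_on_def by (meson Ck_on_subset Int_lower1 Int_lower2 open_Int)+
    then show "open (W \<inter> W')" "Ck_on k (W \<inter> W') (\<lambda>x. F x + G x)"
      by (simp, intro Ck_on_add)
  qed
  then show "\<exists>W F. x \<in> W \<and> Cinf_on W F \<and> (\<forall>y\<in>W \<inter> S. F y = f y + g y)"
    using F G by (intro exI[of _ "W \<inter> W'"] exI[of _ "\<lambda>x. F x + G x"]) auto
qed

lemma smooth_on_sum: "(\<And>i. i \<in> J \<Longrightarrow> smooth_on S (f i)) \<Longrightarrow> smooth_on S (\<lambda>x. \<Sum>i\<in>J. f i x)"
  by (induction J rule: infinite_finite_induct) (auto intro: smooth_on_add)

lemma smooth_on_compose:
  fixes f :: "'a::real_normed_vector \<Rightarrow> 'b::euclidean_space"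
    and g :: "'b \<Rightarrow> 'c::real_normed_vector"
  assumes "smooth_on S f" "smooth_on T g" "f ` S \<subseteq> T"
  shows "smooth_on S (\<lambda>x. g (f x))"
  unfolding smooth_on_Cinf
proof
  fix x assume x: "x \<in> S"
  obtain W F where F: "x \<in> W" "Cinf_on W F" "\<forall>y\<in>W \<inter> S. F y = f y"
    using assms(1) x unfolding smooth_on_Cinf by blast
  obtain W' G where G: "f x \<in> W'" "Cinf_on W' G" "\<forall>y\<in>W' \<inter> T. G y = g y"
    using assms(2,3) x unfolding smooth_on_Cinf by blast
  \<comment> \<open>Away from \<open>x\<close> the extension of \<open>f\<close> may leave the set
    where the extension of \<open>g\<close> is smooth, so the neighbourhood is shrunk to this open
    preimage.\<close>
  define V where "V = W \<inter> F -` W'"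
  have "continuous_on W F" using F(2) unfolding Cinf_on_def by (metis Ck_on.simps(1))
  then have V: "open V" unfolding V_def
    using F(2) G(2) unfolding Cinf_on_def by (simp add: continuous_open_preimage)
  have C: "Cinf_on V (\<lambda>x. G (F x))"
    unfolding Cinf_on_def
  proof safe
    fix k
    have "Ck_on k V F" "Ck_on k W' G" "open W'"
      using F(2) G(2) Ck_on_subset[of k W F V] by (auto simp: V_def Cinf_on_def)
    then show "Ck_on k V (\<lambda>x. G (F x))"
      by (intro Ck_on_compose[where f = F and g = G and W' = W'] V) (auto simp: V_def)
  qed (rule V)
  show "\<exists>W F. x \<in> W \<and> Cinf_on W F \<and> (\<forall>y\<in>W \<inter> S. F y = g (f y))"
  proof (intro exI conjI ballI)
    show "Cinf_on V (\<lambda>x. G (F x))" by (rule C)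
    show "x \<in> V" using F(1,3) G(1) x by (simp add: V_def)
    fix y assume y: "y \<in> V \<inter> S"
    then have "F y = f y" using F(3) by (simp add: V_def)
    moreover have "f y \<in> W' \<inter> T" using y \<open>F y = f y\<close> assms(3) by (auto simp: V_def)
    ultimately show "G (F y) = g (f y)" using G(3) by simp
  qed
qed

lemma smooth_on_linear_compose:
  fixes f :: "'a::real_normed_vector \<Rightarrow> 'b::euclidean_space"
  shows "bounded_linear h \<Longrightarrow> smooth_on S f \<Longrightarrow> smooth_on S (\<lambda>x. h (f x))"
  by (rule smooth_on_compose[where T = UNIV]) (auto intro: smooth_on_bounded_linear)

lemma smooth_on_rsqrt:
  assumes "smooth_on S f" "\<And>x. x \<in> S \<Longrightarrow> f x > 0"
  shows "smooth_on S (\<lambda>x. rsqrt (f x))"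
  by (rule smooth_on_compose[OF assms(1), where T = "{0<..}"])
    (use assms(2) in \<open>auto intro!: smooth_onI_open simp: Cinf_on_def Ck_on_rsqrt\<close>)

lemma smooth_on_uminus: "smooth_on S f \<Longrightarrow> smooth_on S (\<lambda>x. - f x)"
  using smooth_on_scaleR[OF smooth_on_const[of S "-1"], of f] by simp

lemma smooth_on_diff: "smooth_on S f \<Longrightarrow> smooth_on S g \<Longrightarrow> smooth_on S (\<lambda>x. f x - g x)"
  using smooth_on_add[OF _ smooth_on_uminus, of S f g] by simp

lemma smooth_on_Pair:
  fixes f :: "'a::real_normed_vector \<Rightarrow> 'b::euclidean_space"
    and g :: "'a \<Rightarrow> 'c::euclidean_space"
  assumes "smooth_on S f" "smooth_on S g"
  shows "smooth_on S (\<lambda>x. (f x, g x))"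
proof -
  have "bounded_linear (\<lambda>x::'b. (x, 0::'c))" "bounded_linear (\<lambda>x::'c. (0::'b, x))"
    by (auto intro: bounded_linear_Pair)
  then have "smooth_on S (\<lambda>x. (f x, 0) + (0, g x))"
    by (intro smooth_on_add smooth_on_linear_compose[of "\<lambda>x. (x, 0)"]
        smooth_on_linear_compose[of "\<lambda>x. (0, x)"] assms)
  then show ?thesis by simp
qed

lemma smooth_on_fst:
  fixes f :: "'a::real_normed_vector \<Rightarrow> 'b::euclidean_space \<times> 'c::euclidean_space"
  shows "smooth_on S f \<Longrightarrow> smooth_on S (\<lambda>x. fst (f x))"
  by (rule smooth_on_linear_compose[OF bounded_linear_fst])

lemma smooth_on_vec_nth:
  fixes f :: "'a::real_normed_vector \<Rightarrow> 'b::euclidean_space ^ 'n"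
  shows "smooth_on S f \<Longrightarrow> smooth_on S (\<lambda>x. f x $ i)"
  by (rule smooth_on_linear_compose[OF bounded_linear_vec_nth])

lemma bounded_linear_axis: "bounded_linear (\<lambda>c::'b::euclidean_space. axis i c)"
  by (rule linear_conv_bounded_linear[THEN iffD1])
    (auto intro!: linearI simp: axis_def vec_eq_iff)

lemma smooth_on_vec_lambda:
  fixes f :: "'i::finite \<Rightarrow> 'a::real_normed_vector \<Rightarrow> 'b::euclidean_space"
  assumes "\<And>i. smooth_on S (f i)"
  shows "smooth_on S (\<lambda>x. \<chi> i. f i x)"
proof -
  have eq: "(\<chi> i. f i x) = (\<Sum>i\<in>UNIV. axis i (f i x))" for x
    by (simp add: vec_eq_iff axis_def)
  show ?thesis unfolding eq
    by (intro smooth_on_sum smooth_on_linear_compose[OF bounded_linear_axis] assms)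
qed

lemma smooth_on_imp_continuous_on:
  assumes "smooth_on S f" shows "continuous_on S f"
  unfolding continuous_on_eq_continuous_within
proof
  fix x assume x: "x \<in> S"
  obtain W F where F: "x \<in> W" "Cinf_on W F" "\<forall>y\<in>W \<inter> S. F y = f y"
    using assms x unfolding smooth_on_Cinf by blast
  have "isCont F x" using Cinf_on_has_derivative[OF F(2,1)] by (rule has_derivative_continuous)
  then have "continuous (at x within S) F" by (rule continuous_at_imp_continuous_at_within)
  then have "(F \<longlongrightarrow> f x) (at x within S)"
    using F x by (simp add: continuous_within)
  moreover have "eventually (\<lambda>y. F y = f y) (at x within S)"
    using F x unfolding eventually_at_topological Cinf_on_def by blast
  ultimately have "(f \<longlongrightarrow> f x) (at x within S)"
    by (rule Lim_transform_eventually)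
  then show "continuous (at x within S) f" by (simp add: continuous_within)
qed

text \<open>On \<open>I \<times> V\<close> with \<open>V\<close> open, differentiation in the second variable is meaningful even if \<open>I\<close>
  has empty interior, and it preserves smoothness.\<close>

lemma smooth_on_time_has_derivative:
  assumes f: "smooth_on (I \<times> V) (\<lambda>(t, u). f t u)" and V: "open V" and tu: "t \<in> I" "u \<in> V"
  shows "(f t has_derivative frechet_derivative (f t) (at u)) (at u)"
proof -
  obtain W F where F: "(t, u) \<in> W" "Cinf_on W F" "\<forall>y\<in>W \<inter> (I \<times> V). F y = (case y of (t, u) \<Rightarrow> f t u)"
    using f tu unfolding smooth_on_Cinf by blast
  obtain A B where AB: "open A" "open B" "t \<in> A" "u \<in> B" "A \<times> B \<subseteq> W"
    using F(1,2) unfolding Cinf_on_def by (auto elim: open_prod_elim)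
  \<comment> \<open>Only the slice of the extension at the fixed time is differentiated, along
    \<open>(0, v)\<close>, so openness is required of \<open>V\<close> alone.\<close>
  have "((\<lambda>u. F (t, u)) has_derivative (\<lambda>v. frechet_derivative F (at (t, u)) (0, v))) (at u)"
    using diff_chain_at[OF has_derivative_Pair[OF has_derivative_const has_derivative_ident],
        OF Cinf_on_has_derivative[OF F(2,1)]] by (simp add: o_def)
  then have "(f t has_derivative (\<lambda>v. frechet_derivative F (at (t, u)) (0, v))) (at u)"
    by (rule has_derivative_transform_within_open[where s = "B \<inter> V"])
      (use AB V F(3) tu in auto)
  then show ?thesis using frechet_derivative_at by metis
qed

lemma smooth_on_time_derivative:
  assumes f: "smooth_on (I \<times> V) (\<lambda>(t, u). f t u)" and V: "open V"
  shows "smooth_on (I \<times> V) (\<lambda>(t, u). frechet_derivative (f t) (at u) v)"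
  unfolding smooth_on_Cinf
proof
  fix p assume p: "p \<in> I \<times> V"
  then obtain W F where F: "p \<in> W" "Cinf_on W F" "\<forall>y\<in>W \<inter> (I \<times> V). F y = (case y of (t, u) \<Rightarrow> f t u)"
    using f unfolding smooth_on_Cinf by blast
  have "frechet_derivative F (at y) (0, v) = (case y of (t, u) \<Rightarrow> frechet_derivative (f t) (at u) v)"
    if y: "y \<in> W \<inter> (I \<times> V)" for y
  proof -
    obtain t u where tu: "y = (t, u)" by (cases y)
    obtain A B where AB: "open A" "open B" "t \<in> A" "u \<in> B" "A \<times> B \<subseteq> W"
      using F(2) y tu unfolding Cinf_on_def by (metis Int_iff mem_Sigma_iff open_prod_elim)
    have "((\<lambda>u. F (t, u)) has_derivative (\<lambda>v. frechet_derivative F (at (t, u)) (0, v))) (at u)"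
      using diff_chain_at[OF has_derivative_Pair[OF has_derivative_const has_derivative_ident],
        OF Cinf_on_has_derivative[OF F(2)], of t u] y tu by (simp add: o_def)
    then have "(f t has_derivative (\<lambda>v. frechet_derivative F (at (t, u)) (0, v))) (at u)"
      by (rule has_derivative_transform_within_open[where s = "B \<inter> V"])
        (use AB V F(3) tu y in auto)
    then show ?thesis using frechet_derivative_at tu by (metis case_prod_conv)
  qed
  then show "\<exists>W F. p \<in> W \<and> Cinf_on W F \<and>
      (\<forall>y\<in>W \<inter> (I \<times> V). F y = (case y of (t, u) \<Rightarrow> frechet_derivative (f t) (at u) v))"
    using Cinf_on_derivative[OF F(2)] F(1)
    by (intro exI[of _ W] exI[of _ "\<lambda>y. frechet_derivative F (at y) (0, v)"]) auto
qed

text \<open>On an open set the local extensions agree with \<open>f\<close> near each point, and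
  hence so do their derivatives. The induction runs on a localised hypothesis for a single
  \<open>k\<close>, because it has to be re-established for the derivatives of
  \<open>f\<close>.\<close>

lemma smooth_on_Cinf_onD:
  assumes "smooth_on V f" "open V" shows "Cinf_on V f"
proof -
  have "Ck_on k V f" if "\<forall>x\<in>V. \<exists>W F. x \<in> W \<and> open W \<and> Ck_on k W F \<and> (\<forall>y\<in>W \<inter> V. F y = f y)"
    for k f using that
  proof (induction k arbitrary: f)
    case 0
    have "continuous (at x) f" if x: "x \<in> V" for x
    proof -
      obtain W F where F: "x \<in> W" "open W" "continuous_on W F" "\<forall>y\<in>W \<inter> V. F y = f y"
        using 0 x by auto
      have "continuous_on (W \<inter> V) f"
        using continuous_on_subset[OF F(3)] F(4) by (metis Int_lower1 continuous_on_eq)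
      then show ?thesis using F x assms(2) by (simp add: continuous_on_eq_continuous_at open_Int)
    qed
    then show ?case by (auto intro: continuous_at_imp_continuous_on)
  next
    case (Suc k)
    have *: "\<exists>W F. x \<in> W \<and> open W \<and> W \<subseteq> V \<and> Ck_on (Suc k) W f" if x: "x \<in> V" for x
    proof -
      obtain W F where F: "x \<in> W" "open W" "Ck_on (Suc k) W F" "\<forall>y\<in>W \<inter> V. F y = f y"
        using Suc.prems x by meson
      have "Ck_on (Suc k) (W \<inter> V) F" using F(3) Ck_on_subset Int_lower1 by metis
      then have "Ck_on (Suc k) (W \<inter> V) f"
        using Ck_on_cong[of "W \<inter> V" F f "Suc k"] F assms(2) by blast
      then show ?thesis using F x assms(2) by (intro exI[of _ "W \<inter> V"]) auto
    qed
    have "f differentiable at x" if "x \<in> V" for x using *[OF that] by auto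
    moreover have "Ck_on k V (\<lambda>x. frechet_derivative f (at x) v)" for v
    proof (rule Suc.IH, rule ballI)
      fix x assume "x \<in> V"
      then obtain W where "x \<in> W" "open W" "Ck_on (Suc k) W f" using * by meson
      then show "\<exists>W F. x \<in> W \<and> open W \<and> Ck_on k W F \<and> (\<forall>y\<in>W \<inter> V. F y = frechet_derivative f (at y) v)"
        by (intro exI[of _ W] exI[of _ "\<lambda>x. frechet_derivative f (at x) v"]) simp
    qed
    ultimately show ?case by simp
  qed
  note * = this
  have "Ck_on k V f" for k
  proof (rule *, rule ballI)
    fix x assume "x \<in> V"
    then obtain W F where "x \<in> W" "Cinf_on W F" "\<forall>y\<in>W \<inter> V. F y = f y"
      using assms(1) unfolding smooth_on_Cinf by meson
    then show "\<exists>W F. x \<in> W \<and> open W \<and> Ck_on k W F \<and> (\<forall>y\<in>W \<inter> V. F y = f y)"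
      by (intro exI[of _ W] exI[of _ F]) (simp add: Cinf_on_def)
  qed
  then show ?thesis using assms(2) by (simp add: Cinf_on_def)
qed

lemma smooth_on_has_derivative:
  "smooth_on V f \<Longrightarrow> open V \<Longrightarrow> u \<in> V \<Longrightarrow> (f has_derivative frechet_derivative f (at u)) (at u)"
  using Cinf_on_has_derivative smooth_on_Cinf_onD by blast

lemma smooth_on_derivative:
  "smooth_on V f \<Longrightarrow> open V \<Longrightarrow> smooth_on V (\<lambda>u. frechet_derivative f (at u) v)"
  using Cinf_on_derivative smooth_on_Cinf_onD smooth_onI_open by blast

section \<open>Symmetry of mixed second derivatives\<close>

text \<open>Two mean value steps, along \<open>a\<close> and then along \<open>b\<close>, turn the
  quotient into the value of the mixed derivative \<open>f2\<close> at an intermediate point;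
  continuity of \<open>f2\<close> at \<open>u\<close> gives the limit. The one-sided limit keeps
  both mean value intervals of the form from 0 to \<open>s\<close>.\<close>

lemma second_difference_limit:
  fixes f :: "'a::real_normed_vector \<Rightarrow> real"
  assumes f: "smooth_on V f" and V: "open V" "u \<in> V"
  shows "((\<lambda>s. (f (u + s *\<^sub>R a + s *\<^sub>R b) - f (u + s *\<^sub>R a) - f (u + s *\<^sub>R b) + f u) / s\<^sup>2) \<longlongrightarrow>
    frechet_derivative (\<lambda>w. frechet_derivative f (at w) a) (at u) b) (at_right 0)"
proof -
  define f1 where "f1 w = frechet_derivative f (at w) a" for w
  define f2 where "f2 w = frechet_derivative f1 (at w) b" for w
  have f1: "smooth_on V f1" unfolding f1_def by (rule smooth_on_derivative[OF f V(1)])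
  have f2: "smooth_on V f2" unfolding f2_def by (rule smooth_on_derivative[OF f1 V(1)])
  have cont: "isCont f2 u" using smooth_on_imp_continuous_on[OF f2] V
    by (simp add: continuous_on_eq_continuous_at)
  have df: "((\<lambda>r. f (p + r *\<^sub>R a)) has_real_derivative f1 (p + r *\<^sub>R a)) (at r)"
    if "p + r *\<^sub>R a \<in> V" for p r
  proof -
    have d: "(f has_derivative frechet_derivative f (at (p + r *\<^sub>R a))) (at (p + r *\<^sub>R a))"
      by (rule smooth_on_has_derivative[OF f V(1) that])
    have "((\<lambda>r. p + r *\<^sub>R a) has_derivative (\<lambda>r. r *\<^sub>R a)) (at r)"
      by (auto intro!: derivative_eq_intros)
    from diff_chain_at[OF this d] show ?thesis
      using linear_cmul[OF has_derivative_linear[OF d]]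
      by (simp add: o_def has_field_derivative_def f1_def mult_commute_abs)
  qed
  have df1: "((\<lambda>r. f1 (p + r *\<^sub>R b)) has_real_derivative f2 (p + r *\<^sub>R b)) (at r)"
    if "p + r *\<^sub>R b \<in> V" for p r
  proof -
    have d: "(f1 has_derivative frechet_derivative f1 (at (p + r *\<^sub>R b))) (at (p + r *\<^sub>R b))"
      by (rule smooth_on_has_derivative[OF f1 V(1) that])
    have "((\<lambda>r. p + r *\<^sub>R b) has_derivative (\<lambda>r. r *\<^sub>R b)) (at r)"
      by (auto intro!: derivative_eq_intros)
    from diff_chain_at[OF this d] show ?thesis
      using linear_cmul[OF has_derivative_linear[OF d]]
      by (simp add: o_def has_field_derivative_def f2_def mult_commute_abs)
  qed
  show ?thesis
    unfolding f1_def[symmetric] f2_def[symmetric]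
  proof (rule tendstoI)
    fix e :: real assume e: "e > 0"
    obtain d1 where d1: "d1 > 0" "ball u d1 \<subseteq> V" using V open_contains_ball by blast
    obtain d2 where d2: "d2 > 0" "\<And>w. dist w u < d2 \<Longrightarrow> dist (f2 w) (f2 u) < e"
      using cont e unfolding continuous_at_eps_delta by blast
    \<comment> \<open>With step lengths at most \<open>s < d\<close>, all intermediate points stay
      within \<open>min d1 d2\<close> of \<open>u\<close>. The summand 1 keeps the denominator
      positive when \<open>a\<close> and \<open>b\<close> are both zero.\<close>
    define d where "d = min d1 d2 / (norm a + norm b + 1)"
    have n: "norm a + norm b + 1 > 0" by (smt (verit) norm_ge_zero)
    have d: "d > 0" unfolding d_def using d1 d2 n by simp
    have close: "norm (r *\<^sub>R a + r' *\<^sub>R b) < min d1 d2" if "0 \<le> r" "r \<le> s" "0 \<le> r'" "r' \<le> s" "s < d" for r r' s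
    proof -
      have "norm (r *\<^sub>R a + r' *\<^sub>R b) \<le> r * norm a + r' * norm b"
        using norm_triangle_ineq[of "r *\<^sub>R a" "r' *\<^sub>R b"] that by simp
      also have "\<dots> \<le> s * norm a + s * norm b"
        using that by (intro add_mono mult_right_mono) auto
      also have "\<dots> \<le> s * (norm a + norm b + 1)" using that by (simp add: algebra_simps)
      also have "\<dots> < d * (norm a + norm b + 1)" by (rule mult_strict_right_mono[OF that(5) n])
      also have "\<dots> = min d1 d2" using n unfolding d_def by (rule nonzero_eq_divide_eq[THEN iffD1, OF less_imp_neq[symmetric] refl])
      finally show ?thesis .
    qed
    have "dist ((f (u + s *\<^sub>R a + s *\<^sub>R b) - f (u + s *\<^sub>R a) - f (u + s *\<^sub>R b) + f u) / s\<^sup>2) (f2 u) < e"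
      if s: "0 < s" "s < d" for s
    proof -
      have inV: "u + r *\<^sub>R a + r' *\<^sub>R b \<in> V" if "0 \<le> r" "r \<le> s" "0 \<le> r'" "r' \<le> s" for r r'
      proof -
        have "dist u (u + (r *\<^sub>R a + r' *\<^sub>R b)) < d1" using close[OF that s(2)] by (subst dist_commute) (simp add: dist_norm)
        then show ?thesis using d1 by (auto simp: add.assoc)
      qed
      \<comment> \<open>The mean value theorem is applied to the increment of \<open>f\<close> under
        the shift by \<open>s *\<^sub>R b\<close>, regarded as a function of the step along
        \<open>a\<close>.\<close>
      obtain r where r: "0 < r" "r < s" and 1:
        "(f ((u + s *\<^sub>R b) + s *\<^sub>R a) - f (u + s *\<^sub>R a)) - (f ((u + s *\<^sub>R b) + 0 *\<^sub>R a) - f (u + 0 *\<^sub>R a))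
          = (s - 0) * (f1 ((u + s *\<^sub>R b) + r *\<^sub>R a) - f1 (u + r *\<^sub>R a))"
      proof -
        have "\<exists>r. 0 < r \<and> r < s \<and>
          (\<lambda>r. f ((u + s *\<^sub>R b) + r *\<^sub>R a) - f (u + r *\<^sub>R a)) s - (\<lambda>r. f ((u + s *\<^sub>R b) + r *\<^sub>R a) - f (u + r *\<^sub>R a)) 0
          = (s - 0) * (f1 ((u + s *\<^sub>R b) + r *\<^sub>R a) - f1 (u + r *\<^sub>R a))"
        proof (rule MVT2[OF s(1)])
          fix r assume "0 \<le> r" "r \<le> s"
          then show "((\<lambda>r. f ((u + s *\<^sub>R b) + r *\<^sub>R a) - f (u + r *\<^sub>R a)) has_real_derivative
              f1 ((u + s *\<^sub>R b) + r *\<^sub>R a) - f1 (u + r *\<^sub>R a)) (at r)"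
            using inV[of r s] inV[of r 0] s
            by (intro DERIV_diff df) (auto simp: add_ac)
        qed
        then show ?thesis using that by auto
      qed
      obtain r' where r': "0 < r'" "r' < s" and 2:
        "f1 ((u + r *\<^sub>R a) + s *\<^sub>R b) - f1 ((u + r *\<^sub>R a) + 0 *\<^sub>R b) = (s - 0) * f2 ((u + r *\<^sub>R a) + r' *\<^sub>R b)"
      proof -
        have "\<exists>r'. 0 < r' \<and> r' < s \<and>
          (\<lambda>r'. f1 ((u + r *\<^sub>R a) + r' *\<^sub>R b)) s - (\<lambda>r'. f1 ((u + r *\<^sub>R a) + r' *\<^sub>R b)) 0 = (s - 0) * f2 ((u + r *\<^sub>R a) + r' *\<^sub>R b)"
        proof (rule MVT2[OF s(1)])
          fix r' assume "0 \<le> r'" "r' \<le> s"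
          then show "((\<lambda>r'. f1 ((u + r *\<^sub>R a) + r' *\<^sub>R b)) has_real_derivative f2 ((u + r *\<^sub>R a) + r' *\<^sub>R b)) (at r')"
            using inV[of r r'] r s by (intro df1) (auto simp: add_ac)
        qed
        then show ?thesis using that by auto
      qed
      have "f (u + s *\<^sub>R a + s *\<^sub>R b) - f (u + s *\<^sub>R a) - f (u + s *\<^sub>R b) + f u = s\<^sup>2 * f2 (u + r *\<^sub>R a + r' *\<^sub>R b)"
        using 1 2 by (simp add: add_ac power2_eq_square)
      then have "(f (u + s *\<^sub>R a + s *\<^sub>R b) - f (u + s *\<^sub>R a) - f (u + s *\<^sub>R b) + f u) / s\<^sup>2 = f2 (u + r *\<^sub>R a + r' *\<^sub>R b)"
        using s by simp
      moreover have "dist (u + r *\<^sub>R a + r' *\<^sub>R b) u < d2"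
        using close[of r s r'] r r' s by (simp add: dist_norm add.assoc)
      ultimately show ?thesis using d2(2) by simp
    qed
    then show "eventually (\<lambda>s. dist ((f (u + s *\<^sub>R a + s *\<^sub>R b) - f (u + s *\<^sub>R a) - f (u + s *\<^sub>R b) + f u) / s\<^sup>2) (f2 u) < e)
        (at_right 0)"
      unfolding eventually_at_right_field using d by (intro exI[of _ d]) blast
  qed
qed

text \<open>The second difference is symmetric in \<open>a\<close> and \<open>b\<close>, so both
  mixed derivatives are limits of one and the same quotient.\<close>

lemma second_derivative_symmetric:
  fixes f :: "'a::real_normed_vector \<Rightarrow> real"
  assumes "smooth_on V f" "open V" "u \<in> V"
  shows "frechet_derivative (\<lambda>w. frechet_derivative f (at w) a) (at u) b =
    frechet_derivative (\<lambda>w. frechet_derivative f (at w) b) (at u) a"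
proof (rule tendsto_unique[OF _ second_difference_limit[OF assms]])
  have eq: "(f (u + s *\<^sub>R b + s *\<^sub>R a) - f (u + s *\<^sub>R b) - f (u + s *\<^sub>R a) + f u) =
    (f (u + s *\<^sub>R a + s *\<^sub>R b) - f (u + s *\<^sub>R a) - f (u + s *\<^sub>R b) + f u)" for s
    by (simp add: add_ac)
  show "((\<lambda>s. (f (u + s *\<^sub>R a + s *\<^sub>R b) - f (u + s *\<^sub>R a) - f (u + s *\<^sub>R b) + f u) / s\<^sup>2) \<longlongrightarrow>
    frechet_derivative (\<lambda>w. frechet_derivative f (at w) b) (at u) a) (at_right 0)"
    using second_difference_limit[OF assms, of b a] unfolding eq .
qed simp

section \<open>Gram--Schmidt and rotations\<close>

lemma bounded_bilinear_matrix_mult: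
  "bounded_bilinear ((**) :: real^'n^'m \<Rightarrow> real^'p^'n \<Rightarrow> real^'p^'m)"
  unfolding bilinear_conv_bounded_bilinear[symmetric] bilinear_def
  by (auto intro!: linearI simp: vec_eq_iff matrix_matrix_mult_def sum.distrib sum_distrib_left algebra_simps)

lemma bounded_bilinear_matrix_vector_mult:
  "bounded_bilinear ((*v) :: real^'n^'m \<Rightarrow> real^'n \<Rightarrow> real^'m)"
  unfolding bilinear_conv_bounded_bilinear[symmetric] bilinear_def
  by (auto intro!: linearI simp: vec_eq_iff matrix_vector_mult_def sum.distrib sum_distrib_left algebra_simps)

lemma bounded_linear_transpose: "bounded_linear (transpose :: real^'n^'m \<Rightarrow> real^'m^'n)"
  unfolding linear_conv_bounded_linear[symmetric]
  by (auto intro!: linearI simp: vec_eq_iff transpose_def)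

lemmas smooth_on_matrix_mult = smooth_on_bilinear[OF bounded_bilinear_matrix_mult]
lemmas smooth_on_matrix_vector_mult = smooth_on_bilinear[OF bounded_bilinear_matrix_vector_mult]
lemmas smooth_on_transpose = smooth_on_linear_compose[OF bounded_linear_transpose]

lemma matrix_mult_row: "(Q ** R) $ k = (\<Sum>l\<in>UNIV. Q $ k $ l *\<^sub>R R $ l)" for Q :: "real^'i^'j" and R :: "real^'k^'i"
  by (simp add: vec_eq_iff matrix_matrix_mult_def)

text \<open>When the rows of \<open>B\<close> are frame vectors and \<open>G\<close> is the Gram
  matrix of the ambient basis, these entries are the inner products of the frame. Equating the
  matrix with \<open>mat 1\<close> is the form in which orthonormality is carried
  throughout.\<close>

lemma matrix_congruence_nth:
  fixes B :: "real^'n^'m" and G :: "real^'n^'n"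
  shows "(B ** G ** transpose B) $ i $ j = B $ i \<bullet> (G *v B $ j)"
proof -
  have "(B ** G ** transpose B) $ i $ j = (B ** (G ** transpose B)) $ i $ j"
    by (simp add: matrix_mul_assoc)
  then show ?thesis
    by (simp add: matrix_matrix_mult_def matrix_vector_mult_def transpose_def inner_vec_def)
qed

text \<open>For square matrices the right inverse \<open>G ** transpose B\<close> of
  \<open>B\<close> is also a left inverse. Multiplying the row vector \<open>y\<close> by the
  resulting identity matrix and reading it along the rows of \<open>B\<close> gives the orthonormal
  expansion.\<close>

lemma orthonormal_rows_expansion:
  fixes B G :: "real^'n^'n"
  assumes "B ** G ** transpose B = mat 1"
  shows "y = (\<Sum>k\<in>UNIV. (y \<bullet> (G *v B $ k)) *\<^sub>R B $ k)"
proof -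
  have "(G ** transpose B) ** B = mat 1"
    using assms by (metis matrix_left_right_inverse matrix_mul_assoc)
  then have "y = y v* ((G ** transpose B) ** B)" by simp
  also have "\<dots> = (y v* (G ** transpose B)) v* B" by (simp add: vector_matrix_mul_assoc)
  also have "\<dots> = (\<Sum>k\<in>UNIV. (y \<bullet> (G *v B $ k)) *\<^sub>R B $ k)"
    by (simp add: vec_eq_iff vector_matrix_mult_def matrix_matrix_mult_def matrix_vector_mult_def
        transpose_def inner_vec_def mult_ac)
  finally show ?thesis .
qed

lemma orthonormal_rows_mult:
  fixes B G R :: "real^'n^'n"
  assumes "B ** G ** transpose B = mat 1" "R ** transpose R = mat 1"
  shows "(R ** B) ** G ** transpose (R ** B) = mat 1"
proof -
  have "(R ** B) ** G ** transpose (R ** B) = R ** (B ** G ** transpose B) ** transpose R"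
    by (simp add: matrix_transpose_mul matrix_mul_assoc)
  then show ?thesis using assms by simp
qed

section \<open>Smooth Gram--Schmidt on positive definite matrices\<close>

text \<open>Above dimension one this set has empty interior among all matrices, being contained in
  the symmetric ones, so smoothness on it really means local extendability.\<close>

definition spd :: "(real^'n^'n) set" where
  "spd = {M. transpose M = M \<and> (\<forall>v. v \<noteq> 0 \<longrightarrow> 0 < v \<bullet> (M *v v))}"

lemma inner_vector_matrix: "v \<bullet> (w v* A) = w \<bullet> (A *v v)" for A :: "real^'n^'m"
  by (simp add: inner_commute[of v] dot_lmul_matrix)

lemma spd_inner_commute:
  assumes "M \<in> spd" shows "v \<bullet> (M *v w) = w \<bullet> (M *v v)"
proof -
  have "transpose M = M" using assms by (simp add: spd_def)
  from transpose_matrix_vector[of M w, unfolded this] show ?thesis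
    by (simp only: inner_vector_matrix)
qed

lemma mat_1_spd: "mat 1 \<in> spd"
  by (simp add: spd_def)

text \<open>Induction on the set \<open>J\<close> of processed indices replaces an ordering of the
  index type. The vectors built so far vanish outside \<open>J\<close>, so the next vector before
  normalisation has component 1 at the new index and cannot be zero. The clause about
  \<open>mat 1\<close> is carried along to obtain a normalised map.\<close>

lemma gram_schmidt_aux:
  fixes J :: "'n::finite set"
  assumes "finite J"
  shows "\<exists>e :: 'n \<Rightarrow> real^'n^'n \<Rightarrow> real^'n. (\<forall>i\<in>J. smooth_on spd (e i)) \<and>
    (\<forall>M\<in>spd. \<forall>i\<in>J. \<forall>j\<in>J. e i M \<bullet> (M *v e j M) = (if i = j then 1 else 0)) \<and>
    (\<forall>M\<in>spd. \<forall>i\<in>J. \<forall>k. k \<notin> J \<longrightarrow> e i M $ k = 0) \<and> (\<forall>i\<in>J. e i (mat 1) = axis i 1)"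
  using assms
proof induction
  case empty
  then show ?case by simp
next
  case (insert a J)
  then obtain e :: "'n \<Rightarrow> real^'n^'n \<Rightarrow> real^'n" where
    sm: "\<And>i. i \<in> J \<Longrightarrow> smooth_on spd (e i)" and
    on: "\<And>M i j. M \<in> spd \<Longrightarrow> i \<in> J \<Longrightarrow> j \<in> J \<Longrightarrow> e i M \<bullet> (M *v e j M) = (if i = j then 1 else 0)" and
    z: "\<And>M i k. M \<in> spd \<Longrightarrow> i \<in> J \<Longrightarrow> k \<notin> J \<Longrightarrow> e i M $ k = 0" and
    one: "\<And>i. i \<in> J \<Longrightarrow> e i (mat 1) = axis i 1"
    by blast
  \<comment> \<open>The basis vector minus its \<open>M\<close>-orthogonal projection to the span of
    the earlier vectors.\<close>
  define u where "u M = axis a 1 - (\<Sum>j\<in>J. (axis a 1 \<bullet> (M *v e j M)) *\<^sub>R e j M)" for M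
  define e' where "e' = e(a := \<lambda>M. rsqrt (u M \<bullet> (M *v u M)) *\<^sub>R u M)"
  have ua: "u M $ a = 1" if "M \<in> spd" for M
    using z[OF that _ insert.hyps(2)] by (simp add: u_def)
  then have u0: "u M \<noteq> 0" if "M \<in> spd" for M using that by fastforce
  have pos: "0 < u M \<bullet> (M *v u M)" if "M \<in> spd" for M
    using u0[OF that] that by (auto simp: spd_def)
  have usm: "smooth_on spd u" unfolding u_def
    by (intro smooth_on_diff smooth_on_const smooth_on_sum smooth_on_scaleR smooth_on_inner
        smooth_on_matrix_vector_mult sm smooth_on_bounded_linear bounded_linear_ident)
  have ue: "u M \<bullet> (M *v e j M) = 0" if "M \<in> spd" "j \<in> J" for M j
  proof -
    have "u M \<bullet> (M *v e j M) = axis a 1 \<bullet> (M *v e j M)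
        - (\<Sum>i\<in>J. (axis a 1 \<bullet> (M *v e i M)) * (e i M \<bullet> (M *v e j M)))"
      by (simp add: u_def inner_diff_left inner_sum_left)
    also have "(\<Sum>i\<in>J. (axis a 1 \<bullet> (M *v e i M)) * (e i M \<bullet> (M *v e j M)))
        = (\<Sum>i\<in>J. if i = j then axis a 1 \<bullet> (M *v e i M) else 0)"
      using on[OF that(1) _ that(2)] by (intro sum.cong) auto
    also have "\<dots> = axis a 1 \<bullet> (M *v e j M)" using that insert.hyps(1) by simp
    finally show ?thesis by simp
  qed
  have "smooth_on spd (e' i)" if "i \<in> insert a J" for i
  proof (cases "i = a")
    case True
    then have "e' i = (\<lambda>M. rsqrt (u M \<bullet> (M *v u M)) *\<^sub>R u M)" by (simp add: e'_def)
    moreover have "smooth_on spd (\<lambda>M. rsqrt (u M \<bullet> (M *v u M)) *\<^sub>R u M)"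
      by (intro smooth_on_scaleR smooth_on_rsqrt smooth_on_inner
        smooth_on_matrix_vector_mult usm smooth_on_bounded_linear bounded_linear_ident pos)
    ultimately show ?thesis by metis
  qed (use sm that in \<open>auto simp: e'_def\<close>)
  moreover have "e' i M \<bullet> (M *v e' j M) = (if i = j then 1 else 0)"
    if M: "M \<in> spd" and ij: "i \<in> insert a J" "j \<in> insert a J" for M i j
  proof -
    have ea: "e' a M = rsqrt (u M \<bullet> (M *v u M)) *\<^sub>R u M" and ei: "\<And>i. i \<in> J \<Longrightarrow> e' i M = e i M"
      using insert.hyps by (auto simp: e'_def)
    have "rsqrt (u M \<bullet> (M *v u M)) * (rsqrt (u M \<bullet> (M *v u M)) * (u M \<bullet> (M *v u M))) = 1"
      using pos[OF M] by (simp add: rsqrt_def divide_simps)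
    then have aa: "e' a M \<bullet> (M *v e' a M) = 1"
      by (simp add: ea matrix_vector_mult_scaleR)
    have aj: "e' a M \<bullet> (M *v e' j M) = 0" if "j \<in> J" for j
      using ue[OF M that] by (simp add: ea ei[OF that])
    then have ja: "e' j M \<bullet> (M *v e' a M) = 0" if "j \<in> J" for j
      using spd_inner_commute[OF M] that by metis
    show ?thesis
      using ij aa aj ja on[OF M] ei insert.hyps by (cases "i = a"; cases "j = a") auto
  qed
  moreover have "e' i M $ k = 0" if "M \<in> spd" "i \<in> insert a J" "k \<notin> insert a J" for M i k
    using that z[OF that(1)] by (auto simp: e'_def u_def axis_def)
  moreover have "e' i (mat 1) = axis i 1" if "i \<in> insert a J" for i
  proof (cases "i = a")
    case True
    have "u (mat 1) = axis a 1"
    proof -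
      have "(\<Sum>j\<in>J. (axis a 1 \<bullet> (mat 1 *v e j (mat 1))) *\<^sub>R e j (mat 1)) = (\<Sum>j\<in>J. 0)"
        using insert.hyps by (intro sum.cong) (auto simp: one inner_axis_axis)
      then show ?thesis unfolding u_def by simp
    qed
    then show ?thesis using True by (simp add: e'_def rsqrt_def)
  qed (use one that in \<open>auto simp: e'_def\<close>)
  ultimately show ?case by (intro exI[of _ e'] conjI ballI allI impI)
qed

lemma gram_schmidt_exists:
  "\<exists>\<Phi> :: real^'n^'n \<Rightarrow> real^'n^'n. smooth_on spd \<Phi> \<and>
    (\<forall>M\<in>spd. \<Phi> M ** M ** transpose (\<Phi> M) = mat 1) \<and> \<Phi> (mat 1) = mat 1"
proof -
  obtain e :: "'n \<Rightarrow> real^'n^'n \<Rightarrow> real^'n" where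
    sm: "\<And>i. smooth_on spd (e i)" and
    on: "\<And>M i j. M \<in> spd \<Longrightarrow> e i M \<bullet> (M *v e j M) = (if i = j then 1 else 0)" and
    one: "\<And>i. e i (mat 1) = axis i 1"
    using gram_schmidt_aux[OF finite_class.finite_UNIV, where 'n = 'n] unfolding ball_UNIV by blast
  show ?thesis
  proof (intro exI[of _ "\<lambda>M. \<chi> i. e i M"] conjI ballI)
    show "smooth_on spd (\<lambda>M. \<chi> i. e i M)" by (intro smooth_on_vec_lambda sm)
    show "(\<chi> i. e i M) ** M ** transpose (\<chi> i. e i M) = mat 1" if "M \<in> spd" for M
      unfolding vec_eq_iff matrix_congruence_nth using on[OF that] by (simp add: mat_def)
    show "(\<chi> i. e i (mat 1)) = mat 1"
      unfolding one by (simp add: vec_eq_iff mat_def axis_def)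
  qed
qed

text \<open>Any map with these three properties serves; the value at \<open>mat 1\<close> is fixed
  so that \<open>rot 0\<close> becomes the identity.\<close>

definition gram_schmidt :: "real^'n^'n \<Rightarrow> real^'n^'n" where
  "gram_schmidt = (SOME \<Phi>. smooth_on spd \<Phi> \<and>
    (\<forall>M\<in>spd. \<Phi> M ** M ** transpose (\<Phi> M) = mat 1) \<and> \<Phi> (mat 1) = mat 1)"

lemma
  shows smooth_on_gram_schmidt: "smooth_on spd gram_schmidt"
    and gram_schmidt_orthonormal: "M \<in> spd \<Longrightarrow> gram_schmidt M ** M ** transpose (gram_schmidt M) = mat 1"
    and gram_schmidt_mat_1: "gram_schmidt (mat 1) = mat 1"
  using someI_ex[OF gram_schmidt_exists] unfolding gram_schmidt_def[symmetric] by auto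

section \<open>Orthogonal matrices with prescribed first derivative\<close>

definition skew :: "(real^'n^'n) set" where
  "skew = {T. transpose T = - T}"

text \<open>The derivative at \<open>0\<close> of this map from skew matrices to orthogonal matrices is the identity,
  like that of the matrix exponential.\<close>

definition rot :: "real^'n^'n \<Rightarrow> real^'n^'n" where
  "rot T = gram_schmidt ((mat 1 + T) ** transpose (mat 1 + T)) ** (mat 1 + T)"

lemma skewI:
  assumes "\<And>i j. T $ j $ i = - T $ i $ j" shows "T \<in> skew"
  unfolding skew_def mem_Collect_eq vec_eq_iff transpose_def
  by (intro allI, simp only: vec_lambda_beta vector_uminus_component) (rule assms)

lemma skew_inner: "T \<in> skew \<Longrightarrow> v \<bullet> (T *v v) = (0::real)"
proof -
  assume "T \<in> skew"
  then have "T = - transpose T" by (simp add: skew_def)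
  then have "v \<bullet> (T *v v) = v \<bullet> ((- transpose T) *v v)"
    by (rule arg_cong[where f = "\<lambda>A. v \<bullet> (A *v v)"])
  also have "\<dots> = - (v \<bullet> (transpose T *v v))"
    by (simp only: bounded_bilinear.minus_left[OF bounded_bilinear_matrix_vector_mult] inner_minus_right)
  also have "v \<bullet> (transpose T *v v) = v \<bullet> (T *v v)"
    by (simp add: inner_vector_matrix)
  finally show ?thesis by simp
qed

text \<open>A skew \<open>T\<close> contributes nothing to v . (1 + T) v = |v|^2, so the row vector
  v (1 + T) is nonzero for nonzero v, and the quadratic form is its squared length.\<close>

lemma skew_spd:
  assumes "T \<in> skew" shows "(mat 1 + T) ** transpose (mat 1 + T) \<in> spd"
proof -
  have "0 < v \<bullet> (((mat 1 + T) ** transpose (mat 1 + T)) *v v)" if "v \<noteq> 0" for v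
  proof -
    have "v \<bullet> (v v* (mat 1 + T)) = v \<bullet> v"
      by (simp add: inner_vector_matrix matrix_vector_mult_add_rdistrib inner_add_right skew_inner[OF assms])
    then have "v v* (mat 1 + T) \<noteq> 0" using that by auto
    moreover have "v \<bullet> (((mat 1 + T) ** transpose (mat 1 + T)) *v v) = (v v* (mat 1 + T)) \<bullet> (v v* (mat 1 + T))"
      by (simp add: dot_lmul_matrix flip: matrix_vector_mul_assoc)
    ultimately show ?thesis by simp
  qed
  then show ?thesis by (simp add: spd_def matrix_transpose_mul)
qed

lemma smooth_on_rot: "smooth_on skew rot"
proof -
  have 1: "smooth_on skew (\<lambda>T::real^'n^'n. mat 1 + T)"
    by (intro smooth_on_add smooth_on_const smooth_on_bounded_linear bounded_linear_ident)
  then have "smooth_on skew (\<lambda>T::real^'n^'n. (mat 1 + T) ** transpose (mat 1 + T))"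
    by (intro smooth_on_matrix_mult smooth_on_transpose)
  then have "smooth_on skew (\<lambda>T::real^'n^'n. gram_schmidt ((mat 1 + T) ** transpose (mat 1 + T)))"
    by (rule smooth_on_compose[OF _ smooth_on_gram_schmidt]) (auto intro: skew_spd)
  with 1 show ?thesis unfolding rot_def by (intro smooth_on_matrix_mult)
qed

text \<open>\<open>rot T\<close> consists of the rows of \<open>mat 1 + T\<close> orthonormalised
  for the standard inner product; the argument of \<open>gram_schmidt\<close> is their Gram
  matrix.\<close>

lemma rot_orthogonal: "T \<in> skew \<Longrightarrow> rot T ** transpose (rot T) = mat 1"
  using gram_schmidt_orthonormal[OF skew_spd, of T]
  by (simp add: rot_def matrix_transpose_mul matrix_mul_assoc)

lemma rot_0: "rot 0 = mat 1"
  by (simp add: rot_def gram_schmidt_mat_1)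

text \<open>For skew \<open>T\<close> the Gram matrix is (1 + T)(1 - T) = 1 - T^2, which is
  stationary where \<open>T\<close> vanishes. The Gram--Schmidt factor is therefore constant to
  first order, and the factor \<open>mat 1 + T\<close> alone contributes the derivative
  \<open>T'\<close>.\<close>

lemma rot_has_derivative:
  fixes T :: "'a::real_normed_vector \<Rightarrow> real^'n^'n"
  assumes T: "(T has_derivative T') (at u0)" and T0: "T u0 = 0"
    and skew: "eventually (\<lambda>u. T u \<in> skew) (nhds u0)"
  shows "((\<lambda>u. rot (T u)) has_derivative T') (at u0)"
proof -
  define K where "K u = (mat 1 + T u) ** transpose (mat 1 + T u)" for u
  define K1 where "K1 u = (mat 1 + T u) ** (mat 1 - T u)" for u
  have K0: "K u0 = mat 1" by (simp add: K_def T0)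
  \<comment> \<open>\<open>gram_schmidt\<close> is smooth only along \<open>spd\<close>, so the
    chain rule is applied to a smooth extension and carried back at the nearby points where
    \<open>K u\<close> lies in \<open>W\<close> and \<open>T u\<close> is skew.\<close>
  obtain W F where F: "mat 1 \<in> W" "Cinf_on W F" "\<forall>y\<in>W \<inter> spd. F y = gram_schmidt (y::real^'n^'n)"
    using smooth_on_gram_schmidt mat_1_spd unfolding smooth_on_Cinf by blast
  have KK1: "eventually (\<lambda>u. K1 u = K u) (nhds u0)"
    using skew
  proof eventually_elim
    case (elim u)
    have "transpose (mat 1 + T u) = mat 1 + transpose (T u)"
      by (simp add: vec_eq_iff transpose_def mat_def)
    then show ?case using elim by (simp add: K_def K1_def skew_def)
  qed
  have "((\<lambda>u. mat 1 + T u) has_derivative T') (at u0)" "((\<lambda>u. mat 1 - T u) has_derivative (\<lambda>v. - T' v)) (at u0)"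
    by (auto intro!: derivative_eq_intros T)
  from bounded_bilinear.FDERIV[OF bounded_bilinear_matrix_mult this]
  have "(K1 has_derivative (\<lambda>v. 0)) (at u0)"
    by (simp add: K1_def[abs_def] T0)
  moreover have "eventually (\<lambda>u. K1 u = K u) (at u0)" "K1 u0 = K u0"
    using KK1 eventually_nhds_x_imp_x[OF KK1] by (auto simp: eventually_at_filter elim: eventually_mono)
  ultimately have K: "(K has_derivative (\<lambda>v. 0)) (at u0)"
    by (rule has_derivative_transform_eventually) simp
  have "isCont K u0" using K by (rule has_derivative_continuous)
  then have evW: "eventually (\<lambda>u. K u \<in> W) (at u0)"
    using F(1,2) K0 unfolding Cinf_on_def isCont_def
    by (metis topological_tendstoD)
  have "(F has_derivative frechet_derivative F (at (K u0))) (at (K u0))"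
    using Cinf_on_has_derivative[OF F(2,1)] K0 by simp
  from diff_chain_at[OF K this]
  have "((\<lambda>u. F (K u)) has_derivative (\<lambda>v. 0)) (at u0)"
    using linear_0[OF has_derivative_linear[OF Cinf_on_has_derivative[OF F(2,1)]]] K0
    by (simp add: o_def)
  moreover have "eventually (\<lambda>u. F (K u) = gram_schmidt (K u)) (at u0)"
    using evW skew[unfolded eventually_nhds_conv_at, THEN conjunct1]
  proof eventually_elim
    case (elim u)
    then show ?case using F(3) skew_spd by (auto simp: K_def)
  qed
  moreover have "F (K u0) = gram_schmidt (K u0)" 
    unfolding K0 by (rule F(3)[rule_format, OF IntI[OF F(1) mat_1_spd]])
  ultimately have "((\<lambda>u. gram_schmidt (K u)) has_derivative (\<lambda>v. 0)) (at u0)"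
    by (rule has_derivative_transform_eventually) simp
  from bounded_bilinear.FDERIV[OF bounded_bilinear_matrix_mult this
      \<open>((\<lambda>u. mat 1 + T u) has_derivative T') (at u0)\<close>]
  show ?thesis by (simp add: K0 gram_schmidt_mat_1 T0 rot_def flip: K_def)
qed

text \<open>The rotation keeps the frame at \<open>u0\<close> and shifts its derivative by
  \<open>T' v ** E u0\<close>. This additive shift is the freedom used to cancel the structure
  functions at the base point.\<close>

lemma rot_frame_has_derivative:
  fixes T E :: "'a::real_normed_vector \<Rightarrow> real^'n^'n"
  assumes "(T has_derivative T') (at u0)" "T u0 = 0" "eventually (\<lambda>u. T u \<in> skew) (nhds u0)"
    and "(E has_derivative E') (at u0)"
  shows "((\<lambda>u. rot (T u) ** E u) has_derivative (\<lambda>v. E' v + T' v ** E u0)) (at u0)"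
  using bounded_bilinear.FDERIV[OF bounded_bilinear_matrix_mult rot_has_derivative[OF assms(1-3)] assms(4)]
  by (simp add: assms(2) rot_0)

section \<open>Computations in a foliated chart\<close>

lemma frechet_derivative_expand:
  fixes f :: "'a::euclidean_space \<Rightarrow> 'b::real_normed_vector"
  assumes "(f has_derivative frechet_derivative f (at u)) (at u)"
  shows "frechet_derivative f (at u) v = (\<Sum>b\<in>Basis. (v \<bullet> b) *\<^sub>R frechet_derivative f (at u) b)"
proof -
  interpret linear "frechet_derivative f (at u)" using assms by (rule has_derivative_linear)
  have "frechet_derivative f (at u) v = frechet_derivative f (at u) (\<Sum>b\<in>Basis. (v \<bullet> b) *\<^sub>R b)"
    by (simp add: euclidean_representation)
  then show ?thesis by (simp add: sum scale)
qed

text \<open>Since the direction moves with the point, the derivative is expanded in the constant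
  directions of \<open>Basis\<close>, where \<open>smooth_on_derivative\<close> applies.\<close>

lemma smooth_on_directional:
  fixes f :: "'a::euclidean_space \<Rightarrow> 'b::real_normed_vector"
  assumes f: "smooth_on V f" and xi: "smooth_on V \<xi>" and V: "open V"
  shows "smooth_on V (\<lambda>u. frechet_derivative f (at u) (\<xi> u))"
proof -
  have "smooth_on V (\<lambda>u. \<Sum>b\<in>Basis. (\<xi> u \<bullet> b) *\<^sub>R frechet_derivative f (at u) b)"
    by (intro smooth_on_sum smooth_on_scaleR smooth_on_inner xi smooth_on_const smooth_on_derivative f V)
  then show ?thesis
    using frechet_derivative_expand[OF smooth_on_has_derivative[OF f V]]
    by (subst smooth_on_cong) auto
qed

lemma smooth_on_static:
  fixes f :: "'a::euclidean_space \<Rightarrow> 'b::real_normed_vector"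
  assumes "smooth_on V f" shows "smooth_on (I \<times> V) (\<lambda>(t::real, u). f u)"
  using smooth_on_compose[OF smooth_on_bounded_linear[OF bounded_linear_snd] assms, of "I \<times> V"]
  by (auto simp: case_prod_unfold)

lemma smooth_on_at_time:
  fixes f :: "real \<Rightarrow> 'a::euclidean_space \<Rightarrow> 'b::real_normed_vector"
  assumes "smooth_on (I \<times> V) (\<lambda>(t, u). f t u)" "t \<in> I" shows "smooth_on V (f t)"
proof -
  have "smooth_on V (\<lambda>u. (t, u))"
    by (intro smooth_on_Pair smooth_on_const smooth_on_bounded_linear[OF bounded_linear_ident])
  from smooth_on_compose[OF this assms(1)] show ?thesis using assms(2) by (auto simp: image_subset_iff)
qed

text \<open>The point is frozen while the domain remains \<open>I \<times> V\<close>; this is how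
  coefficients evaluated at the base point are seen to be smooth in time.\<close>

lemma smooth_on_at_point:
  fixes f :: "real \<Rightarrow> 'a::euclidean_space \<Rightarrow> 'b::real_normed_vector"
  assumes "smooth_on (I \<times> V) (\<lambda>(t, u). f t u)" "u0 \<in> V" shows "smooth_on (I \<times> V) (\<lambda>(t, u). f t u0)"
proof -
  have "smooth_on (I \<times> V) (\<lambda>x. (fst x, u0))"
    by (intro smooth_on_Pair smooth_on_const smooth_on_bounded_linear[OF bounded_linear_fst])
  from smooth_on_compose[OF this assms(1)] show ?thesis
    using assms(2) by (simp add: case_prod_unfold image_subset_iff)
qed

lemma smooth_on_time_directional:
  fixes f :: "real \<Rightarrow> 'a::euclidean_space \<Rightarrow> 'b::real_normed_vector"
  assumes f: "smooth_on (I \<times> V) (\<lambda>(t, u). f t u)" and xi: "smooth_on (I \<times> V) (\<lambda>(t, u). \<xi> t u)" and V: "open V"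
  shows "smooth_on (I \<times> V) (\<lambda>(t, u). frechet_derivative (f t) (at u) (\<xi> t u))"
proof -
  have "smooth_on (I \<times> V) (\<lambda>x. \<Sum>b\<in>Basis. ((case x of (t, u) \<Rightarrow> \<xi> t u) \<bullet> b) *\<^sub>R
      (case x of (t, u) \<Rightarrow> frechet_derivative (f t) (at u) b))"
    by (intro smooth_on_sum smooth_on_scaleR smooth_on_inner xi smooth_on_const smooth_on_time_derivative f V)
  then show ?thesis
    using frechet_derivative_expand[OF smooth_on_time_has_derivative[OF f V]]
    by (subst smooth_on_cong) auto
qed

section \<open>Functions and tangent vectors in a single foliated chart\<close>

lemma is_chartD:
  assumes "is_chart c"
  shows "open (cdom c)" "open (cmap c ` cdom c)"
    and "q \<in> cdom c \<Longrightarrow> cinv c (cmap c q) = q"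
    and "u \<in> cmap c ` cdom c \<Longrightarrow> cmap c (cinv c u) = u"
    and "continuous_on (cdom c) (cmap c)" "continuous_on (cmap c ` cdom c) (cinv c)"
  using assms by (auto simp: is_chart_def homeomorphism_def)

lemma chart_open_image:
  assumes "is_chart c" "open W" "W \<subseteq> cdom c" shows "open (cmap c ` W)"
proof -
  have "cmap c ` W = cmap c ` cdom c \<inter> cinv c -` W"
    using is_chartD[OF assms(1)] assms(3) by (force simp: image_iff)
  then show ?thesis using is_chartD[OF assms(1)] assms(2) by (simp add: continuous_open_preimage)
qed

lemma foliated_atlas_chart: "foliated_atlas A \<Longrightarrow> c \<in> A \<Longrightarrow> is_chart c"
  by (simp add: foliated_atlas_def)

lemma transition_smooth:
  assumes "foliated_atlas A" "c \<in> A" "d \<in> A"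
  shows "smooth_on (cmap d ` (cdom d \<inter> cdom c)) (cmap c \<circ> cinv d)"
  using assms unfolding foliated_atlas_def by blast

locale foliated_chart =
  fixes A :: "('a::topological_space, 'n::finite, 'm::finite) fchart set" and c
  assumes atlas: "foliated_atlas A" and c_in: "c \<in> A"
begin

lemmas chart = foliated_atlas_chart[OF atlas c_in]
lemmas cinv_cmap = is_chartD(3)[OF chart]
lemmas cmap_cinv = is_chartD(4)[OF chart]
lemmas open_image = chart_open_image[OF chart]

text \<open>Smoothness of the coordinate changes reduces the condition over the whole atlas to the
  chart \<open>c\<close>, whose domain contains \<open>U\<close>.\<close>

lemma smooth_fun_iff:
  assumes "U \<subseteq> cdom c"
  shows "smooth_fun A U f \<longleftrightarrow> smooth_on (cmap c ` U) (f \<circ> cinv c)"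
proof
  assume "smooth_fun A U f"
  moreover have "cdom c \<inter> U = U" using assms by auto
  ultimately show "smooth_on (cmap c ` U) (f \<circ> cinv c)"
    using c_in unfolding smooth_fun_def by force
next
  assume f: "smooth_on (cmap c ` U) (f \<circ> cinv c)"
  show "smooth_fun A U f"
    unfolding smooth_fun_def
  proof
    fix d assume d: "d \<in> A"
    note cd = is_chartD[OF foliated_atlas_chart[OF atlas d]]
    have "smooth_on (cmap d ` (cdom d \<inter> U)) (cmap c \<circ> cinv d)"
      using assms by (intro smooth_on_subset[OF transition_smooth[OF atlas c_in d]]) auto
    then have "smooth_on (cmap d ` (cdom d \<inter> U)) (\<lambda>u. (f \<circ> cinv c) ((cmap c \<circ> cinv d) u))"
      by (rule smooth_on_compose[OF _ f]) (auto simp: cd)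
    then show "smooth_on (cmap d ` (cdom d \<inter> U)) (f \<circ> cinv d)"
      by (rule smooth_on_cong[THEN iffD1, rotated]) (use assms in \<open>auto simp: cd cinv_cmap\<close>)
  qed
qed

lemma smooth_in_time_iff:
  assumes "U \<subseteq> cdom c"
  shows "smooth_in_time A I U F \<longleftrightarrow> smooth_on (I \<times> cmap c ` U) (\<lambda>(t, u). F t (cinv c u))"
proof
  assume "smooth_in_time A I U F"
  moreover have "cdom c \<inter> U = U" using assms by auto
  ultimately show "smooth_on (I \<times> cmap c ` U) (\<lambda>(t, u). F t (cinv c u))"
    using c_in unfolding smooth_in_time_def by force
next
  assume f: "smooth_on (I \<times> cmap c ` U) (\<lambda>(t, u). F t (cinv c u))"
  show "smooth_in_time A I U F"
    unfolding smooth_in_time_def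
  proof
    fix d assume d: "d \<in> A"
    note cd = is_chartD[OF foliated_atlas_chart[OF atlas d]]
    let ?V = "cmap d ` (cdom d \<inter> U)"
    have "smooth_on ?V (cmap c \<circ> cinv d)"
      using assms by (intro smooth_on_subset[OF transition_smooth[OF atlas c_in d]]) auto
    then have "smooth_on (I \<times> ?V) (\<lambda>x. (cmap c \<circ> cinv d) (snd x))"
      by (rule smooth_on_compose[where f = snd, OF smooth_on_bounded_linear[OF bounded_linear_snd]]) auto
    then have "smooth_on (I \<times> ?V) (\<lambda>x. (fst x, (cmap c \<circ> cinv d) (snd x)))"
      by (intro smooth_on_Pair smooth_on_bounded_linear[OF bounded_linear_fst])
    then have "smooth_on (I \<times> ?V) (\<lambda>x. case (fst x, (cmap c \<circ> cinv d) (snd x)) of (t, u) \<Rightarrow> F t (cinv c u))"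
      by (rule smooth_on_compose[OF _ f]) (auto simp: cd)
    then show "smooth_on (I \<times> ?V) (\<lambda>(t, u). F t (cinv d u))"
      by (rule smooth_on_cong[THEN iffD1, rotated]) (use assms in \<open>auto simp: cd cinv_cmap\<close>)
  qed
qed

lemma smooth_fun_near: "smooth_fun A W f \<Longrightarrow> open W \<Longrightarrow> q \<in> W \<Longrightarrow> smooth_near A q f"
  unfolding smooth_near_def by blast

lemma smooth_near_in:
  assumes "smooth_near A q f" "open U" "q \<in> U" "U \<subseteq> cdom c"
  obtains W where "open W" "q \<in> W" "W \<subseteq> U" "smooth_on (cmap c ` W) (f \<circ> cinv c)"
proof -
  obtain W where W: "open W" "q \<in> W" "smooth_fun A W f"
    using assms(1) unfolding smooth_near_def by blast
  have "smooth_on (cmap c ` (cdom c \<inter> W)) (f \<circ> cinv c)"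
    using W(3) c_in unfolding smooth_fun_def by blast
  then have "smooth_on (cmap c ` (W \<inter> U)) (f \<circ> cinv c)"
    by (rule smooth_on_subset) (use assms in auto)
  then show ?thesis using that[of "W \<inter> U"] W assms by auto
qed

lemma smooth_near_has_derivative:
  assumes "smooth_near A q f" "q \<in> cdom c"
  shows "(f \<circ> cinv c has_derivative frechet_derivative (f \<circ> cinv c) (at (cmap c q))) (at (cmap c q))"
proof -
  obtain W where W: "open W" "q \<in> W" "W \<subseteq> cdom c" "smooth_on (cmap c ` W) (f \<circ> cinv c)"
    using smooth_near_in[OF assms(1) is_chartD(1)[OF chart] assms(2)] by blast
  then show ?thesis using smooth_on_has_derivative[OF W(4) open_image] by blast
qed

lemma coord_vec_near:
  "smooth_near A q f \<Longrightarrow> coord_vec A c q w f = frechet_derivative (f \<circ> cinv c) (at (cmap c q)) w"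
  by (simp add: coord_vec_def)

lemma coord_vec_not_near: "\<not> smooth_near A q f \<Longrightarrow> coord_vec A c q w f = 0"
  by (simp add: coord_vec_def)

lemma coord_vec_lincomb:
  assumes "q \<in> cdom c"
  shows "coord_vec A c q (a *\<^sub>R v + b *\<^sub>R w) = lincomb a (coord_vec A c q v) b (coord_vec A c q w)"
proof
  fix f
  show "coord_vec A c q (a *\<^sub>R v + b *\<^sub>R w) f = a * coord_vec A c q v f + b * coord_vec A c q w f"
  proof (cases "smooth_near A q f")
    case True
    interpret linear "frechet_derivative (f \<circ> cinv c) (at (cmap c q))"
      using smooth_near_has_derivative[OF True assms] by (rule has_derivative_linear)
    show ?thesis using True by (simp add: coord_vec_near add scale)
  qed (simp add: coord_vec_not_near)
qed

lemma coord_vec_add: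
  "q \<in> cdom c \<Longrightarrow> coord_vec A c q (v + w) f = coord_vec A c q v f + coord_vec A c q w f"
  using coord_vec_lincomb[of q 1 v 1 w] by (simp add: fun_eq_iff)

lemma coord_vec_scale:
  "q \<in> cdom c \<Longrightarrow> coord_vec A c q (a *\<^sub>R v) f = a * coord_vec A c q v f"
  using coord_vec_lincomb[of q a v 0 0] by (simp add: fun_eq_iff)

lemma coord_vec_0: "q \<in> cdom c \<Longrightarrow> coord_vec A c q 0 f = 0"
  using coord_vec_scale[of q 0 0 f] by simp

lemma coord_vec_sum:
  "q \<in> cdom c \<Longrightarrow> coord_vec A c q (\<Sum>i\<in>J. v i) f = (\<Sum>i\<in>J. coord_vec A c q (v i) f)"
  by (induction J rule: infinite_finite_induct) (auto simp: coord_vec_0 coord_vec_add)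

lemma coordinate_smooth: "U \<subseteq> cdom c \<Longrightarrow> smooth_fun A U (\<lambda>r. cmap c r \<bullet> b)"
proof -
  assume U: "U \<subseteq> cdom c"
  have "smooth_on (cmap c ` U) (\<lambda>u. u \<bullet> b)"
    by (intro smooth_on_bounded_linear bounded_linear_inner_left)
  then show ?thesis unfolding smooth_fun_iff[OF U]
    by (rule smooth_on_cong[THEN iffD1, rotated]) (use U in \<open>auto simp: cinv_cmap\<close>)
qed

text \<open>Tangent vectors are operators, so their components are recovered by testing on the
  coordinate functions.\<close>

lemma coord_vec_coordinate:
  assumes "q \<in> cdom c" shows "coord_vec A c q w (\<lambda>r. cmap c r \<bullet> b) = w \<bullet> b"
proof -
  have near: "smooth_near A q (\<lambda>r. cmap c r \<bullet> b)"
    using smooth_fun_near[OF coordinate_smooth is_chartD(1)[OF chart] assms] by simp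
  have "((\<lambda>u. u \<bullet> b) has_derivative (\<lambda>w. w \<bullet> b)) (at (cmap c q))"
    by (rule bounded_linear_imp_has_derivative[OF bounded_linear_inner_left])
  then have "((\<lambda>r. cmap c r \<bullet> b) \<circ> cinv c has_derivative (\<lambda>w. w \<bullet> b)) (at (cmap c q))"
    by (rule has_derivative_transform_within_open[OF _ is_chartD(2)[OF chart]])
      (use assms in \<open>auto simp: cinv_cmap\<close>)
  then show ?thesis using near by (simp add: coord_vec_near frechet_derivative_at[symmetric])
qed

lemma coord_vec_inj:
  assumes "q \<in> cdom c" "coord_vec A c q v = coord_vec A c q w" shows "v = w"
proof (rule euclidean_eqI)
  fix b :: "(real^'n) \<times> (real^'m)"
  show "v \<bullet> b = w \<bullet> b" using assms coord_vec_coordinate[OF assms(1)] by metis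
qed

text \<open>\<open>\<tau>'\<close> is the differential of the coordinate change. That change locally
  has the form (y, z) -> (a y, b (y, z)), so its differential maps leaf directions to leaf
  directions; hence \<open>vertical\<close> can be described in any one chart.\<close>

lemma coord_vec_transition:
  assumes q: "q \<in> cdom c" "q \<in> cdom d" and d: "d \<in> A"
  obtains \<tau>' where "\<And>w. coord_vec A d q w = coord_vec A c q (\<tau>' w)" "\<And>w. fst (\<tau>' (0, w)) = 0"
proof -
  note cd = is_chartD[OF foliated_atlas_chart[OF atlas d]]
  define \<tau> where "\<tau> = cmap c \<circ> cinv d"
  define \<tau>' where "\<tau>' = frechet_derivative \<tau> (at (cmap d q))"
  let ?V = "cmap d ` (cdom d \<inter> cdom c)"
  have V: "open ?V"
    using chart_open_image[OF foliated_atlas_chart[OF atlas d]] cd(1) is_chartD(1)[OF chart] by blast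
  have qV: "cmap d q \<in> ?V" using q by blast
  have \<tau>q: "\<tau> (cmap d q) = cmap c q" using q by (simp add: \<tau>_def cd)
  have D: "(\<tau> has_derivative \<tau>') (at (cmap d q))"
    unfolding \<tau>'_def \<tau>_def using smooth_on_has_derivative[OF transition_smooth[OF atlas c_in d] V qV] .
  show ?thesis
  proof
    fix w
    show "coord_vec A d q w = coord_vec A c q (\<tau>' w)"
    proof
      fix f
      show "coord_vec A d q w f = coord_vec A c q (\<tau>' w) f"
      proof (cases "smooth_near A q f")
        case True
        have "(f \<circ> cinv c \<circ> \<tau> has_derivative frechet_derivative (f \<circ> cinv c) (at (cmap c q)) \<circ> \<tau>') (at (cmap d q))"
          using diff_chain_at[OF D] smooth_near_has_derivative[OF True q(1)] \<tau>q by simp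
        then have "(f \<circ> cinv d has_derivative frechet_derivative (f \<circ> cinv c) (at (cmap c q)) \<circ> \<tau>') (at (cmap d q))"
          by (rule has_derivative_transform_within_open[OF _ V qV]) (auto simp: \<tau>_def cd cinv_cmap)
        then show ?thesis
          using True by (simp add: coord_vec_def frechet_derivative_at[symmetric])
      qed (simp add: coord_vec_def)
    qed
  next
    fix w :: "real^'m"
    obtain W where W: "open W" "cmap d q \<in> W"
      "\<forall>u\<in>W. \<forall>v\<in>W. fst u = fst v \<longrightarrow> fst (\<tau> u) = fst (\<tau> v)"
    proof -
      have "\<exists>W. open W \<and> cmap d q \<in> W \<and> W \<subseteq> ?V \<and>
           (\<forall>u\<in>W. \<forall>v\<in>W. fst u = fst v \<longrightarrow> fst (cmap c (cinv d u)) = fst (cmap c (cinv d v)))"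
        using atlas d c_in qV unfolding foliated_atlas_def by blast
      then show ?thesis using that unfolding \<tau>_def o_def by blast
    qed
    \<comment> \<open>Along this line only the leaf coordinates of \<open>d\<close> move, so the
      transverse coordinate of its image in \<open>c\<close> is constant near 0.\<close>
    define p where "p s = cmap d q + s *\<^sub>R (0, w)" for s
    have p: "(p has_derivative (\<lambda>s. s *\<^sub>R (0, w))) (at 0)" unfolding p_def[abs_def]
      by (auto intro!: derivative_eq_intros)
    have "p 0 = cmap d q" by (simp only: p_def scaleR_zero_left add_0_right)
    then have "((\<lambda>s. fst (\<tau> (p s))) has_derivative (\<lambda>s. fst (\<tau>' (s *\<^sub>R (0, w))))) (at 0)"
      using has_derivative_fst[OF diff_chain_at[OF p, of \<tau> \<tau>']] D by (simp add: o_def)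
    moreover have "((\<lambda>s. fst (\<tau> (p s))) has_derivative (\<lambda>s. 0)) (at 0)"
    proof (rule has_derivative_transform_within_open[where f = "\<lambda>s. fst (\<tau> (cmap d q))"])
      show "open (p -` W)" unfolding p_def[abs_def]
        by (intro open_vimage W continuous_intros)
      show "fst (\<tau> (cmap d q)) = fst (\<tau> (p s))" if "s \<in> p -` W" for s
      proof (rule W(3)[rule_format, OF W(2)])
        show "p s \<in> W" using that by simp
        show "fst (cmap d q) = fst (p s)" by (simp add: p_def)
      qed
      show "0 \<in> p -` W" using W(2) \<open>p 0 = cmap d q\<close> by simp
    qed simp
    ultimately have "(\<lambda>s. fst (\<tau>' (s *\<^sub>R (0, w)))) = (\<lambda>s. 0)"
      by (rule has_derivative_unique)
    from fun_cong[OF this, of 1] show "fst (\<tau>' (0, w)) = 0" by (simp only: scaleR_one)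
  qed
qed

lemma tangent_space_eq:
  assumes "q \<in> cdom c" shows "tangent_space A q = range (coord_vec A c q)"
proof
  show "range (coord_vec A c q) \<subseteq> tangent_space A q"
    using assms c_in unfolding tangent_space_def by blast
  show "tangent_space A q \<subseteq> range (coord_vec A c q)"
  proof
    fix v assume "v \<in> tangent_space A q"
    then obtain d w where d: "v = coord_vec A d q w" "d \<in> A" "q \<in> cdom d"
      unfolding tangent_space_def by blast
    then show "v \<in> range (coord_vec A c q)"
      using coord_vec_transition[OF assms d(3,2)] by (metis rangeI)
  qed
qed

lemma vertical_eq:
  assumes "q \<in> cdom c" shows "vertical A q = range (\<lambda>w. coord_vec A c q (0, w))"
proof
  show "range (\<lambda>w. coord_vec A c q (0, w)) \<subseteq> vertical A q"
    using assms c_in unfolding vertical_def by blast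
  show "vertical A q \<subseteq> range (\<lambda>w. coord_vec A c q (0, w))"
  proof
    fix v assume "v \<in> vertical A q"
    then obtain d w where d: "v = coord_vec A d q (0, w)" "d \<in> A" "q \<in> cdom d"
      unfolding vertical_def by blast
    obtain \<tau>' where "\<And>w. coord_vec A d q w = coord_vec A c q (\<tau>' w)" "\<And>w. fst (\<tau>' (0, w)) = 0"
      using coord_vec_transition[OF assms d(3,2)] by blast
    then have "v = coord_vec A c q (0, snd (\<tau>' (0, w)))" using d(1) by (metis prod.collapse)
    then show "v \<in> range (\<lambda>w. coord_vec A c q (0, w))" by blast
  qed
qed

section \<open>Vector fields and Lie brackets in coordinates\<close>

definition fld :: "((real^'n) \<times> (real^'m) \<Rightarrow> (real^'n) \<times> (real^'m)) \<Rightarrow> 'a tfield" where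
  "fld \<xi> q = coord_vec A c q (\<xi> (cmap c q))"

lemma fld_family:
  assumes U: "open U" "U \<subseteq> cdom c" and xi: "smooth_on (I \<times> cmap c ` U) (\<lambda>(t, u). \<xi> t u)"
    and W: "open W" "W \<subseteq> U" "smooth_fun A W f"
  shows "smooth_in_time A I W (\<lambda>t q. fld (\<xi> t) q f)"
proof -
  have Wc: "W \<subseteq> cdom c" using U W by auto
  have f: "smooth_on (cmap c ` W) (f \<circ> cinv c)" using W smooth_fun_iff[OF Wc] by blast
  have "smooth_on (I \<times> cmap c ` W) (\<lambda>(t, u). frechet_derivative (f \<circ> cinv c) (at u) (\<xi> t u))"
    using smooth_on_time_directional[OF smooth_on_static[OF f] smooth_on_subset[OF xi] open_image[OF W(1) Wc]] W(2)
    by blast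
  then show ?thesis
    unfolding smooth_in_time_iff[OF Wc]
    by (rule smooth_on_cong[THEN iffD1, rotated])
      (use Wc in \<open>auto simp: fld_def cinv_cmap coord_vec_near smooth_fun_near[OF W(3,1)]\<close>)
qed

lemma smooth_in_time_at:
  assumes "smooth_in_time A I U F" "t \<in> I" "U \<subseteq> cdom c" shows "smooth_fun A U (F t)"
  using smooth_on_at_time[OF assms(1)[unfolded smooth_in_time_iff[OF assms(3)]] assms(2)]
  by (simp add: smooth_fun_iff[OF assms(3)] o_def)

lemma fld_vector_field_family:
  assumes U: "open U" "U \<subseteq> cdom c" and xi: "smooth_on (I \<times> cmap c ` U) (\<lambda>(t, u). \<xi> t u)"
  shows "(\<lambda>t. fld (\<xi> t)) \<in> vector_field_families A I U"
proof -
  note * = fld_family[OF assms]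
  have "fld (\<xi> t) \<in> vector_fields A U" if "t \<in> I" for t
    unfolding vector_fields_def
  proof (intro CollectI conjI allI ballI impI)
    show "fld (\<xi> t) q \<in> tangent_space A q" if "q \<in> U" for q
      using that U tangent_space_eq by (auto simp: fld_def)
    show "smooth_fun A W (\<lambda>q. fld (\<xi> t) q f)" if "open W \<and> W \<subseteq> U \<and> smooth_fun A W f" for W f
      using smooth_in_time_at[OF *[of W f] \<open>t \<in> I\<close>] that U by auto
  qed
  then show ?thesis using * unfolding vector_field_families_def by blast
qed

lemma fld_vector_field:
  assumes U: "open U" "U \<subseteq> cdom c" and xi: "smooth_on (cmap c ` U) \<xi>"
  shows "fld \<xi> \<in> vector_fields A U"
  using fld_vector_field_family[OF U smooth_on_static[OF xi, of "{0}"]]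
  unfolding vector_field_families_def by auto

lemma vector_fields_cong:
  assumes "\<And>q. q \<in> U \<Longrightarrow> X q = Y q" "Y \<in> vector_fields A U" "U \<subseteq> cdom c"
  shows "X \<in> vector_fields A U"
  unfolding vector_fields_def
proof (intro CollectI conjI allI ballI impI)
  show "X q \<in> tangent_space A q" if "q \<in> U" for q
    using assms that by (auto simp: vector_fields_def)
  fix W f assume W: "open W \<and> W \<subseteq> U \<and> smooth_fun A W f"
  then have Wc: "W \<subseteq> cdom c" using assms(3) by auto
  have "smooth_fun A W (\<lambda>q. Y q f)" using assms(2) W by (auto simp: vector_fields_def)
  then show "smooth_fun A W (\<lambda>q. X q f)"
    unfolding smooth_fun_iff[OF Wc]
    by (rule smooth_on_cong[THEN iffD1, rotated]) (use W Wc assms(1) in \<open>auto simp: cinv_cmap subset_iff\<close>)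
qed

text \<open>The components are the values of \<open>X\<close> on the coordinate functions, and their
  smoothness is what membership in \<open>vector_fields\<close> asserts for these test
  functions.\<close>

lemma vector_field_coordinates:
  assumes X: "X \<in> vector_fields A U" and U: "open U" "U \<subseteq> cdom c"
  obtains \<xi> where "smooth_on (cmap c ` U) \<xi>" "\<And>q. q \<in> U \<Longrightarrow> X q = fld \<xi> q"
proof
  define \<xi> where "\<xi> u = (\<Sum>b\<in>Basis. X (cinv c u) (\<lambda>r. cmap c r \<bullet> b) *\<^sub>R b)" for u
  have "smooth_on (cmap c ` U) (\<lambda>u. X (cinv c u) (\<lambda>r. cmap c r \<bullet> b))" for b
  proof -
    have "smooth_fun A U (\<lambda>q. X q (\<lambda>r. cmap c r \<bullet> b))"
      using X coordinate_smooth[OF U(2)] U(1) unfolding vector_fields_def by blast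
    then show ?thesis by (simp add: smooth_fun_iff[OF U(2)] o_def)
  qed
  then show "smooth_on (cmap c ` U) \<xi>" unfolding \<xi>_def
    by (intro smooth_on_sum smooth_on_scaleR smooth_on_const)
  fix q assume q: "q \<in> U"
  then have qc: "q \<in> cdom c" using U by auto
  have "X q \<in> tangent_space A q" using X q by (simp add: vector_fields_def)
  then obtain w where w: "X q = coord_vec A c q w" unfolding tangent_space_eq[OF qc] by blast
  have "\<xi> (cmap c q) = (\<Sum>b\<in>Basis. (w \<bullet> b) *\<^sub>R b)"
    unfolding \<xi>_def using qc by (simp add: cinv_cmap w coord_vec_coordinate)
  then show "X q = fld \<xi> q" by (simp add: fld_def w euclidean_representation)
qed

lemma vertical_field_coordinates:
  assumes Z: "Z \<in> vertical_fields A U" and U: "open U" "U \<subseteq> cdom c"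
  obtains \<zeta> where "smooth_on (cmap c ` U) \<zeta>" "\<And>q. q \<in> U \<Longrightarrow> Z q = fld \<zeta> q"
    "\<And>u. u \<in> cmap c ` U \<Longrightarrow> fst (\<zeta> u) = 0"
proof -
  obtain \<zeta> where z: "smooth_on (cmap c ` U) \<zeta>" "\<And>q. q \<in> U \<Longrightarrow> Z q = fld \<zeta> q"
    using vector_field_coordinates[OF _ U] Z unfolding vertical_fields_def by blast
  have "fst (\<zeta> (cmap c q)) = 0" if "q \<in> U" for q
  proof -
    have qc: "q \<in> cdom c" using that U by auto
    have "Z q \<in> vertical A q" using Z that by (auto simp: vertical_fields_def)
    then obtain w where "Z q = coord_vec A c q (0, w)" using vertical_eq[OF qc] by auto
    then have "coord_vec A c q (\<zeta> (cmap c q)) = coord_vec A c q (0, w)" using z(2)[OF that] by (simp add: fld_def)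
    from coord_vec_inj[OF qc this] show ?thesis by simp
  qed
  with z that show ?thesis by blast
qed

lemma fld_vertical_field:
  assumes U: "open U" "U \<subseteq> cdom c" and xi: "smooth_on (cmap c ` U) \<xi>"
    and "\<And>u. u \<in> cmap c ` U \<Longrightarrow> fst (\<xi> u) = 0"
  shows "fld \<xi> \<in> vertical_fields A U"
  unfolding vertical_fields_def
proof (intro CollectI conjI ballI)
  show "fld \<xi> \<in> vector_fields A U" by (rule fld_vector_field[OF U xi])
  fix q assume q: "q \<in> U"
  then have "\<xi> (cmap c q) = (0, snd (\<xi> (cmap c q)))" using assms(4) by (metis imageI prod.collapse)
  then show "fld \<xi> q \<in> vertical A q"
    unfolding fld_def using vertical_eq q U by (metis (no_types, lifting) rangeI subsetD)
qed

definition bracket where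
  "bracket \<xi> \<eta> u = frechet_derivative \<eta> (at u) (\<xi> u) - frechet_derivative \<xi> (at u) (\<eta> u)"
  for \<xi> \<eta> :: "(real^'n) \<times> (real^'m) \<Rightarrow> (real^'n) \<times> (real^'m)"

text \<open>The product rule for a derivative along a moving direction. By symmetry of second
  derivatives the second-order term is written with \<open>v\<close> frozen and differentiated along
  \<open>\<eta> u\<close>, the form in which it cancels in a commutator.\<close>

lemma second_derivative_along:
  fixes \<eta> :: "(real^'n) \<times> (real^'m) \<Rightarrow> (real^'n) \<times> (real^'m)" and F :: "(real^'n) \<times> (real^'m) \<Rightarrow> real"
  assumes F: "smooth_on V F" and eta: "smooth_on V \<eta>" and V: "open V" "u \<in> V"
  shows "frechet_derivative (\<lambda>w. frechet_derivative F (at w) (\<eta> w)) (at u) v =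
    frechet_derivative F (at u) (frechet_derivative \<eta> (at u) v) +
    frechet_derivative (\<lambda>w. frechet_derivative F (at w) v) (at u) (\<eta> u)"
proof -
  let ?D = "\<lambda>w b. frechet_derivative F (at w) b"
  let ?DD = "\<lambda>b. frechet_derivative (\<lambda>w. ?D w b) (at u)"
  have dF: "((\<lambda>w. ?D w b) has_derivative ?DD b) (at u)" for b
    by (rule smooth_on_has_derivative[OF smooth_on_derivative[OF F V(1)] V])
  have d\<eta>: "(\<eta> has_derivative frechet_derivative \<eta> (at u)) (at u)"
    by (rule smooth_on_has_derivative[OF eta V])
  note exp = frechet_derivative_expand[OF smooth_on_has_derivative[OF F V(1)]]
  have "((\<lambda>w. \<Sum>b\<in>Basis. (\<eta> w \<bullet> b) *\<^sub>R ?D w b) has_derivative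
      (\<lambda>v. \<Sum>b\<in>Basis. (\<eta> u \<bullet> b) *\<^sub>R ?DD b v + (frechet_derivative \<eta> (at u) v \<bullet> b) *\<^sub>R ?D u b)) (at u)"
    by (intro has_derivative_sum has_derivative_scaleR has_derivative_inner_left d\<eta> dF)
  then have "((\<lambda>w. ?D w (\<eta> w)) has_derivative
      (\<lambda>v. \<Sum>b\<in>Basis. (\<eta> u \<bullet> b) *\<^sub>R ?DD b v + (frechet_derivative \<eta> (at u) v \<bullet> b) *\<^sub>R ?D u b)) (at u)"
    by (rule has_derivative_transform_within_open[OF _ V]) (rule exp[symmetric])
  then have "frechet_derivative (\<lambda>w. ?D w (\<eta> w)) (at u) v =
      (\<Sum>b\<in>Basis. (\<eta> u \<bullet> b) *\<^sub>R ?DD b v) + (\<Sum>b\<in>Basis. (frechet_derivative \<eta> (at u) v \<bullet> b) *\<^sub>R ?D u b)"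
    by (simp add: frechet_derivative_at[symmetric] sum.distrib)
  also have "(\<Sum>b\<in>Basis. (\<eta> u \<bullet> b) *\<^sub>R ?DD b v) = (\<Sum>b\<in>Basis. (\<eta> u \<bullet> b) *\<^sub>R ?DD v b)"
    by (simp add: second_derivative_symmetric[OF F V, of _ v])
  also have "\<dots> = ?DD v (\<eta> u)" by (rule frechet_derivative_expand[OF dF, symmetric])
  also have "(\<Sum>b\<in>Basis. (frechet_derivative \<eta> (at u) v \<bullet> b) *\<^sub>R ?D u b) = ?D u (frechet_derivative \<eta> (at u) v)"
    by (rule exp[OF V(2), symmetric])
  finally show ?thesis by simp
qed

text \<open>The second-order terms of the two iterated derivatives agree by symmetry; what remains
  is the derivative of \<open>f\<close> in the direction
  \<open>bracket \<xi> \<eta>\<close>.\<close>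

lemma lie_bracket_fld:
  assumes U: "open U" "U \<subseteq> cdom c" "q \<in> U"
    and xi: "smooth_on (cmap c ` U) \<xi>" "\<And>r. r \<in> U \<Longrightarrow> X r = fld \<xi> r"
    and eta: "smooth_on (cmap c ` U) \<eta>" "\<And>r. r \<in> U \<Longrightarrow> Y r = fld \<eta> r"
  shows "lie_bracket A X Y q = fld (bracket \<xi> \<eta>) q"
proof
  fix f
  have qc: "q \<in> cdom c" using U by auto
  show "lie_bracket A X Y q f = fld (bracket \<xi> \<eta>) q f"
  proof (cases "smooth_near A q f")
    case True
    obtain W where W: "open W" "q \<in> W" "W \<subseteq> U" "smooth_on (cmap c ` W) (f \<circ> cinv c)"
      by (rule smooth_near_in[OF True U(1,3,2)])
    have Wc: "W \<subseteq> cdom c" using W U by auto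
    have fW: "smooth_fun A W f" using W(4) smooth_fun_iff[OF Wc] by simp
    let ?F = "f \<circ> cinv c" and ?V = "cmap c ` W" and ?u = "cmap c q"
    have V: "open ?V" "?u \<in> ?V" using open_image[OF W(1) Wc] W by auto
    have *: "fld \<xi> q (\<lambda>r. Y r f) = frechet_derivative ?F (at ?u) (frechet_derivative \<eta> (at ?u) (\<xi> ?u)) +
        frechet_derivative (\<lambda>w. frechet_derivative ?F (at w) (\<xi> ?u)) (at ?u) (\<eta> ?u)"
      if eta: "smooth_on (cmap c ` U) \<eta>" "\<And>r. r \<in> U \<Longrightarrow> Y r = fld \<eta> r" for \<xi> \<eta> Y
    proof -
      have eW: "smooth_on ?V \<eta>" by (rule smooth_on_subset[OF eta(1) image_mono[OF W(3)]])
      have G: "smooth_on ?V (\<lambda>w. frechet_derivative ?F (at w) (\<eta> w))"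
        by (rule smooth_on_directional[OF W(4) eW V(1)])
      have eq: "frechet_derivative ?F (at w) (\<eta> w) = ((\<lambda>r. Y r f) \<circ> cinv c) w" if "w \<in> ?V" for w
        using that W Wc eta(2) smooth_fun_near[OF fW W(1)]
        by (auto simp: fld_def coord_vec_near cinv_cmap subset_iff)
      have "smooth_on ?V ((\<lambda>r. Y r f) \<circ> cinv c)"
        using G eq by (rule smooth_on_cong[THEN iffD1, rotated])
      then have "smooth_fun A W (\<lambda>r. Y r f)" using smooth_fun_iff[OF Wc] by simp
      \<comment> \<open>Tangent vectors take the default value 0 on functions that are not smooth
        near \<open>q\<close>, so this must be known before the outer operator can be evaluated as a
        derivative.\<close>
      then have near: "smooth_near A q (\<lambda>r. Y r f)" using W by (intro smooth_fun_near)
      have "frechet_derivative ((\<lambda>r. Y r f) \<circ> cinv c) (at ?u) = frechet_derivative (\<lambda>w. frechet_derivative ?F (at w) (\<eta> w)) (at ?u)"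
        by (rule frechet_derivative_at[symmetric],
            rule has_derivative_transform_within_open[OF smooth_on_has_derivative[OF G V] V eq])
      then show ?thesis
        unfolding fld_def[of \<xi>] coord_vec_near[OF near]
        using second_derivative_along[OF W(4) eW V] by simp
    qed
    have 1: "smooth_on ?V \<xi>" "smooth_on ?V \<eta>"
      by (rule smooth_on_subset[OF xi(1) image_mono[OF W(3)]], rule smooth_on_subset[OF eta(1) image_mono[OF W(3)]])
    interpret linear "frechet_derivative ?F (at ?u)"
      using smooth_near_has_derivative[OF True qc] by (rule has_derivative_linear)
    have sym: "frechet_derivative (\<lambda>w. frechet_derivative ?F (at w) (\<xi> ?u)) (at ?u) (\<eta> ?u) =
       frechet_derivative (\<lambda>w. frechet_derivative ?F (at w) (\<eta> ?u)) (at ?u) (\<xi> ?u)"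
      by (rule second_derivative_symmetric[OF W(4) V])
    have "lie_bracket A X Y q f = fld \<xi> q (\<lambda>r. Y r f) - fld \<eta> q (\<lambda>r. X r f)"
      using True U(3) xi(2) eta(2) by (simp add: lie_bracket_def)
    also have "\<dots> = frechet_derivative ?F (at ?u) (bracket \<xi> \<eta> ?u)"
      using *[OF eta, of \<xi>] *[OF xi, of \<eta>] sym unfolding bracket_def diff by linarith
    finally show ?thesis by (simp add: fld_def coord_vec_near[OF True])
  qed (simp add: lie_bracket_def fld_def coord_vec_not_near)
qed

lemma smooth_on_bracket:
  assumes "smooth_on V \<xi>" "smooth_on V \<eta>" "open V"
  shows "smooth_on V (bracket \<xi> \<eta>)"
  unfolding bracket_def[abs_def]
  by (intro smooth_on_diff smooth_on_directional assms)

lemma smooth_on_time_bracket: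
  fixes I :: "real set"
  assumes "smooth_on (I \<times> V) (\<lambda>(t, u). \<xi> t u)" "smooth_on (I \<times> V) (\<lambda>(t, u). \<eta> t u)" "open V"
  shows "smooth_on (I \<times> V) (\<lambda>(t, u). bracket (\<xi> t) (\<eta> t) u)"
  using smooth_on_diff[OF smooth_on_time_directional[OF assms(2,1,3)] smooth_on_time_directional[OF assms(1,2,3)]]
  by (simp add: bracket_def case_prod_unfold)

section \<open>The metric in coordinates, and Gram matrices\<close>

definition gcoord :: "'a tensor2 \<Rightarrow> (real^'n) \<times> (real^'m) \<Rightarrow> (real^'n) \<times> (real^'m) \<Rightarrow> (real^'n) \<times> (real^'m) \<Rightarrow> real" where
  "gcoord g u v w = g (cinv c u) (coord_vec A c (cinv c u) v) (coord_vec A c (cinv c u) w)"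

lemma gcoord_fld: "q \<in> cdom c \<Longrightarrow> g q (fld \<xi> q) (fld \<eta> q) = gcoord g (cmap c q) (\<xi> (cmap c q)) (\<eta> (cmap c q))"
  by (simp add: gcoord_def fld_def cinv_cmap)

context
  fixes g u assumes g: "riemannian_metric A g" and u: "u \<in> cmap c ` cdom c"
begin

lemma in_cdom: "cinv c u \<in> cdom c"
  using u by (auto simp: cinv_cmap)

lemma coord_vec_tangent: "coord_vec A c (cinv c u) v \<in> tangent_space A (cinv c u)"
  by (simp add: tangent_space_eq[OF in_cdom])

lemma gcoord_sym: "gcoord g u v w = gcoord g u w v"
  using g coord_vec_tangent[of v] coord_vec_tangent[of w]
  by (simp add: riemannian_metric_def symmetric_tensor2_def gcoord_def)

lemma gcoord_lincomb: "gcoord g u (a *\<^sub>R v + b *\<^sub>R v') w = a * gcoord g u v w + b * gcoord g u v' w"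
  using g coord_vec_tangent[of v] coord_vec_tangent[of v'] coord_vec_tangent[of w]
  by (simp add: riemannian_metric_def symmetric_tensor2_def gcoord_def coord_vec_lincomb[OF in_cdom])

lemma bilinear_gcoord: "bilinear (gcoord g u)"
proof -
  have 1: "linear (\<lambda>v. gcoord g u v w)" for w
    using gcoord_lincomb[of 1 _ 1] gcoord_lincomb[of _ _ 0 0] by (intro linearI) auto
  then have "linear (\<lambda>v. gcoord g u w v)" for w unfolding gcoord_sym[of w] .
  with 1 show ?thesis by (simp add: bilinear_def)
qed

lemma gcoord_pos: "v \<noteq> 0 \<Longrightarrow> 0 < gcoord g u v v"
proof -
  assume v: "v \<noteq> 0"
  have "coord_vec A c (cinv c u) v \<noteq> coord_vec A c (cinv c u) 0"
    using coord_vec_inj[OF in_cdom] v by blast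
  moreover have "coord_vec A c (cinv c u) 0 = (\<lambda>f. 0)" using coord_vec_0[OF in_cdom] by blast
  ultimately show ?thesis using g coord_vec_tangent[of v] by (simp add: riemannian_metric_def gcoord_def)
qed

lemma gcoord_expand:
  "gcoord g u v w = (\<Sum>p\<in>Basis \<times> Basis. ((v \<bullet> fst p) * (w \<bullet> snd p)) * gcoord g u (fst p) (snd p))"
proof -
  have "gcoord g u v w = gcoord g u (\<Sum>b\<in>Basis. (v \<bullet> b) *\<^sub>R b) (\<Sum>b\<in>Basis. (w \<bullet> b) *\<^sub>R b)"
    by (simp add: euclidean_representation)
  also have "\<dots> = (\<Sum>(b, b')\<in>Basis \<times> Basis. gcoord g u ((v \<bullet> b) *\<^sub>R b) ((w \<bullet> b') *\<^sub>R b'))"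
    by (rule bilinear_sum[OF bilinear_gcoord])
  finally show ?thesis
    by (simp add: bilinear_lmul[OF bilinear_gcoord] bilinear_rmul[OF bilinear_gcoord] mult_ac
        split_beta)
qed

end

text \<open>A smooth metric family is tested only on vector fields without time dependence. Constant
  coordinate fields yield smooth metric coefficients, and the bilinear expansion then admits
  arguments that move with time.\<close>

lemma smooth_on_time_gcoord:
  assumes g: "smooth_metric_family A I g" and U: "open U" "U \<subseteq> cdom c"
    and xi: "smooth_on (I \<times> cmap c ` U) (\<lambda>(t, u). \<xi> t u)"
    and eta: "smooth_on (I \<times> cmap c ` U) (\<lambda>(t, u). \<eta> t u)"
  shows "smooth_on (I \<times> cmap c ` U) (\<lambda>(t, u). gcoord (g t) u (\<xi> t u) (\<eta> t u))"
proof -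
  have 1: "smooth_on (I \<times> cmap c ` U) (\<lambda>(t, u). gcoord (g t) u b b')" for b b'
  proof -
    have "fld (\<lambda>_. b) \<in> vector_fields A U" "fld (\<lambda>_. b') \<in> vector_fields A U"
      by (auto intro: fld_vector_field[OF U])
    then have "smooth_in_time A I U (\<lambda>t q. g t q (fld (\<lambda>_. b) q) (fld (\<lambda>_. b') q))"
      using g U unfolding smooth_metric_family_def by blast
    then show ?thesis unfolding smooth_in_time_iff[OF U(2)]
      by (rule smooth_on_cong[THEN iffD1, rotated])
        (use U in \<open>auto simp: gcoord_fld cinv_cmap\<close>)
  qed
  have "smooth_on (I \<times> cmap c ` U) (\<lambda>x. \<Sum>p\<in>Basis \<times> Basis.
    (((case x of (t, u) \<Rightarrow> \<xi> t u) \<bullet> fst p) * ((case x of (t, u) \<Rightarrow> \<eta> t u) \<bullet> snd p)) *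
      (case x of (t, u) \<Rightarrow> gcoord (g t) u (fst p) (snd p)))"
    by (intro smooth_on_sum smooth_on_mult smooth_on_inner smooth_on_const xi eta 1)
  then show ?thesis
  proof (rule smooth_on_cong[THEN iffD1, rotated])
    fix x assume "x \<in> I \<times> cmap c ` U"
    then obtain t u where x: "x = (t, u)" "t \<in> I" "u \<in> cmap c ` cdom c"
      using image_mono[OF U(2), of "cmap c"] by blast
    have "riemannian_metric A (g t)" using g x by (simp add: smooth_metric_family_def)
    from gcoord_expand[OF this x(3), of "\<xi> t u" "\<eta> t u"]
    show "(\<Sum>p\<in>Basis \<times> Basis.
    (((case x of (t, u) \<Rightarrow> \<xi> t u) \<bullet> fst p) * ((case x of (t, u) \<Rightarrow> \<eta> t u) \<bullet> snd p)) *
      (case x of (t, u) \<Rightarrow> gcoord (g t) u (fst p) (snd p))) = (case x of (t, u) \<Rightarrow> gcoord (g t) u (\<xi> t u) (\<eta> t u))"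
      by (simp add: x)
  qed
qed

end

text \<open>The linear map \<open>L\<close> is kept arbitrary because it is instantiated both by the
  inclusion of leaf directions and by the horizontal lift.\<close>

lemma bilinear_gram_matrix:
  fixes h :: "'b::real_vector \<Rightarrow> 'b \<Rightarrow> real" and L :: "real^'k \<Rightarrow> 'b"
  assumes h: "bilinear h" and L: "linear L"
  shows "h (L v) (L w) = v \<bullet> ((\<chi> i j. h (L (axis i 1)) (L (axis j 1))) *v w)"
proof -
  interpret L: linear L by (rule L)
  have exp: "L v = (\<Sum>i\<in>UNIV. v $ i *\<^sub>R L (axis i 1))" for v
  proof -
    have "L v = L (\<Sum>i\<in>UNIV. v $ i *\<^sub>R axis i 1)"
      by (simp add: basis_expansion flip: scalar_mult_eq_scaleR)
    then show ?thesis by (simp add: L.sum L.scale)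
  qed
  have "h (L v) (L w) = (\<Sum>(i, j)\<in>UNIV \<times> UNIV. h (v $ i *\<^sub>R L (axis i 1)) (w $ j *\<^sub>R L (axis j 1)))"
    unfolding exp[of v] exp[of w] by (rule bilinear_sum[OF h])
  also have "\<dots> = (\<Sum>i\<in>UNIV. \<Sum>j\<in>UNIV. v $ i * (w $ j * h (L (axis i 1)) (L (axis j 1))))"
    by (simp add: sum.cartesian_product bilinear_lmul[OF h] bilinear_rmul[OF h]
        split_beta mult.left_commute)
  also have "\<dots> = v \<bullet> ((\<chi> i j. h (L (axis i 1)) (L (axis j 1))) *v w)"
    by (simp add: inner_vec_def matrix_vector_mult_def sum_distrib_left mult_ac)
  finally show ?thesis .
qed

lemma gram_matrix_spd:
  fixes h :: "'b::real_vector \<Rightarrow> 'b \<Rightarrow> real" and L :: "real^'k \<Rightarrow> 'b"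
  assumes h: "bilinear h" and L: "linear L" and sym: "\<And>v w. h v w = h w v"
    and pos: "\<And>v. v \<noteq> 0 \<Longrightarrow> 0 < h (L v) (L v)"
  shows "(\<chi> i j. h (L (axis i 1)) (L (axis j 1))) \<in> spd"
  unfolding spd_def
proof (intro CollectI conjI allI impI)
  show "transpose (\<chi> i j. h (L (axis i 1)) (L (axis j 1))) = (\<chi> i j. h (L (axis i 1)) (L (axis j 1)))"
    unfolding transpose_def vec_eq_iff by (simp add: sym)
  show "0 < v \<bullet> ((\<chi> i j. h (L (axis i 1)) (L (axis j 1))) *v v)" if "v \<noteq> 0" for v
    unfolding bilinear_gram_matrix[OF h L, symmetric] by (rule pos[OF that])
qed

section \<open>The transverse flow in a product chart\<close>

text \<open>Convexity of \<open>Z\<close> lets a vanishing derivative along the leaves integrate to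
  constancy on whole plaques of \<open>U\<close>.\<close>

locale flow_chart = foliated_chart A c
  for A :: "('a::topological_space, 'n::finite, 'm::finite) fchart set" and c +
  fixes g0 :: "'a tensor2" and I :: "real set" and g h :: "real \<Rightarrow> 'a tensor2"
    and U :: "'a set" and Y :: "(real^'n) set" and Z :: "(real^'m) set" and u0
  assumes riem0: "riemannian_metric A g0"
    and tot_geod: "totally_geodesic_leaves A g0"
    and flow: "transverse_flow A g0 I g h"
    and I: "is_interval I" "0 \<in> I"
    and bundle_like: "\<And>t. t \<in> I \<Longrightarrow> bundle_like A (g t)"
    and U: "open U" "U \<subseteq> cdom c"
    and V: "cmap c ` U = Y \<times> Z" and Z: "convex Z" and u0: "u0 \<in> cmap c ` U"
begin

abbreviation V :: "((real^'n) \<times> (real^'m)) set" where "V \<equiv> cmap c ` U"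

lemma V_open: "open V" by (rule open_image[OF U])
lemma V_chart: "u \<in> V \<Longrightarrow> u \<in> cmap c ` cdom c" using U by blast
lemma cinv_U: "u \<in> V \<Longrightarrow> cinv c u \<in> U" using U by (auto simp: cinv_cmap subset_iff)
lemma cmap_cinv_V: "u \<in> V \<Longrightarrow> cmap c (cinv c u) = u" using V_chart cmap_cinv by blast

lemma metric_family: "smooth_metric_family A I g"
  using flow by (simp add: transverse_flow_def)

lemma riem: "t \<in> I \<Longrightarrow> riemannian_metric A (g t)"
  using metric_family by (simp add: smooth_metric_family_def)

lemma tangent: "u \<in> V \<Longrightarrow> coord_vec A c (cinv c u) v \<in> tangent_space A (cinv c u)"
  using tangent_space_eq[of "cinv c u"] cinv_U U by (auto simp: subset_iff)

lemma vertical_coord: "u \<in> V \<Longrightarrow> coord_vec A c (cinv c u) (0, w) \<in> vertical A (cinv c u)"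
  using vertical_eq[of "cinv c u"] cinv_U U by (auto simp: subset_iff)

lemma gcoord_0: "u \<in> V \<Longrightarrow> gcoord (g 0) u v w = gcoord g0 u v w"
  using flow tangent unfolding transverse_flow_def gcoord_def by blast

text \<open>The time derivative vanishes on the interval \<open>I\<close>, which contains 0, where
  the metric is \<open>g0\<close>.\<close>

lemma gcoord_vertical:
  assumes t: "t \<in> I" and u: "u \<in> V"
  shows "gcoord (g t) u (0, v) (0, w) = gcoord g0 u (0, v) (0, w)"
proof -
  have "((\<lambda>s. gcoord (g s) u (0, v) (0, w)) has_real_derivative 0) (at s within I)" if "s \<in> I" for s
    using flow that vertical_coord[OF u] unfolding transverse_flow_def gcoord_def by blast
  then obtain k where "\<And>s. s \<in> I \<Longrightarrow> gcoord (g s) u (0, v) (0, w) = k"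
    using has_field_derivative_zero_constant[of I "\<lambda>s. gcoord (g s) u (0, v) (0, w)"]
      is_interval_convex[OF I(1)] by blast
  then show ?thesis using t I(2) gcoord_0[OF u] by metis
qed

lemma gcoord_horizontal:
  assumes t: "t \<in> I" and u: "u \<in> V" and v: "\<And>w. gcoord g0 u v (0, w) = 0"
  shows "gcoord (g t) u v (0, w) = 0"
proof -
  let ?q = "cinv c u"
  have "coord_vec A c ?q v \<in> horizontal A g0 ?q"
    using v tangent[OF u] vertical_eq[of ?q] cinv_U[OF u] U
    by (auto simp: horizontal_def gcoord_def subset_iff)
  then show ?thesis
    using flow t vertical_coord[OF u] unfolding transverse_flow_def gcoord_def by blast
qed

lemmas bilin = bilinear_gcoord[OF riem V_chart]
lemmas bilin0 = bilinear_gcoord[OF riem0 V_chart]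

section \<open>Joint smoothness in time and space\<close>

definition tsmooth :: "(real \<Rightarrow> (real^'n) \<times> (real^'m) \<Rightarrow> 'b::real_normed_vector) \<Rightarrow> bool" where
  "tsmooth f \<longleftrightarrow> smooth_on (I \<times> V) (\<lambda>(t, u). f t u)"

lemma tsmooth_iff: "tsmooth f \<longleftrightarrow> smooth_on (I \<times> V) (\<lambda>x. f (fst x) (snd x))"
  by (simp add: tsmooth_def case_prod_unfold)

lemma tsmooth_cong:
  assumes "tsmooth f" "\<And>t u. t \<in> I \<Longrightarrow> u \<in> V \<Longrightarrow> f t u = f' t u"
  shows "tsmooth f'"
  using assms(1) unfolding tsmooth_iff
  by (rule smooth_on_cong[THEN iffD1, rotated]) (metis assms(2) mem_Times_iff)

lemma tsmooth_static: "smooth_on V f \<Longrightarrow> tsmooth (\<lambda>t. f)"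
  unfolding tsmooth_def by (rule smooth_on_static)

lemma tsmooth_const: "tsmooth (\<lambda>t u. k)"
  unfolding tsmooth_iff by (rule smooth_on_const)

lemma tsmooth_at: "tsmooth f \<Longrightarrow> t \<in> I \<Longrightarrow> smooth_on V (f t)"
  unfolding tsmooth_def by (rule smooth_on_at_time)

lemma tsmooth_point: "tsmooth f \<Longrightarrow> tsmooth (\<lambda>t u. f t u0)"
  unfolding tsmooth_def by (rule smooth_on_at_point[OF _ u0])

lemma tsmooth_add: "tsmooth f \<Longrightarrow> tsmooth f' \<Longrightarrow> tsmooth (\<lambda>t u. f t u + f' t u)"
  unfolding tsmooth_iff by (rule smooth_on_add)

lemma tsmooth_diff: "tsmooth f \<Longrightarrow> tsmooth f' \<Longrightarrow> tsmooth (\<lambda>t u. f t u - f' t u)"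
  unfolding tsmooth_iff by (rule smooth_on_diff)

lemma tsmooth_sum: "(\<And>i. i \<in> J \<Longrightarrow> tsmooth (f i)) \<Longrightarrow> tsmooth (\<lambda>t u. \<Sum>i\<in>J. f i t u)"
  unfolding tsmooth_iff by (rule smooth_on_sum)

lemma tsmooth_mult:
  fixes f f' :: "real \<Rightarrow> (real^'n) \<times> (real^'m) \<Rightarrow> real"
  shows "tsmooth f \<Longrightarrow> tsmooth f' \<Longrightarrow> tsmooth (\<lambda>t u. f t u * f' t u)"
  unfolding tsmooth_iff by (rule smooth_on_mult)

lemma tsmooth_scaleR: "tsmooth f \<Longrightarrow> tsmooth f' \<Longrightarrow> tsmooth (\<lambda>t u. f t u *\<^sub>R f' t u)"
  unfolding tsmooth_iff by (rule smooth_on_scaleR)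

lemma tsmooth_inner:
  fixes f f' :: "real \<Rightarrow> (real^'n) \<times> (real^'m) \<Rightarrow> 'b::euclidean_space"
  shows "tsmooth f \<Longrightarrow> tsmooth f' \<Longrightarrow> tsmooth (\<lambda>t u. f t u \<bullet> f' t u)"
  unfolding tsmooth_iff by (rule smooth_on_inner)

lemma tsmooth_matrix_mult:
  fixes f :: "real \<Rightarrow> (real^'n) \<times> (real^'m) \<Rightarrow> real^'i^'j" and f' :: "real \<Rightarrow> (real^'n) \<times> (real^'m) \<Rightarrow> real^'k^'i"
  shows "tsmooth f \<Longrightarrow> tsmooth f' \<Longrightarrow> tsmooth (\<lambda>t u. f t u ** f' t u)"
  unfolding tsmooth_iff by (rule smooth_on_matrix_mult)

lemma tsmooth_matrix_vector_mult:
  fixes f :: "real \<Rightarrow> (real^'n) \<times> (real^'m) \<Rightarrow> real^'i^'j"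
  shows "tsmooth f \<Longrightarrow> tsmooth f' \<Longrightarrow> tsmooth (\<lambda>t u. f t u *v f' t u)"
  unfolding tsmooth_iff by (rule smooth_on_matrix_vector_mult)

lemma tsmooth_vec_nth:
  fixes f :: "real \<Rightarrow> (real^'n) \<times> (real^'m) \<Rightarrow> 'b::euclidean_space^'i"
  shows "tsmooth f \<Longrightarrow> tsmooth (\<lambda>t u. f t u $ i)"
  unfolding tsmooth_iff by (rule smooth_on_vec_nth)

lemma tsmooth_vec_lambda:
  fixes f :: "'i::finite \<Rightarrow> real \<Rightarrow> (real^'n) \<times> (real^'m) \<Rightarrow> 'b::euclidean_space"
  shows "(\<And>i. tsmooth (f i)) \<Longrightarrow> tsmooth (\<lambda>t u. \<chi> i. f i t u)"
  unfolding tsmooth_iff by (rule smooth_on_vec_lambda)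

lemma tsmooth_fst:
  fixes f :: "real \<Rightarrow> (real^'n) \<times> (real^'m) \<Rightarrow> 'b::euclidean_space \<times> 'd::euclidean_space"
  shows "tsmooth f \<Longrightarrow> tsmooth (\<lambda>t u. fst (f t u))"
  unfolding tsmooth_iff by (rule smooth_on_fst)

lemma tsmooth_compose:
  fixes f :: "real \<Rightarrow> (real^'n) \<times> (real^'m) \<Rightarrow> 'b::euclidean_space"
  assumes "smooth_on S F" "tsmooth f" "\<And>t u. t \<in> I \<Longrightarrow> u \<in> V \<Longrightarrow> f t u \<in> S"
  shows "tsmooth (\<lambda>t u. F (f t u))"
  using assms(2) unfolding tsmooth_iff
  by (rule smooth_on_compose[OF _ assms(1)]) (auto intro: assms(3))

lemma tsmooth_bracket: "tsmooth \<xi> \<Longrightarrow> tsmooth \<eta> \<Longrightarrow> tsmooth (\<lambda>t. bracket (\<xi> t) (\<eta> t))"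
  unfolding tsmooth_def by (rule smooth_on_time_bracket[OF _ _ V_open])

lemma tsmooth_gcoord: "tsmooth \<xi> \<Longrightarrow> tsmooth \<eta> \<Longrightarrow> tsmooth (\<lambda>t u. gcoord (g t) u (\<xi> t u) (\<eta> t u))"
  unfolding tsmooth_def by (rule smooth_on_time_gcoord[OF metric_family U])

lemma smooth_gcoord0:
  assumes "smooth_on V \<xi>" "smooth_on V \<eta>" shows "smooth_on V (\<lambda>u. gcoord g0 u (\<xi> u) (\<eta> u))"
  using tsmooth_at[OF tsmooth_gcoord[OF tsmooth_static[OF assms(1)] tsmooth_static[OF assms(2)]] I(2)]
  by (rule smooth_on_cong[THEN iffD1, rotated]) (rule gcoord_0)

text \<open>The metric is frozen at \<open>g0\<close> while the arguments move with time; expansion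
  in \<open>Basis\<close> separates the two dependences.\<close>

lemma tsmooth_gcoord0:
  assumes "tsmooth \<xi>" "tsmooth \<eta>"
  shows "tsmooth (\<lambda>t u. gcoord g0 u (\<xi> t u) (\<eta> t u))"
proof -
  have "tsmooth (\<lambda>t u. \<Sum>p\<in>Basis \<times> Basis. ((\<xi> t u \<bullet> fst p) * (\<eta> t u \<bullet> snd p)) * gcoord g0 u (fst p) (snd p))"
    by (intro tsmooth_sum tsmooth_mult tsmooth_inner assms tsmooth_const tsmooth_static
        smooth_gcoord0 smooth_on_const)
  then show ?thesis
    by (rule tsmooth_cong) (rule gcoord_expand[OF riem0 V_chart, symmetric])
qed

lemma smooth_in_time_coord:
  assumes "tsmooth f" shows "smooth_in_time A I U (\<lambda>t q. f t (cmap c q))"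
proof -
  have "tsmooth (\<lambda>t u. f t (cmap c (cinv c u)))"
    using assms by (rule tsmooth_cong) (simp add: cmap_cinv_V)
  then show ?thesis unfolding smooth_in_time_iff[OF U(2)] tsmooth_def .
qed

lemma coord_vec_locally_const:
  assumes "q \<in> U" "\<And>r. r \<in> U \<Longrightarrow> f r = k"
  shows "coord_vec A c q w f = 0"
proof (cases "smooth_near A q f")
  case True
  have "((\<lambda>u. k) has_derivative (\<lambda>w. 0)) (at (cmap c q))" by simp
  then have "(f \<circ> cinv c has_derivative (\<lambda>w. 0)) (at (cmap c q))"
    by (rule has_derivative_transform_within_open[OF _ V_open]) (use assms cinv_U in auto)
  then show ?thesis using True by (simp add: coord_vec_near frechet_derivative_at[symmetric])
qed (simp add: coord_vec_not_near)

text \<open>The transverse part of a bracket involves only derivatives of transverse components. For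
  lifted fields these components are the frame coefficients, so the leaf component of the lift is
  never differentiated.\<close>

lemma fst_bracket:
  assumes "smooth_on V \<xi>" "smooth_on V \<eta>" "u \<in> V"
    and a: "((\<lambda>u. fst (\<xi> u)) has_derivative a) (at u)"
    and b: "((\<lambda>u. fst (\<eta> u)) has_derivative b) (at u)"
  shows "fst (bracket \<xi> \<eta> u) = b (\<xi> u) - a (\<eta> u)"
proof -
  have "(\<lambda>v. fst (frechet_derivative \<xi> (at u) v)) = a"
    using has_derivative_fst[OF smooth_on_has_derivative[OF assms(1) V_open assms(3)]] a
    by (rule has_derivative_unique)
  moreover have "(\<lambda>v. fst (frechet_derivative \<eta> (at u) v)) = b"
    using has_derivative_fst[OF smooth_on_has_derivative[OF assms(2) V_open assms(3)]] b
    by (rule has_derivative_unique)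
  ultimately show ?thesis by (auto simp: bracket_def)
qed

lemma bracket_eq:
  assumes "(\<xi> has_derivative \<xi>') (at u)" "(\<eta> has_derivative \<eta>') (at u)"
  shows "bracket \<xi> \<eta> u = \<eta>' (\<xi> u) - \<xi>' (\<eta> u)"
  using assms by (simp add: bracket_def frechet_derivative_at[symmetric])

section \<open>Basic functions, in the sense of foliation theory\<close>

definition basic :: "((real^'n) \<times> (real^'m) \<Rightarrow> 'b) \<Rightarrow> bool" where
  "basic f \<longleftrightarrow> (\<forall>u\<in>V. \<forall>v\<in>V. fst u = fst v \<longrightarrow> f u = f v)"

lemma basicD: "basic f \<Longrightarrow> u \<in> V \<Longrightarrow> v \<in> V \<Longrightarrow> fst u = fst v \<Longrightarrow> f u = f v"
  unfolding basic_def by blast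

lemma basic_derivative:
  fixes f :: "(real^'n) \<times> (real^'m) \<Rightarrow> 'b::real_normed_vector"
  assumes "basic f" "(f has_derivative f') (at u)" "u \<in> V"
  shows "f' (0, w) = 0"
proof -
  define p where "p s = u + s *\<^sub>R (0 :: real^'n, w)" for s
  have p0: "p 0 = u" by (simp only: p_def scaleR_zero_left add_0_right)
  have "(p has_derivative (\<lambda>s. s *\<^sub>R (0, w))) (at 0)" unfolding p_def[abs_def]
    by (auto intro!: derivative_eq_intros)
  from diff_chain_at[OF this, of f f'] p0 assms(2)
  have 1: "(f \<circ> p has_derivative f' \<circ> (\<lambda>s. s *\<^sub>R (0, w))) (at 0)" by simp
  have "((\<lambda>s. f u) has_derivative (\<lambda>s. 0)) (at 0)" by simp
  then have "(f \<circ> p has_derivative (\<lambda>s. 0)) (at 0)"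
  proof (rule has_derivative_transform_within_open)
    show "open (p -` V)" unfolding p_def[abs_def]
      by (intro open_vimage V_open continuous_intros)
    show "0 \<in> p -` V" using p0 assms(3) by simp
    fix s assume "s \<in> p -` V"
    then have "p s \<in> V" by simp
    moreover have "fst u = fst (p s)" by (simp add: p_def)
    ultimately show "f u = (f \<circ> p) s" using basicD[OF assms(1,3)] by simp
  qed
  from fun_cong[OF has_derivative_unique[OF 1 this], of 1]
  show ?thesis by (simp only: o_apply scaleR_one)
qed

text \<open>Restricted to a plaque, \<open>f\<close> has zero derivative on the convex set
  \<open>Z\<close> and is therefore constant there.\<close>

lemma basicI:
  fixes f :: "(real^'n) \<times> (real^'m) \<Rightarrow> 'b::real_normed_vector"
  assumes "\<And>u. u \<in> V \<Longrightarrow> (f has_derivative f' u) (at u)" "\<And>u w. u \<in> V \<Longrightarrow> f' u (0, w) = 0"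
  shows "basic f"
  unfolding basic_def
proof (intro ballI impI)
  fix u v assume uv: "u \<in> V" "v \<in> V" "fst u = fst v"
  let ?y = "fst u"
  have y: "?y \<in> Y" "snd u \<in> Z" "snd v \<in> Z" using uv unfolding V by auto
  have "((\<lambda>z. f (?y, z)) has_derivative (\<lambda>w. 0)) (at z within Z)" if "z \<in> Z" for z
  proof -
    have z: "(?y, z) \<in> V" unfolding V using y that by simp
    have "((\<lambda>z. (?y, z)) has_derivative (\<lambda>w. (0, w))) (at z)"
      by (intro has_derivative_Pair has_derivative_const has_derivative_ident)
    from diff_chain_at[OF this assms(1)[OF z]]
    have "((\<lambda>z. f (?y, z)) has_derivative (\<lambda>w. 0)) (at z)"
      by (simp add: o_def assms(2)[OF z])
    then show ?thesis by (rule has_derivative_at_withinI)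
  qed
  then obtain k where "\<And>z. z \<in> Z \<Longrightarrow> f (?y, z) = k"
    using has_derivative_zero_constant[OF Z] by blast
  then show "f u = f v" using y uv(3) by (metis prod.collapse)
qed

section \<open>Total geodesy as skewness of brackets\<close>

text \<open>Let X, Z, W be the fields of \<open>\<xi>\<close>, \<open>\<zeta>\<close>,
  \<open>\<zeta>'\<close>. Then <D_Z X, W> = Z<X, W> - <X, D_Z W> = 0, because X is horizontal while
  W and, by total geodesy, D_Z W are vertical. As the connection is torsion free, <[X, Z], W> = <D_X
  Z, W>, and likewise with Z and W exchanged. The sum is therefore X<Z, W>, the derivative of a
  constant.\<close>

lemma totally_geodesic_skew:
  assumes xi: "smooth_on V \<xi>" "\<And>u w. u \<in> V \<Longrightarrow> gcoord g0 u (\<xi> u) (0, w) = 0"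
    and z: "smooth_on V \<zeta>" "\<And>u. u \<in> V \<Longrightarrow> fst (\<zeta> u) = 0"
    and z': "smooth_on V \<zeta>'" "\<And>u. u \<in> V \<Longrightarrow> fst (\<zeta>' u) = 0"
    and const: "\<And>u. u \<in> V \<Longrightarrow> gcoord g0 u (\<zeta> u) (\<zeta>' u) = k"
    and u: "u \<in> V"
  shows "gcoord g0 u (bracket \<xi> \<zeta> u) (\<zeta>' u) + gcoord g0 u (\<zeta> u) (bracket \<xi> \<zeta>' u) = 0"
proof -
  obtain D where D: "levi_civita A g0 U D"
    and DV: "\<And>Z W. Z \<in> vertical_fields A U \<Longrightarrow> W \<in> vertical_fields A U \<Longrightarrow> D Z W \<in> vertical_fields A U"
    using tot_geod U(1) unfolding totally_geodesic_leaves_def by metis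
  let ?q = "cinv c u"
  have q: "?q \<in> U" "?q \<in> cdom c" "cmap c ?q = u" using cinv_U[OF u] U cmap_cinv_V[OF u] by auto
  let ?X = "fld \<xi>" and ?Z = "fld \<zeta>" and ?W = "fld \<zeta>'"
  have X: "?X \<in> vector_fields A U" by (rule fld_vector_field[OF U xi(1)])
  have Zv: "?Z \<in> vertical_fields A U" by (rule fld_vertical_field[OF U z])
  have Wv: "?W \<in> vertical_fields A U" by (rule fld_vertical_field[OF U z'])
  have ZW: "?Z \<in> vector_fields A U" "?W \<in> vector_fields A U"
    using Zv Wv by (auto simp: vertical_fields_def)
  have Dvf: "D X Y \<in> vector_fields A U" if "X \<in> vector_fields A U" "Y \<in> vector_fields A U" for X Y
    using D that by (simp add: levi_civita_def)
  have T: "X ?q \<in> tangent_space A ?q" if "X \<in> vector_fields A U" for X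
    using that q by (simp add: vector_fields_def)
  have lin: "g0 ?q (lincomb a v b v') w = a * g0 ?q v w + b * g0 ?q v' w"
    if "v \<in> tangent_space A ?q" "v' \<in> tangent_space A ?q" "w \<in> tangent_space A ?q" for a b v v' w
    using riem0 that by (simp add: riemannian_metric_def symmetric_tensor2_def)
  have sym: "g0 ?q v w = g0 ?q w v" if "v \<in> tangent_space A ?q" "w \<in> tangent_space A ?q" for v w
    using riem0 that by (simp add: riemannian_metric_def symmetric_tensor2_def)
  have comp: "X ?q (\<lambda>r. g0 r (Y r) (W r)) = g0 ?q (D X Y ?q) (W ?q) + g0 ?q (Y ?q) (D X W ?q)"
    and tors: "lincomb 1 (D X Y ?q) (-1) (D Y X ?q) = lie_bracket A X Y ?q"
    if "X \<in> vector_fields A U" "Y \<in> vector_fields A U" "W \<in> vector_fields A U" for X Y W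
    using D that q(1) unfolding levi_civita_def by blast+
  have hor: "g0 r (?X r) v = 0" if rU: "r \<in> U" and v: "v \<in> vertical A r" for r v
  proof -
    have r: "r \<in> cdom c" using rU U by auto
    obtain w where "v = coord_vec A c r (0, w)" using v vertical_eq[OF r] by auto
    then show ?thesis using xi(2)[of "cmap c r" w] rU r by (simp add: fld_def gcoord_def cinv_cmap)
  qed
  have DX: "g0 ?q (D Z ?X ?q) (W ?q) = 0"
    if Z: "Z \<in> vertical_fields A U" and W: "W \<in> vertical_fields A U" for Z W
  proof -
    have vf: "Z \<in> vector_fields A U" "W \<in> vector_fields A U" using Z W by (auto simp: vertical_fields_def)
    have "Z ?q (\<lambda>r. g0 r (?X r) (W r)) = 0"
    proof -
      obtain v where "Z ?q = coord_vec A c ?q v" using T[OF vf(1)] tangent_space_eq[OF q(2)] by auto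
      moreover have "g0 r (?X r) (W r) = 0" if "r \<in> U" for r
        using hor[OF that] W that by (simp add: vertical_fields_def)
      ultimately show ?thesis using coord_vec_locally_const[OF q(1), of "\<lambda>r. g0 r (?X r) (W r)" 0] by simp
    qed
    moreover have "g0 ?q (?X ?q) (D Z W ?q) = 0"
      using hor[OF q(1)] DV[OF Z W] q(1) by (simp add: vertical_fields_def)
    ultimately show ?thesis using comp[OF vf(1) X vf(2)] by simp
  qed
  have br: "g0 ?q (lie_bracket A ?X Z ?q) (W ?q) = g0 ?q (D ?X Z ?q) (W ?q)"
    if Z: "Z \<in> vertical_fields A U" and W: "W \<in> vertical_fields A U" for Z W
  proof -
    have vf: "Z \<in> vector_fields A U" "W \<in> vector_fields A U" using Z W by (auto simp: vertical_fields_def)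
    show ?thesis
      unfolding tors[OF X vf(1) vf(1), symmetric]
      using lin[OF T[OF Dvf[OF X vf(1)]] T[OF Dvf[OF vf(1) X]] T[OF vf(2)], of 1 "-1"] DX[OF Z W]
      by simp
  qed
  have "?X ?q (\<lambda>r. g0 r (?Z r) (?W r)) = 0"
  proof -
    have "g0 r (?Z r) (?W r) = k" if "r \<in> U" for r
    proof -
      have "r \<in> cdom c" using that U by auto
      then show ?thesis using const[of "cmap c r"] that by (simp add: gcoord_fld)
    qed
    then show ?thesis
      using coord_vec_locally_const[OF q(1), of "\<lambda>r. g0 r (?Z r) (?W r)" k] by (simp add: fld_def[of \<xi>])
  qed
  then have sum0: "g0 ?q (lie_bracket A ?X ?Z ?q) (?W ?q) + g0 ?q (?Z ?q) (lie_bracket A ?X ?W ?q) = 0"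
  proof -
    have "lie_bracket A ?X ?W ?q \<in> tangent_space A ?q"
      unfolding lie_bracket_fld[OF U q(1) xi(1) refl z'(1) refl] tangent_space_eq[OF q(2)]
      by (simp add: fld_def)
    then have "g0 ?q (?Z ?q) (lie_bracket A ?X ?W ?q) = g0 ?q (D ?X ?W ?q) (?Z ?q)"
      using sym T ZW br[OF Wv Zv] by metis
    moreover have "g0 ?q (D ?X ?W ?q) (?Z ?q) = g0 ?q (?Z ?q) (D ?X ?W ?q)"
      by (rule sym[OF T[OF Dvf[OF X ZW(2)]] T[OF ZW(1)]])
    ultimately show ?thesis
      using br[OF Zv Wv] comp[OF X ZW] \<open>?X ?q (\<lambda>r. g0 r (?Z r) (?W r)) = 0\<close> by simp
  qed
  have "lie_bracket A ?X ?Z ?q = fld (bracket \<xi> \<zeta>) ?q"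
    by (rule lie_bracket_fld[OF U q(1) xi(1) refl z(1) refl])
  moreover have "lie_bracket A ?X ?W ?q = fld (bracket \<xi> \<zeta>') ?q"
    by (rule lie_bracket_fld[OF U q(1) xi(1) refl z'(1) refl])
  ultimately show ?thesis using sum0 by (simp add: gcoord_fld[OF q(2)] q(3))
qed

end

section \<open>Adapted frames\<close>

context flow_chart
begin

section \<open>Horizontal lifts and their Gram matrix\<close>

lemma linear_vert: "linear (\<lambda>w. (0 :: real^'n, w :: real^'m))"
  by (auto intro!: linearI)

definition vert_gram :: "(real^'n) \<times> (real^'m) \<Rightarrow> real^'m^'m" where
  "vert_gram u = (\<chi> k l. gcoord g0 u (0, axis k 1) (0, axis l 1))"

lemma gcoord0_vert: "u \<in> V \<Longrightarrow> gcoord g0 u (0, v) (0, w) = v \<bullet> (vert_gram u *v w)"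
  unfolding vert_gram_def by (rule bilinear_gram_matrix[OF bilin0 linear_vert])

lemma vert_gram_spd:
  assumes "u \<in> V" shows "vert_gram u \<in> spd"
  unfolding vert_gram_def
proof (rule gram_matrix_spd[OF bilin0[OF assms] linear_vert gcoord_sym[OF riem0 V_chart[OF assms]]])
  show "0 < gcoord g0 u (0, v) (0, v)" if "v \<noteq> 0" for v
    by (rule gcoord_pos[OF riem0 V_chart[OF assms]]) (use that in \<open>simp add: zero_prod_def\<close>)
qed

lemma smooth_vert_gram: "smooth_on V vert_gram"
  unfolding vert_gram_def[abs_def]
  by (intro smooth_on_vec_lambda smooth_gcoord0 smooth_on_const)

definition vert_frame0 :: "(real^'n) \<times> (real^'m) \<Rightarrow> real^'m^'m" where
  "vert_frame0 u = gram_schmidt (vert_gram u)"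

lemma smooth_vert_frame0: "smooth_on V vert_frame0"
  unfolding vert_frame0_def[abs_def]
  by (rule smooth_on_compose[OF smooth_vert_gram smooth_on_gram_schmidt]) (auto intro: vert_gram_spd)

lemma vert_frame0_orthonormal: "u \<in> V \<Longrightarrow> vert_frame0 u ** vert_gram u ** transpose (vert_frame0 u) = mat 1"
  unfolding vert_frame0_def by (rule gram_schmidt_orthonormal[OF vert_gram_spd])

text \<open>The vector \<open>(y, 0)\<close> minus its \<open>g0\<close>-orthogonal projection to
  the leaf, computed in an orthonormal vertical frame. Using \<open>g0\<close> at every time is
  legitimate because the horizontal bundle is fixed.\<close>

definition lift :: "(real^'n) \<times> (real^'m) \<Rightarrow> real^'n \<Rightarrow> (real^'n) \<times> (real^'m)" where
  "lift u y = (y, - (\<Sum>k\<in>UNIV. gcoord g0 u (y, 0) (0, vert_frame0 u $ k) *\<^sub>R vert_frame0 u $ k))"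

lemma fst_lift [simp]: "fst (lift u y) = y"
  by (simp add: lift_def)

lemma gcoord0_linear:
  assumes u: "u \<in> V"
  shows "linear (\<lambda>v. gcoord g0 u v w)" "linear (\<lambda>w. gcoord g0 u v w)"
  using bilin0[OF u] unfolding bilinear_def by blast+

lemma linear_lift:
  assumes u: "u \<in> V" shows "linear (lift u)"
proof -
  have 1: "linear (\<lambda>y. gcoord g0 u (y, 0) w)" for w
  proof -
    have "linear ((\<lambda>v. gcoord g0 u v w) \<circ> (\<lambda>y. (y, 0)))"
      by (rule linear_compose[OF _ gcoord0_linear(1)[OF u]]) (auto intro!: linearI)
    then show ?thesis by (simp add: o_def)
  qed
  have "linear (\<lambda>y. - (\<Sum>k\<in>UNIV. gcoord g0 u (y, 0) (0, vert_frame0 u $ k) *\<^sub>R vert_frame0 u $ k))"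
    by (intro linear_compose_neg linear_compose_sum ballI)
      (auto intro!: linearI simp: linear_add[OF 1] linear_cmul[OF 1] scaleR_add_left)
  then show ?thesis
    unfolding lift_def[abs_def] linear_conv_bounded_linear
    by (intro bounded_linear_Pair bounded_linear_ident)
qed

lemma lift_horizontal:
  assumes u: "u \<in> V" shows "gcoord g0 u (lift u y) (0, w) = 0"
proof -
  let ?c = "\<lambda>k. gcoord g0 u (y, 0) (0, vert_frame0 u $ k)"
  let ?s = "\<Sum>k\<in>UNIV. ?c k *\<^sub>R vert_frame0 u $ k"
  have "linear (\<lambda>w. gcoord g0 u (y, 0) (0, w))"
    using linear_compose[OF linear_vert gcoord0_linear(2)[OF u]] by (simp add: o_def)
  then interpret l: linear "\<lambda>w. gcoord g0 u (y, 0) (0, w)" .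
  \<comment> \<open>Expanding \<open>w\<close> in the orthonormal rows identifies pairing with
    \<open>(y, 0)\<close> and pairing with its vertical projection.\<close>
  have "gcoord g0 u (y, 0) (0, w) = gcoord g0 u (y, 0) (0, \<Sum>k\<in>UNIV. (w \<bullet> (vert_gram u *v vert_frame0 u $ k)) *\<^sub>R vert_frame0 u $ k)"
    using orthonormal_rows_expansion[OF vert_frame0_orthonormal[OF u], of w] by simp
  also have "\<dots> = (\<Sum>k\<in>UNIV. (w \<bullet> (vert_gram u *v vert_frame0 u $ k)) * ?c k)"
    by (simp add: l.sum l.scale)
  also have "\<dots> = ?s \<bullet> (vert_gram u *v w)"
    by (simp add: inner_sum_left spd_inner_commute[OF vert_gram_spd[OF u], of w] mult.commute)
  finally have "gcoord g0 u (y, 0) (0, w) = gcoord g0 u (0, ?s) (0, w)"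
    using gcoord0_vert[OF u] by simp
  moreover have "gcoord g0 u ((y, 0) - (0, ?s)) (0, w) = gcoord g0 u (y, 0) (0, w) - gcoord g0 u (0, ?s) (0, w)"
    by (rule linear_diff[OF gcoord0_linear(1)[OF u]])
  moreover have "lift u y = (y, 0) - (0, ?s)" by (simp add: lift_def)
  ultimately show ?thesis by (simp only: diff_self)
qed

lemma lift_horizontal_t: "t \<in> I \<Longrightarrow> u \<in> V \<Longrightarrow> gcoord (g t) u (lift u y) (0, w) = 0"
  by (rule gcoord_horizontal[OF _ _ lift_horizontal])

lemma smooth_lift: "smooth_on V (\<lambda>u. lift u y)"
  unfolding lift_def
  by (intro smooth_on_Pair smooth_on_const smooth_on_uminus smooth_on_sum smooth_on_scaleR
      smooth_gcoord0 smooth_on_vec_nth smooth_vert_frame0)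

lemma lift_expand:
  assumes "u \<in> V" shows "lift u y = (\<Sum>a\<in>UNIV. y $ a *\<^sub>R lift u (axis a 1))"
proof -
  interpret l: linear "lift u" by (rule linear_lift[OF assms])
  have "lift u y = lift u (\<Sum>a\<in>UNIV. y $ a *\<^sub>R axis a 1)"
    by (simp add: basis_expansion flip: scalar_mult_eq_scaleR)
  then show ?thesis by (simp add: l.sum l.scale)
qed

lemma tsmooth_lift:
  assumes "tsmooth y" shows "tsmooth (\<lambda>t u. lift u (y t u))"
proof -
  have "tsmooth (\<lambda>t u. \<Sum>a\<in>UNIV. y t u $ a *\<^sub>R lift u (axis a 1))"
    by (intro tsmooth_sum tsmooth_scaleR tsmooth_vec_nth assms tsmooth_static smooth_lift)
  then show ?thesis by (rule tsmooth_cong) (rule lift_expand[symmetric])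
qed

lemma smooth_lift_at:
  assumes "smooth_on V y" shows "smooth_on V (\<lambda>u. lift u (y u))"
  using tsmooth_at[OF tsmooth_lift[OF tsmooth_static[OF assms]] I(2)] .

definition horiz_gram :: "real \<Rightarrow> (real^'n) \<times> (real^'m) \<Rightarrow> real^'n^'n" where
  "horiz_gram t u = (\<chi> i j. gcoord (g t) u (lift u (axis i 1)) (lift u (axis j 1)))"

lemma gcoord_lift_lift:
  "t \<in> I \<Longrightarrow> u \<in> V \<Longrightarrow> gcoord (g t) u (lift u y) (lift u y') = y \<bullet> (horiz_gram t u *v y')"
  unfolding horiz_gram_def by (rule bilinear_gram_matrix[OF bilin linear_lift])

text \<open>The vector \<open>v\<close> differs from the lift of its transverse part by a vertical
  vector, which is orthogonal to every lift.\<close>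

lemma gcoord_lift:
  assumes "t \<in> I" "u \<in> V" shows "gcoord (g t) u v (lift u y) = fst v \<bullet> (horiz_gram t u *v y)"
proof -
  let ?w = "snd v - snd (lift u (fst v))"
  have "v = lift u (fst v) + (0, ?w)" by (simp add: prod_eq_iff)
  then have "gcoord (g t) u v (lift u y) = gcoord (g t) u (lift u (fst v)) (lift u y) + gcoord (g t) u (0, ?w) (lift u y)"
    using bilinear_ladd[OF bilin[OF assms]] by metis
  moreover have "gcoord (g t) u (0, ?w) (lift u y) = 0"
    using lift_horizontal_t[OF assms] gcoord_sym[OF riem[OF assms(1)] V_chart[OF assms(2)]] by metis
  ultimately show ?thesis by (simp only: gcoord_lift_lift[OF assms] add_0_right)
qed

lemma horiz_gram_spd:
  assumes "t \<in> I" "u \<in> V" shows "horiz_gram t u \<in> spd"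
  unfolding horiz_gram_def
proof (rule gram_matrix_spd[OF bilin[OF assms] linear_lift[OF assms(2)] gcoord_sym[OF riem[OF assms(1)] V_chart[OF assms(2)]]])
  show "0 < gcoord (g t) u (lift u y) (lift u y)" if "y \<noteq> 0" for y
    by (rule gcoord_pos[OF riem[OF assms(1)] V_chart[OF assms(2)]]) (use that in \<open>metis fst_lift fst_zero\<close>)
qed

lemma tsmooth_horiz_gram: "tsmooth horiz_gram"
  unfolding horiz_gram_def[abs_def]
  by (intro tsmooth_vec_lambda tsmooth_gcoord tsmooth_static smooth_lift)

text \<open>The transverse components of the two fields are \<open>y\<close> and 0, so the
  transverse part of the bracket is minus the derivative of \<open>y\<close> along
  \<open>\<zeta>\<close>. It vanishes because \<open>y\<close> is basic.\<close>

lemma fst_bracket_lift_vertical: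
  assumes y: "smooth_on V y" "basic y" and z: "smooth_on V \<zeta>" "\<And>u. u \<in> V \<Longrightarrow> fst (\<zeta> u) = 0" and u: "u \<in> V"
  shows "fst (bracket (\<lambda>u. lift u (y u)) \<zeta> u) = 0"
proof -
  have y': "(y has_derivative frechet_derivative y (at u)) (at u)"
    by (rule smooth_on_has_derivative[OF y(1) V_open u])
  have "((\<lambda>u. 0) has_derivative (\<lambda>v. 0)) (at u)" by simp
  then have "((\<lambda>u. fst (\<zeta> u)) has_derivative (\<lambda>v. 0)) (at u)"
    by (rule has_derivative_transform_within_open[OF _ V_open u]) (simp add: z)
  then have "fst (bracket (\<lambda>u. lift u (y u)) \<zeta> u) = 0 - frechet_derivative y (at u) (\<zeta> u)"
    by (intro fst_bracket[OF smooth_lift_at[OF y(1)] z(1) u]) (simp_all add: y')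
  moreover have "\<zeta> u = (0, snd (\<zeta> u))" using z(2)[OF u] by (simp add: prod_eq_iff)
  then have "frechet_derivative y (at u) (\<zeta> u) = 0" using basic_derivative[OF y(2) y' u] by metis
  ultimately show ?thesis by simp
qed

lemma lift_field_horizontal:
  assumes "t \<in> I" "smooth_on V y"
  shows "fld (\<lambda>u. lift u (y u)) \<in> horizontal_fields A (g t) U"
  unfolding horizontal_fields_def horizontal_def
proof (intro CollectI conjI ballI)
  show vf: "fld (\<lambda>u. lift u (y u)) \<in> vector_fields A U"
    by (rule fld_vector_field[OF U smooth_lift_at[OF assms(2)]])
  fix q assume q: "q \<in> U"
  then have qc: "q \<in> cdom c" and qV: "cmap c q \<in> V" using U by auto
  show "fld (\<lambda>u. lift u (y u)) q \<in> tangent_space A q"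
    using vf q by (simp add: vector_fields_def)
  fix w assume "w \<in> vertical A q"
  then obtain w' where "w = coord_vec A c q (0, w')" using vertical_eq[OF qc] by auto
  then show "g t q (fld (\<lambda>u. lift u (y u)) q) w = 0"
    using lift_horizontal_t[OF assms(1) qV, of "y (cmap c q)" w'] qc
    by (simp add: gcoord_def fld_def cinv_cmap)
qed

lemma lift_field_foliate:
  assumes "smooth_on V y" "basic y"
  shows "foliate A U (fld (\<lambda>u. lift u (y u)))"
  unfolding foliate_def
proof (intro conjI ballI)
  let ?\<xi> = "\<lambda>u. lift u (y u)"
  show "fld ?\<xi> \<in> vector_fields A U"
    by (rule fld_vector_field[OF U smooth_lift_at[OF assms(1)]])
  fix Z assume "Z \<in> vertical_fields A U"
  then obtain \<zeta> where z: "smooth_on V \<zeta>" "\<And>q. q \<in> U \<Longrightarrow> Z q = fld \<zeta> q" "\<And>u. u \<in> V \<Longrightarrow> fst (\<zeta> u) = 0"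
    using vertical_field_coordinates[OF _ U] by blast
  have eq: "lie_bracket A (fld ?\<xi>) Z q = fld (bracket ?\<xi> \<zeta>) q" if "q \<in> U" for q
    by (rule lie_bracket_fld[OF U that smooth_lift_at[OF assms(1)] refl z(1,2)])
  have v: "fld (bracket ?\<xi> \<zeta>) \<in> vertical_fields A U"
    by (rule fld_vertical_field[OF U smooth_on_bracket[OF smooth_lift_at[OF assms(1)] z(1) V_open]])
      (rule fst_bracket_lift_vertical[OF assms z(1,3)])
  have "lie_bracket A (fld ?\<xi>) Z \<in> vector_fields A U"
    by (rule vector_fields_cong[OF eq _ U(2)]) (use v in \<open>auto simp: vertical_fields_def\<close>)
  then show "lie_bracket A (fld ?\<xi>) Z \<in> vertical_fields A U"
    using v eq by (simp add: vertical_fields_def)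
qed

lemma basic_const: "basic (\<lambda>u. k)"
  by (simp add: basic_def)

text \<open>Lifts of constant vectors are foliate, and horizontal for every \<open>g t\<close>, so
  the bundle-like condition says precisely that the leafwise derivatives of these entries
  vanish.\<close>

lemma basic_horiz_gram:
  assumes t: "t \<in> I" shows "basic (horiz_gram t)"
proof -
  have "basic (\<lambda>u. horiz_gram t u $ i $ j)" for i j
  proof (rule basicI)
    have sm: "smooth_on V (\<lambda>u. horiz_gram t u $ i $ j)"
      by (intro smooth_on_vec_nth tsmooth_at[OF tsmooth_horiz_gram t])
    show d: "((\<lambda>u. horiz_gram t u $ i $ j) has_derivative frechet_derivative (\<lambda>u. horiz_gram t u $ i $ j) (at u)) (at u)"
      if "u \<in> V" for u
      by (rule smooth_on_has_derivative[OF sm V_open that])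
    fix u w assume u: "u \<in> V"
    let ?X = "\<lambda>i. fld (\<lambda>u. lift u (axis i 1))"
    let ?F = "\<lambda>r. g t r (?X i r) (?X j r)"
    let ?q = "cinv c u"
    have q: "?q \<in> U" "?q \<in> cdom c" "cmap c ?q = u" using cinv_U[OF u] U cmap_cinv_V[OF u] by auto
    have Feq: "horiz_gram t v $ i $ j = (?F \<circ> cinv c) v" if "v \<in> V" for v
    proof -
      have "cinv c v \<in> cdom c" using cinv_U[OF that] U by auto
      then show ?thesis by (simp add: gcoord_fld cmap_cinv_V[OF that] horiz_gram_def)
    qed
    have hf: "?X i \<in> horizontal_fields A (g t) U" "foliate A U (?X i)" for i
      by (rule lift_field_horizontal[OF t smooth_on_const]) (rule lift_field_foliate[OF smooth_on_const basic_const])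
    have Zf: "fld (\<lambda>_. (0, w)) \<in> vertical_fields A U"
      by (rule fld_vertical_field[OF U smooth_on_const]) simp
    have "fld (\<lambda>_. (0, w)) ?q ?F = 0"
      using bundle_like[OF t] U(1) hf Zf q(1) unfolding bundle_like_def by blast
    \<comment> \<open>Without smoothness the preceding equation could hold merely by the default
      value of tangent vectors; here it becomes an equation between derivatives.\<close>
    moreover have "smooth_near A ?q ?F"
    proof -
      have "smooth_on V (?F \<circ> cinv c)"
        using sm Feq by (rule smooth_on_cong[THEN iffD1, rotated])
      then show ?thesis using smooth_fun_iff[OF U(2)] smooth_fun_near[OF _ U(1) q(1)] by blast
    qed
    moreover have "frechet_derivative (?F \<circ> cinv c) (at u) = frechet_derivative (\<lambda>u. horiz_gram t u $ i $ j) (at u)"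
      by (rule frechet_derivative_at[symmetric],
          rule has_derivative_transform_within_open[OF d[OF u] V_open u Feq])
    ultimately show "frechet_derivative (\<lambda>u. horiz_gram t u $ i $ j) (at u) (0, w) = 0"
      by (simp add: fld_def coord_vec_near q(3))
  qed
  then show ?thesis unfolding basic_def vec_eq_iff by blast
qed

text \<open>Split \<open>v\<close> into the lift of its transverse part and a vertical remainder,
  and expand each in its own frame. The vertical coefficients can be taken with \<open>g0\<close> of
  the whole of \<open>v\<close>, since lifts are \<open>g0\<close>-orthogonal to the leaves.\<close>

lemma frame_expansion:
  fixes H :: "real^'n^'n" and Q :: "real^'m^'m"
  assumes t: "t \<in> I" and u: "u \<in> V"
    and H: "H ** horiz_gram t u ** transpose H = mat 1" and Q: "Q ** vert_gram u ** transpose Q = mat 1"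
  shows "v = (\<Sum>k\<in>UNIV. gcoord (g t) u v (lift u (H $ k)) *\<^sub>R lift u (H $ k)) +
    (\<Sum>k\<in>UNIV. gcoord g0 u v (0, Q $ k) *\<^sub>R (0, Q $ k))"
proof -
  interpret l: linear "lift u" by (rule linear_lift[OF u])
  let ?w = "snd v - snd (lift u (fst v))"
  have v: "v = lift u (fst v) + (0, ?w)" by (simp add: prod_eq_iff)
  have "lift u (fst v) = (\<Sum>k\<in>UNIV. gcoord (g t) u v (lift u (H $ k)) *\<^sub>R lift u (H $ k))"
    unfolding gcoord_lift[OF t u] using orthonormal_rows_expansion[OF H, of "fst v"]
    by (metis (no_types, lifting) l.scale l.sum sum.cong)
  moreover have "gcoord g0 u v (0, Q $ k) = ?w \<bullet> (vert_gram u *v Q $ k)" for k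
  proof -
    have "gcoord g0 u v (0, Q $ k) = gcoord g0 u (lift u (fst v)) (0, Q $ k) + gcoord g0 u (0, ?w) (0, Q $ k)"
      using v bilinear_ladd[OF bilin0[OF u]] by metis
    then show ?thesis by (simp only: lift_horizontal[OF u] gcoord0_vert[OF u])
  qed
  then have "(0, ?w) = (\<Sum>k\<in>UNIV. gcoord g0 u v (0, Q $ k) *\<^sub>R (0 :: real^'n, Q $ k))"
    using orthonormal_rows_expansion[OF Q, of ?w]
    by (simp add: prod_eq_iff fst_sum snd_sum)
  ultimately show ?thesis using v by simp
qed

subsection \<open>The vertical frame\<close>

definition vert_coeff :: "'n \<Rightarrow> 'm \<Rightarrow> 'm \<Rightarrow> real" where
  "vert_coeff a k l = gcoord g0 u0 (bracket (\<lambda>u. lift u (axis a 1)) (\<lambda>u. (0, vert_frame0 u $ k)) u0) (0, vert_frame0 u0 $ l)"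

text \<open>Linear in the transverse part of \<open>v\<close>. The sign makes the value at the lift
  of \<open>axis a 1\<close> the negative of the coefficients \<open>vert_coeff a\<close>, ready to
  cancel them.\<close>

definition vert_gen :: "(real^'n) \<times> (real^'m) \<Rightarrow> real^'m^'m" where
  "vert_gen v = (\<chi> k l. - (\<Sum>a\<in>UNIV. fst v $ a * vert_coeff a k l))"

definition vert_frame :: "(real^'n) \<times> (real^'m) \<Rightarrow> real^'m^'m" where
  "vert_frame u = rot (vert_gen (u - u0)) ** vert_frame0 u"

lemma vertical_rows_gcoord:
  assumes "u \<in> V" "Q ** vert_gram u ** transpose Q = mat 1"
  shows "gcoord g0 u (0, Q $ k) (0, Q $ l) = (if k = l then 1 else 0)"
  unfolding gcoord0_vert[OF assms(1)] matrix_congruence_nth[symmetric] assms(2) by (simp add: mat_def)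

text \<open>Total geodesy enters the choice of the frame here: it makes the bracket coefficients
  skew, so that they can generate a rotation.\<close>

lemma vert_coeff_skew: "vert_coeff a k l = - vert_coeff a l k"
proof -
  have s: "smooth_on V (\<lambda>u. (0 :: real^'n, vert_frame0 u $ k))" for k
    by (intro smooth_on_Pair smooth_on_const smooth_on_vec_nth smooth_vert_frame0)
  have "vert_coeff a k l + gcoord g0 u0 (0, vert_frame0 u0 $ k) (bracket (\<lambda>u. lift u (axis a 1)) (\<lambda>u. (0, vert_frame0 u $ l)) u0) = 0"
    unfolding vert_coeff_def
    by (rule totally_geodesic_skew[OF smooth_lift lift_horizontal s _ s _ _ u0])
      (simp_all add: vertical_rows_gcoord vert_frame0_orthonormal)
  then show ?thesis unfolding vert_coeff_def[of a l k] using gcoord_sym[OF riem0 V_chart[OF u0]] by simp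
qed

lemma vert_gen_skew: "vert_gen v \<in> skew"
proof -
  have "vert_gen v $ l $ k = - vert_gen v $ k $ l" for k l
    unfolding vert_gen_def by (simp add: vert_coeff_skew[of _ l k] sum_negf)
  then show ?thesis by (rule skewI)
qed

lemma bounded_linear_vert_gen: "bounded_linear vert_gen"
  unfolding linear_conv_bounded_linear[symmetric] vert_gen_def[abs_def]
  by (auto intro!: linearI simp: vec_eq_iff algebra_simps sum.distrib sum_distrib_left)

lemma linear_shift_has_derivative:
  "bounded_linear L \<Longrightarrow> ((\<lambda>u. L (u - u0)) has_derivative L) (at u)"
  by (rule bounded_linear.has_derivative) (auto intro!: derivative_eq_intros)

lemma vert_frame_orthonormal: "u \<in> V \<Longrightarrow> vert_frame u ** vert_gram u ** transpose (vert_frame u) = mat 1"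
  unfolding vert_frame_def by (rule orthonormal_rows_mult[OF vert_frame0_orthonormal rot_orthogonal[OF vert_gen_skew]])

lemma smooth_vert_frame: "smooth_on V vert_frame"
proof -
  have "smooth_on V (\<lambda>u. u - u0)"
    by (intro smooth_on_diff smooth_on_const smooth_on_bounded_linear bounded_linear_ident)
  then have "smooth_on V (\<lambda>u. vert_gen (u - u0))" by (rule smooth_on_linear_compose[OF bounded_linear_vert_gen])
  then have "smooth_on V (\<lambda>u. rot (vert_gen (u - u0)))"
    by (rule smooth_on_compose[OF _ smooth_on_rot]) (auto intro: vert_gen_skew)
  then show ?thesis unfolding vert_frame_def[abs_def] by (intro smooth_on_matrix_mult smooth_vert_frame0)
qed

lemma vert_gen_0: "vert_gen 0 = 0"
  by (simp add: vert_gen_def vec_eq_iff)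

lemma vert_frame_u0: "vert_frame u0 = vert_frame0 u0"
  by (simp add: vert_frame_def vert_gen_0 rot_0)

definition \<zeta> :: "'m \<Rightarrow> (real^'n) \<times> (real^'m) \<Rightarrow> (real^'n) \<times> (real^'m)" where
  "\<zeta> k u = (0, vert_frame u $ k)"

lemma smooth_\<zeta>: "smooth_on V (\<zeta> k)"
  unfolding \<zeta>_def[abs_def] by (intro smooth_on_Pair smooth_on_const smooth_on_vec_nth smooth_vert_frame)

text \<open>Passing to the rotated frame keeps its value at \<open>u0\<close> and adds the generator
  applied to the lift of \<open>axis a 1\<close> to its derivative. By the choice of
  \<open>vert_gen\<close> this extra term is the negative of the bracket with the unrotated frame,
  which is vertical and hence determined by \<open>vert_coeff\<close>.\<close>

lemma bracket_lift_axis_\<zeta>: "bracket (\<lambda>u. lift u (axis a 1)) (\<zeta> k) u0 = 0"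
proof -
  let ?X = "\<lambda>u. lift u (axis a 1)" and ?zP = "\<lambda>u. (0 :: real^'n, vert_frame0 u $ k)"
  let ?P' = "frechet_derivative vert_frame0 (at u0)" and ?X' = "frechet_derivative ?X (at u0)"
  have X': "(?X has_derivative ?X') (at u0)"
    by (rule smooth_on_has_derivative[OF smooth_lift V_open u0])
  have P': "(vert_frame0 has_derivative ?P') (at u0)"
    by (rule smooth_on_has_derivative[OF smooth_vert_frame0 V_open u0])
  have N': "(vert_frame has_derivative (\<lambda>v. ?P' v + vert_gen v ** vert_frame0 u0)) (at u0)"
    unfolding vert_frame_def[abs_def]
    by (rule rot_frame_has_derivative[OF linear_shift_has_derivative[OF bounded_linear_vert_gen] _ _ P'])
      (simp_all add: vert_gen_0 vert_gen_skew)
  have zP': "(?zP has_derivative (\<lambda>v. (0, ?P' v $ k))) (at u0)"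
    by (intro has_derivative_Pair has_derivative_const bounded_linear.has_derivative[OF bounded_linear_vec_nth] P')
  have zN': "(\<zeta> k has_derivative (\<lambda>v. (0, (?P' v + vert_gen v ** vert_frame0 u0) $ k))) (at u0)"
    unfolding \<zeta>_def[abs_def]
    by (intro has_derivative_Pair has_derivative_const bounded_linear.has_derivative[OF bounded_linear_vec_nth] N')
  let ?w = "bracket ?X ?zP u0"
  have fst0: "fst ?w = 0"
    by (rule fst_bracket_lift_vertical[OF smooth_on_const basic_const _ _ u0])
      (auto intro!: smooth_on_Pair smooth_on_const smooth_on_vec_nth smooth_vert_frame0)
  have "vert_coeff a k l = snd ?w \<bullet> (vert_gram u0 *v vert_frame0 u0 $ l)" for l
  proof -
    have "?w = (0, snd ?w)" using fst0 by (simp add: prod_eq_iff)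
    then show ?thesis unfolding vert_coeff_def using gcoord0_vert[OF u0, of "snd ?w" "vert_frame0 u0 $ l"] by simp
  qed
  then have "snd ?w = (\<Sum>l\<in>UNIV. vert_coeff a k l *\<^sub>R vert_frame0 u0 $ l)"
    using orthonormal_rows_expansion[OF vert_frame0_orthonormal[OF u0], of "snd ?w"] by simp
  moreover have "vert_gen (?X u0) $ k $ l = - vert_coeff a k l" for l
    by (simp add: vert_gen_def axis_def if_distrib[of "\<lambda>x. x * _"] cong: if_cong)
  then have "(vert_gen (?X u0) ** vert_frame0 u0) $ k = - (\<Sum>l\<in>UNIV. vert_coeff a k l *\<^sub>R vert_frame0 u0 $ l)"
    unfolding matrix_mult_row by (simp add: sum_negf)
  ultimately have "(vert_gen (?X u0) ** vert_frame0 u0) $ k = - snd ?w" by simp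
  \<comment> \<open>The derivative of the lift is evaluated at the same vector for both frames, as
    they agree at \<open>u0\<close>; only the derivative of the vertical field changes.\<close>
  moreover have "bracket ?X (\<zeta> k) u0 = ?w + (0, (vert_gen (?X u0) ** vert_frame0 u0) $ k)"
    unfolding bracket_eq[OF X' zP'] bracket_eq[OF X' zN'] by (simp add: \<zeta>_def vert_frame_u0 prod_eq_iff)
  ultimately show ?thesis using fst0 by (simp add: prod_eq_iff)
qed

subsection \<open>The horizontal frame\<close>

definition horiz_frame0 :: "real \<Rightarrow> (real^'n) \<times> (real^'m) \<Rightarrow> real^'n^'n" where
  "horiz_frame0 t u = gram_schmidt (horiz_gram t u)"

text \<open>The structure functions at \<open>u0\<close>, and the coefficients that the rotation must have to first
  order to cancel them; the latter come from the Koszul formula.\<close>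

definition struct_coeff :: "'n \<Rightarrow> 'n \<Rightarrow> 'n \<Rightarrow> real \<Rightarrow> real" where
  "struct_coeff i j k t = fst (bracket (\<lambda>u. lift u (horiz_frame0 t u $ i)) (\<lambda>u. lift u (horiz_frame0 t u $ j)) u0) \<bullet> (horiz_gram t u0 *v horiz_frame0 t u0 $ k)"

definition koszul_coeff :: "'n \<Rightarrow> 'n \<Rightarrow> 'n \<Rightarrow> real \<Rightarrow> real" where
  "koszul_coeff i j k t = (-1/2) * (struct_coeff i j k t - struct_coeff j k i t + struct_coeff k i j t)"

text \<open>The inner product is the \<open>i\<close>-th component of \<open>fst v\<close> in the
  frame at \<open>u0\<close>, so the lift of the \<open>i\<close>-th frame vector selects the matrix
  of \<open>koszul_coeff i\<close>. Leaf components of \<open>v\<close> do not enter, which keeps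
  the rotated frame basic.\<close>

definition horiz_gen :: "real \<Rightarrow> (real^'n) \<times> (real^'m) \<Rightarrow> real^'n^'n" where
  "horiz_gen t v = (\<chi> j k. \<Sum>i\<in>UNIV. koszul_coeff i j k t * (horiz_frame0 t u0 $ i \<bullet> (horiz_gram t u0 *v fst v)))"

definition horiz_frame :: "real \<Rightarrow> (real^'n) \<times> (real^'m) \<Rightarrow> real^'n^'n" where
  "horiz_frame t u = rot (horiz_gen t (u - u0)) ** horiz_frame0 t u"

lemma horiz_frame0_orthonormal: "t \<in> I \<Longrightarrow> u \<in> V \<Longrightarrow> horiz_frame0 t u ** horiz_gram t u ** transpose (horiz_frame0 t u) = mat 1"
  unfolding horiz_frame0_def by (rule gram_schmidt_orthonormal[OF horiz_gram_spd])

lemma tsmooth_horiz_frame0: "tsmooth horiz_frame0"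
  unfolding horiz_frame0_def[abs_def] by (rule tsmooth_compose[OF smooth_on_gram_schmidt tsmooth_horiz_gram horiz_gram_spd])

lemma struct_coeff_skew: "struct_coeff i j k t = - struct_coeff j i k t"
  unfolding struct_coeff_def bracket_def by (simp add: inner_diff_left)

lemma koszul_coeff_skew: "koszul_coeff i j k t = - koszul_coeff i k j t"
  unfolding koszul_coeff_def ring_distribs using struct_coeff_skew[of i j k t] struct_coeff_skew[of k i j t] struct_coeff_skew[of j k i t] by linarith

text \<open>Skewness in the last two indices and this identity together determine the coefficients,
  exactly as for the Levi-Civita connection in an orthonormal frame; solving them produces the
  signed cyclic sum and the factor 1/2. The right-hand side is what must be added to the structure
  functions.\<close>

lemma koszul_coeff_torsion: "koszul_coeff i j k t - koszul_coeff j i k t = - struct_coeff i j k t"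
  unfolding koszul_coeff_def ring_distribs using struct_coeff_skew[of j i k t] struct_coeff_skew[of j k i t] struct_coeff_skew[of k i j t] by linarith

lemma horiz_gen_skew: "horiz_gen t v \<in> skew"
proof -
  have "horiz_gen t v $ k $ j = - horiz_gen t v $ j $ k" for j k
    unfolding horiz_gen_def by (simp add: koszul_coeff_skew[of _ k j] sum_negf)
  then show ?thesis by (rule skewI)
qed

lemma bounded_linear_horiz_gen: "bounded_linear (horiz_gen t)"
  unfolding linear_conv_bounded_linear[symmetric] horiz_gen_def[abs_def]
  by (auto intro!: linearI simp: vec_eq_iff algebra_simps inner_add_right sum.distrib sum_distrib_left
      matrix_vector_mult_scaleR)

lemma horiz_gen_0: "horiz_gen t 0 = 0"
  by (simp add: horiz_gen_def vec_eq_iff)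

lemma horiz_frame_orthonormal: "t \<in> I \<Longrightarrow> u \<in> V \<Longrightarrow> horiz_frame t u ** horiz_gram t u ** transpose (horiz_frame t u) = mat 1"
  unfolding horiz_frame_def by (rule orthonormal_rows_mult[OF horiz_frame0_orthonormal rot_orthogonal[OF horiz_gen_skew]])

lemma tsmooth_horiz_frame: "tsmooth horiz_frame"
proof -
  have Ei: "tsmooth (\<lambda>t u. horiz_frame0 t u $ i)" for i by (intro tsmooth_vec_nth tsmooth_horiz_frame0)
  have "tsmooth (\<lambda>t u. fst (bracket (\<lambda>u. lift u (horiz_frame0 t u $ i)) (\<lambda>u. lift u (horiz_frame0 t u $ j)) u) \<bullet> (horiz_gram t u *v horiz_frame0 t u $ k))"
    for i j k
    by (intro tsmooth_inner tsmooth_fst tsmooth_bracket tsmooth_lift Ei tsmooth_matrix_vector_mult tsmooth_horiz_gram)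
  \<comment> \<open>The structure coefficients are smooth in time because they are values at
    \<open>u0\<close> of functions that are jointly smooth on \<open>I \<times> V\<close>.\<close>
  then have struct_coeff: "tsmooth (\<lambda>t u. struct_coeff i j k t)" for i j k
    unfolding struct_coeff_def by (rule tsmooth_point)
  have "tsmooth (\<lambda>t u. koszul_coeff i j k t)" for i j k
    unfolding koszul_coeff_def by (intro tsmooth_mult tsmooth_const tsmooth_add tsmooth_diff struct_coeff)
  moreover have "tsmooth (\<lambda>t u. fst (u - u0))"
    by (intro tsmooth_fst tsmooth_diff tsmooth_const tsmooth_static smooth_on_bounded_linear bounded_linear_ident)
  ultimately have "tsmooth (\<lambda>t u. horiz_gen t (u - u0))"
    unfolding horiz_gen_def
    by (intro tsmooth_vec_lambda tsmooth_sum tsmooth_mult tsmooth_inner tsmooth_matrix_vector_mult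
        tsmooth_point[OF Ei] tsmooth_point[OF tsmooth_horiz_gram])
  then have "tsmooth (\<lambda>t u. rot (horiz_gen t (u - u0)))"
    by (rule tsmooth_compose[OF smooth_on_rot]) (rule horiz_gen_skew)
  then show ?thesis unfolding horiz_frame_def[abs_def] by (intro tsmooth_matrix_mult tsmooth_horiz_frame0)
qed

text \<open>The point enters only through the Gram matrix, which is basic, and through
  \<open>fst (u - u0)\<close> in the rotation. Thus the rotation does not destroy the foliate
  property of the lifted frame.\<close>

lemma basic_horiz_frame: "t \<in> I \<Longrightarrow> basic (horiz_frame t)"
  unfolding basic_def
proof (intro ballI impI)
  fix u v assume *: "t \<in> I" "u \<in> V" "v \<in> V" "fst u = fst v"
  have "horiz_gram t u = horiz_gram t v" by (rule basicD[OF basic_horiz_gram[OF *(1)] *(2-4)])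
  then show "horiz_frame t u = horiz_frame t v" using *(4) by (simp add: horiz_frame_def horiz_frame0_def horiz_gen_def)
qed

lemma horiz_frame_u0: "horiz_frame t u0 = horiz_frame0 t u0"
  by (simp add: horiz_frame_def horiz_gen_0 rot_0)

text \<open>The rotation changes the transverse bracket of the i-th and j-th fields by the
  coefficients \<open>koszul_coeff i j k t - koszul_coeff j i k t\<close>. By the torsion identity
  these are minus the coefficients of the original bracket in the orthonormal frame.\<close>

lemma fst_bracket_frame_u0:
  assumes t: "t \<in> I"
  shows "fst (bracket (\<lambda>u. lift u (horiz_frame t u $ i)) (\<lambda>u. lift u (horiz_frame t u $ j)) u0) = 0"
proof -
  let ?E' = "frechet_derivative (horiz_frame0 t) (at u0)" and ?E = "horiz_frame0 t u0"
  have sE: "smooth_on V (\<lambda>u. horiz_frame0 t u $ i)" and sB: "smooth_on V (\<lambda>u. horiz_frame t u $ i)" for i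
    by (intro smooth_on_vec_nth tsmooth_at[OF tsmooth_horiz_frame0 t] tsmooth_at[OF tsmooth_horiz_frame t])+
  have E': "(horiz_frame0 t has_derivative ?E') (at u0)"
    by (rule smooth_on_has_derivative[OF tsmooth_at[OF tsmooth_horiz_frame0 t] V_open u0])
  have B': "(horiz_frame t has_derivative (\<lambda>v. ?E' v + horiz_gen t v ** ?E)) (at u0)"
    unfolding horiz_frame_def[abs_def]
    by (rule rot_frame_has_derivative[OF linear_shift_has_derivative[OF bounded_linear_horiz_gen] _ _ E'])
      (simp_all add: horiz_gen_0 horiz_gen_skew)
  have gen_entry: "horiz_gen t (lift u0 (?E $ i)) $ j $ k = koszul_coeff i j k t" for i j k
  proof -
    have *: "?E $ i' \<bullet> (horiz_gram t u0 *v ?E $ i) = (if i' = i then 1 else 0)" for i'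
      unfolding matrix_congruence_nth[symmetric] horiz_frame0_orthonormal[OF t u0] by (simp add: mat_def)
    show ?thesis unfolding horiz_gen_def vec_lambda_beta fst_lift * by (simp add: if_distrib cong: if_cong)
  qed
  have row: "(horiz_gen t (lift u0 (?E $ i)) ** ?E) $ j = (\<Sum>k\<in>UNIV. koszul_coeff i j k t *\<^sub>R ?E $ k)" for i j
    unfolding matrix_mult_row gen_entry ..
  have nth: "((\<lambda>u. fst (lift u (Q u $ i))) has_derivative (\<lambda>v. Q' v $ i)) (at u0)"
    if "(Q has_derivative Q') (at u0)" for Q :: "(real^'n) \<times> (real^'m) \<Rightarrow> real^'n^'n" and Q' i
    using bounded_linear.has_derivative[OF bounded_linear_vec_nth that] by simp
  have brE: "fst (bracket (\<lambda>u. lift u (horiz_frame0 t u $ i)) (\<lambda>u. lift u (horiz_frame0 t u $ j)) u0) =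
      ?E' (lift u0 (?E $ i)) $ j - ?E' (lift u0 (?E $ j)) $ i"
    by (rule fst_bracket[OF smooth_lift_at[OF sE] smooth_lift_at[OF sE] u0 nth[OF E'] nth[OF E']])
  have "fst (bracket (\<lambda>u. lift u (horiz_frame t u $ i)) (\<lambda>u. lift u (horiz_frame t u $ j)) u0) =
      (?E' (lift u0 (?E $ i)) + horiz_gen t (lift u0 (?E $ i)) ** ?E) $ j - (?E' (lift u0 (?E $ j)) + horiz_gen t (lift u0 (?E $ j)) ** ?E) $ i"
    using fst_bracket[OF smooth_lift_at[OF sB] smooth_lift_at[OF sB] u0 nth[OF B'] nth[OF B'], of i j]
    by (simp only: horiz_frame_u0)
  also have "\<dots> = fst (bracket (\<lambda>u. lift u (horiz_frame0 t u $ i)) (\<lambda>u. lift u (horiz_frame0 t u $ j)) u0)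
      + (\<Sum>k\<in>UNIV. (koszul_coeff i j k t - koszul_coeff j i k t) *\<^sub>R ?E $ k)"
    unfolding brE by (simp add: row sum_subtractf scaleR_diff_left)
  also have "\<dots> = 0"
    using orthonormal_rows_expansion[OF horiz_frame0_orthonormal[OF t u0],
        of "fst (bracket (\<lambda>u. lift u (horiz_frame0 t u $ i)) (\<lambda>u. lift u (horiz_frame0 t u $ j)) u0)"]
    unfolding koszul_coeff_torsion by (simp add: struct_coeff_def[symmetric] sum_negf)
  finally show ?thesis .
qed

section \<open>Structure functions of the rotated frames\<close>

definition \<xi> :: "'n \<Rightarrow> real \<Rightarrow> (real^'n) \<times> (real^'m) \<Rightarrow> (real^'n) \<times> (real^'m)" where
  "\<xi> i t u = lift u (horiz_frame t u $ i)"

lemma tsmooth_\<xi>: "tsmooth (\<xi> i)"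
  unfolding \<xi>_def[abs_def] by (intro tsmooth_lift tsmooth_vec_nth tsmooth_horiz_frame)

lemma fst_bracket_\<xi>_\<zeta>:
  assumes "t \<in> I" "u \<in> V" shows "fst (bracket (\<xi> i t) (\<zeta> k) u) = 0"
  unfolding \<xi>_def[abs_def]
proof (rule fst_bracket_lift_vertical[OF _ _ smooth_\<zeta> _ assms(2)])
  show "smooth_on V (\<lambda>u. horiz_frame t u $ i)" by (intro smooth_on_vec_nth tsmooth_at[OF tsmooth_horiz_frame assms(1)])
  show "basic (\<lambda>u. horiz_frame t u $ i)" using basic_horiz_frame[OF assms(1)] unfolding basic_def by metis
qed (simp add: \<zeta>_def)

text \<open>Write the horizontal field as a combination of the lifts of the coordinate vectors. Its
  bracket with \<open>\<zeta> k\<close> is the same combination of brackets already made zero at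
  \<open>u0\<close>, up to terms where \<open>\<zeta> k\<close> differentiates the coefficients;
  these vanish because the coefficients are basic. Hence one vertical frame works for all
  times.\<close>

lemma bracket_\<xi>_\<zeta>_u0:
  assumes t: "t \<in> I" shows "bracket (\<xi> i t) (\<zeta> k) u0 = 0"
proof -
  let ?X = "\<lambda>a u. lift u (axis a 1)"
  let ?B' = "frechet_derivative (horiz_frame t) (at u0)" and ?X' = "\<lambda>a. frechet_derivative (?X a) (at u0)"
  let ?z' = "frechet_derivative (\<zeta> k) (at u0)"
  have X': "(?X a has_derivative ?X' a) (at u0)" for a
    by (rule smooth_on_has_derivative[OF smooth_lift V_open u0])
  have z': "(\<zeta> k has_derivative ?z') (at u0)"
    by (rule smooth_on_has_derivative[OF smooth_\<zeta> V_open u0])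
  have B': "(horiz_frame t has_derivative ?B') (at u0)"
    by (rule smooth_on_has_derivative[OF tsmooth_at[OF tsmooth_horiz_frame t] V_open u0])
  have "((\<lambda>u. \<Sum>a\<in>UNIV. horiz_frame t u $ i $ a *\<^sub>R ?X a u) has_derivative
      (\<lambda>v. \<Sum>a\<in>UNIV. horiz_frame t u0 $ i $ a *\<^sub>R ?X' a v + ?B' v $ i $ a *\<^sub>R ?X a u0)) (at u0)"
    by (intro has_derivative_sum has_derivative_scaleR X' bounded_linear.has_derivative[OF bounded_linear_vec_nth] B')
  then have \<xi>': "(\<xi> i t has_derivative
      (\<lambda>v. \<Sum>a\<in>UNIV. horiz_frame t u0 $ i $ a *\<^sub>R ?X' a v + ?B' v $ i $ a *\<^sub>R ?X a u0)) (at u0)"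
    by (rule has_derivative_transform_within_open[OF _ V_open u0])
      (simp only: \<xi>_def, rule lift_expand[symmetric])
  have B0: "?B' (\<zeta> k u0) = 0" unfolding \<zeta>_def by (rule basic_derivative[OF basic_horiz_frame[OF t] B' u0])
  interpret z: linear ?z' using z' by (rule has_derivative_linear)
  have "bracket (\<xi> i t) (\<zeta> k) u0 = ?z' (\<xi> i t u0) - (\<Sum>a\<in>UNIV. horiz_frame t u0 $ i $ a *\<^sub>R ?X' a (\<zeta> k u0))"
    unfolding bracket_eq[OF \<xi>' z'] by (simp add: B0)
  also have "?z' (\<xi> i t u0) = (\<Sum>a\<in>UNIV. horiz_frame t u0 $ i $ a *\<^sub>R ?z' (?X a u0))"
    unfolding \<xi>_def lift_expand[OF u0, of "horiz_frame t u0 $ i"] by (simp add: z.sum z.scale)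
  also have "\<dots> - (\<Sum>a\<in>UNIV. horiz_frame t u0 $ i $ a *\<^sub>R ?X' a (\<zeta> k u0))
      = (\<Sum>a\<in>UNIV. horiz_frame t u0 $ i $ a *\<^sub>R bracket (?X a) (\<zeta> k) u0)"
    by (simp add: bracket_eq[OF X' z'] scaleR_diff_right sum_subtractf)
  also have "\<dots> = 0" by (simp add: bracket_lift_axis_\<zeta>)
  finally show ?thesis .
qed

lemma adapted_frame:
  fixes x defines "x \<equiv> cinv c u0"
  shows "\<exists>U (X :: 'n \<Rightarrow> real \<Rightarrow> 'a tfield) (Z :: 'm \<Rightarrow> 'a tfield)
           (\<omega> :: 'n \<Rightarrow> 'n \<Rightarrow> 'n \<Rightarrow> real \<Rightarrow> 'a \<Rightarrow> real)
           (\<gamma> :: 'n \<Rightarrow> 'n \<Rightarrow> 'm \<Rightarrow> real \<Rightarrow> 'a \<Rightarrow> real)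
           (\<beta> :: 'n \<Rightarrow> 'm \<Rightarrow> 'm \<Rightarrow> real \<Rightarrow> 'a \<Rightarrow> real).
      open U \<and> x \<in> U \<and>
      (\<forall>i. X i \<in> vector_field_families A I U) \<and>
      (\<forall>k. Z k \<in> vertical_fields A U) \<and>
      (\<forall>t\<in>I. \<forall>i. X i t \<in> horizontal_fields A (g t) U) \<and>
      (\<forall>t\<in>I. \<forall>q\<in>U. \<forall>i j. g t q (X i t q) (X j t q) = (if i = j then 1 else 0)) \<and>
      (\<forall>t\<in>I. \<forall>q\<in>U. \<forall>k l. g t q (Z k q) (Z l q) = (if k = l then 1 else 0)) \<and>
      (\<forall>i j k. smooth_in_time A I U (\<omega> i j k)) \<and>
      (\<forall>i j k. smooth_in_time A I U (\<gamma> i j k)) \<and>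
      (\<forall>i k j. smooth_in_time A I U (\<beta> i k j)) \<and>
      (\<forall>t\<in>I. \<forall>q\<in>U. \<forall>i j. lie_bracket A (X i t) (X j t) q =
         (\<lambda>f. (\<Sum>k\<in>UNIV. \<omega> i j k t q * X k t q f) + (\<Sum>k\<in>UNIV. \<gamma> i j k t q * Z k q f))) \<and>
      (\<forall>t\<in>I. \<forall>q\<in>U. \<forall>i k. lie_bracket A (X i t) (Z k) q =
         (\<lambda>f. \<Sum>j\<in>UNIV. \<beta> i k j t q * Z j q f)) \<and>
      (\<forall>t\<in>I. \<forall>q\<in>U. \<forall>i k j. \<beta> i k j t q = - \<beta> i j k t q) \<and>
      (\<forall>t\<in>I. (\<forall>i j k. \<omega> i j k t x = 0) \<and> (\<forall>i k j. \<beta> i k j t x = 0))"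
proof -
  define X where "X i t = fld (\<xi> i t)" for i t
  define Z where "Z k = fld (\<zeta> k)" for k
  \<comment> \<open>The structure functions are inner products with the frame. Those in vertical
    directions use the fixed metric \<open>g0\<close>, as in \<open>frame_expansion\<close>.\<close>
  define \<omega> where "\<omega> i j k t q = gcoord (g t) (cmap c q) (bracket (\<xi> i t) (\<xi> j t) (cmap c q)) (\<xi> k t (cmap c q))"
    for i j k t q
  define \<gamma> where "\<gamma> i j k t q = gcoord g0 (cmap c q) (bracket (\<xi> i t) (\<xi> j t) (cmap c q)) (\<zeta> k (cmap c q))"
    for i j k t q
  define \<beta> where "\<beta> i k j t q = gcoord g0 (cmap c q) (bracket (\<xi> i t) (\<zeta> k) (cmap c q)) (\<zeta> j (cmap c q))"
    for i k j t q
  have qV: "cmap c q \<in> V" and qc: "q \<in> cdom c" if "q \<in> U" for q using that U by auto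
  have s\<xi>: "smooth_on V (\<xi> i t)" if "t \<in> I" for i t by (rule tsmooth_at[OF tsmooth_\<xi> that])
  have exp: "v = (\<Sum>k\<in>UNIV. gcoord (g t) u v (\<xi> k t u) *\<^sub>R \<xi> k t u) + (\<Sum>k\<in>UNIV. gcoord g0 u v (\<zeta> k u) *\<^sub>R \<zeta> k u)"
    if "t \<in> I" "u \<in> V" for t u v
    unfolding \<xi>_def \<zeta>_def by (rule frame_expansion[OF that horiz_frame_orthonormal[OF that] vert_frame_orthonormal[OF that(2)]])
  have x: "x \<in> U" "cmap c x = u0" using cinv_U[OF u0] cmap_cinv_V[OF u0] by (auto simp: x_def)
  have z1: "gcoord g0 u (\<zeta> k u) (\<zeta> l u) = (if k = l then 1 else 0)" if "u \<in> V" for k l u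
    unfolding \<zeta>_def by (rule vertical_rows_gcoord[OF that vert_frame_orthonormal[OF that]])
  have zg: "gcoord (g t) u (\<zeta> k u) (\<zeta> l u) = gcoord g0 u (\<zeta> k u) (\<zeta> l u)" if "t \<in> I" "u \<in> V" for t u k l
    unfolding \<zeta>_def by (rule gcoord_vertical[OF that])
  \<comment> \<open>Pairing with a lift sees only the transverse part. This removes the horizontal
    terms from the brackets with vertical fields and also yields the vanishing of
    \<open>\<omega>\<close> at \<open>x\<close>.\<close>
  have z0: "gcoord (g t) u v (\<xi> k t u) = 0" if "t \<in> I" "u \<in> V" "fst v = 0" for t u v k
    unfolding \<xi>_def gcoord_lift[OF that(1,2)] that(3) by simp
  show ?thesis
  proof (rule exI[of _ U], rule exI[of _ X], rule exI[of _ Z], rule exI[of _ \<omega>], rule exI[of _ \<gamma>],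
      rule exI[of _ \<beta>], intro conjI allI ballI)
    show "open U" by (rule U(1))
    show "x \<in> U" by (rule x(1))
    show "X i \<in> vector_field_families A I U" for i
      unfolding X_def[abs_def] by (rule fld_vector_field_family[OF U tsmooth_\<xi>[unfolded tsmooth_def]])
    show "Z k \<in> vertical_fields A U" for k
      unfolding Z_def by (rule fld_vertical_field[OF U smooth_\<zeta>]) (simp add: \<zeta>_def)
    show "smooth_in_time A I U (\<omega> i j k)" for i j k
      unfolding \<omega>_def[abs_def] by (rule smooth_in_time_coord[OF tsmooth_gcoord[OF tsmooth_bracket[OF tsmooth_\<xi> tsmooth_\<xi>] tsmooth_\<xi>]])
    show "smooth_in_time A I U (\<gamma> i j k)" for i j k
      unfolding \<gamma>_def[abs_def]
      by (rule smooth_in_time_coord[OF tsmooth_gcoord0[OF tsmooth_bracket[OF tsmooth_\<xi> tsmooth_\<xi>] tsmooth_static[OF smooth_\<zeta>]]])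
    show "smooth_in_time A I U (\<beta> i k j)" for i k j
      unfolding \<beta>_def[abs_def]
      by (rule smooth_in_time_coord[OF tsmooth_gcoord0[OF tsmooth_bracket[OF tsmooth_\<xi> tsmooth_static[OF smooth_\<zeta>]] tsmooth_static[OF smooth_\<zeta>]]])
  next
    fix t i assume t: "t \<in> I"
    show "X i t \<in> horizontal_fields A (g t) U"
      unfolding X_def \<xi>_def[abs_def]
      by (rule lift_field_horizontal[OF t smooth_on_vec_nth[OF tsmooth_at[OF tsmooth_horiz_frame t]]])
  next
    fix t q i j assume t: "t \<in> I" and q: "q \<in> U"
    show "g t q (X i t q) (X j t q) = (if i = j then 1 else 0)"
      unfolding X_def gcoord_fld[OF qc[OF q]] \<xi>_def gcoord_lift_lift[OF t qV[OF q]]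
        matrix_congruence_nth[symmetric] horiz_frame_orthonormal[OF t qV[OF q]] by (simp add: mat_def)
  next
    fix t q k l assume t: "t \<in> I" and q: "q \<in> U"
    show "g t q (Z k q) (Z l q) = (if k = l then 1 else 0)"
      unfolding Z_def gcoord_fld[OF qc[OF q]] zg[OF t qV[OF q]] by (rule z1[OF qV[OF q]])
  next
    fix t q i j assume t: "t \<in> I" and q: "q \<in> U"
    have br: "lie_bracket A (X i t) (X j t) q = fld (bracket (\<xi> i t) (\<xi> j t)) q"
      unfolding X_def by (rule lie_bracket_fld[OF U q s\<xi>[OF t] refl s\<xi>[OF t] refl])
    show "lie_bracket A (X i t) (X j t) q =
         (\<lambda>f. (\<Sum>k\<in>UNIV. \<omega> i j k t q * X k t q f) + (\<Sum>k\<in>UNIV. \<gamma> i j k t q * Z k q f))"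
      unfolding br fld_def[of "bracket (\<xi> i t) (\<xi> j t)"]
      by (subst exp[OF t qV[OF q]])
        (simp add: fun_eq_iff coord_vec_add coord_vec_sum coord_vec_scale qc[OF q] \<omega>_def \<gamma>_def X_def Z_def fld_def)
  next
    fix t q i k assume t: "t \<in> I" and q: "q \<in> U"
    have br: "lie_bracket A (X i t) (Z k) q = fld (bracket (\<xi> i t) (\<zeta> k)) q"
      unfolding X_def Z_def by (rule lie_bracket_fld[OF U q s\<xi>[OF t] refl smooth_\<zeta> refl])
    show "lie_bracket A (X i t) (Z k) q = (\<lambda>f. \<Sum>j\<in>UNIV. \<beta> i k j t q * Z j q f)"
      unfolding br fld_def[of "bracket (\<xi> i t) (\<zeta> k)"]
      by (subst exp[OF t qV[OF q]], subst z0[OF t qV[OF q] fst_bracket_\<xi>_\<zeta>[OF t qV[OF q]]])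
        (simp add: fun_eq_iff coord_vec_sum coord_vec_scale qc[OF q] \<beta>_def Z_def fld_def)
  next
    fix t q i k j assume t: "t \<in> I" and q: "q \<in> U"
    have "gcoord g0 (cmap c q) (bracket (\<xi> i t) (\<zeta> k) (cmap c q)) (\<zeta> j (cmap c q)) +
        gcoord g0 (cmap c q) (\<zeta> k (cmap c q)) (bracket (\<xi> i t) (\<zeta> j) (cmap c q)) = 0"
      by (rule totally_geodesic_skew[OF s\<xi>[OF t] _ smooth_\<zeta> _ smooth_\<zeta> _ z1 qV[OF q]])
        (simp_all add: \<xi>_def lift_horizontal \<zeta>_def)
    then show "\<beta> i k j t q = - \<beta> i j k t q"
      unfolding \<beta>_def using gcoord_sym[OF riem0 V_chart[OF qV[OF q]]] by simp
  next
    fix t i j k assume t: "t \<in> I"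
    show "\<omega> i j k t x = 0"
      unfolding \<omega>_def x(2) by (rule z0[OF t u0]) (unfold \<xi>_def[abs_def], rule fst_bracket_frame_u0[OF t])
  next
    fix t i k j assume t: "t \<in> I"
    show "\<beta> i k j t x = 0"
      unfolding \<beta>_def x(2) bracket_\<xi>_\<zeta>_u0[OF t] by (rule linear_0[OF gcoord0_linear(1)[OF u0]])
  qed
qed

end

theorem lemma4p11:
  fixes A :: "('a::{second_countable_topology, t2_space}, 'n::finite, 'm::finite) fchart set"
    and g0 :: "'a tensor2"
    and I :: "real set"
    and g h :: "real \<Rightarrow> 'a tensor2"
    and x :: 'a
  assumes "foliated_atlas A"
    and "connected (UNIV :: 'a set)"
    and "riemannian_metric A g0"
    and "complete_metric A g0"
    and "bundle_like A g0"
    and "totally_geodesic_leaves A g0"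
    and "bracket_generating A g0"
    and "is_interval I" and "0 \<in> I"
    and "transverse_flow A g0 I g h"
    and "\<forall>t\<in>I. bundle_like A (g t)"
  shows "\<exists>U (X :: 'n \<Rightarrow> real \<Rightarrow> 'a tfield) (Z :: 'm \<Rightarrow> 'a tfield)
           (\<omega> :: 'n \<Rightarrow> 'n \<Rightarrow> 'n \<Rightarrow> real \<Rightarrow> 'a \<Rightarrow> real)
           (\<gamma> :: 'n \<Rightarrow> 'n \<Rightarrow> 'm \<Rightarrow> real \<Rightarrow> 'a \<Rightarrow> real)
           (\<beta> :: 'n \<Rightarrow> 'm \<Rightarrow> 'm \<Rightarrow> real \<Rightarrow> 'a \<Rightarrow> real).
      open U \<and> x \<in> U \<and>
      (\<forall>i. X i \<in> vector_field_families A I U) \<and>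
      (\<forall>k. Z k \<in> vertical_fields A U) \<and>
      (\<forall>t\<in>I. \<forall>i. X i t \<in> horizontal_fields A (g t) U) \<and>
      (\<forall>t\<in>I. \<forall>q\<in>U. \<forall>i j. g t q (X i t q) (X j t q) = (if i = j then 1 else 0)) \<and>
      (\<forall>t\<in>I. \<forall>q\<in>U. \<forall>k l. g t q (Z k q) (Z l q) = (if k = l then 1 else 0)) \<and>
      (\<forall>i j k. smooth_in_time A I U (\<omega> i j k)) \<and>
      (\<forall>i j k. smooth_in_time A I U (\<gamma> i j k)) \<and>
      (\<forall>i k j. smooth_in_time A I U (\<beta> i k j)) \<and>
      (\<forall>t\<in>I. \<forall>q\<in>U. \<forall>i j. lie_bracket A (X i t) (X j t) q =
         (\<lambda>f. (\<Sum>k\<in>UNIV. \<omega> i j k t q * X k t q f) + (\<Sum>k\<in>UNIV. \<gamma> i j k t q * Z k q f))) \<and>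
      (\<forall>t\<in>I. \<forall>q\<in>U. \<forall>i k. lie_bracket A (X i t) (Z k) q =
         (\<lambda>f. \<Sum>j\<in>UNIV. \<beta> i k j t q * Z j q f)) \<and>
      (\<forall>t\<in>I. \<forall>q\<in>U. \<forall>i k j. \<beta> i k j t q = - \<beta> i j k t q) \<and>
      (\<forall>t\<in>I. (\<forall>i j k. \<omega> i j k t x = 0) \<and> (\<forall>i k j. \<beta> i k j t x = 0))"
proof -
  obtain c where c: "c \<in> A" "x \<in> cdom c"
    using assms(1) unfolding foliated_atlas_def by blast
  interpret foliated_chart A c by unfold_locales (use assms(1) c in auto)
  let ?u0 = "cmap c x" and ?V = "cmap c ` cdom c"
  obtain Y Z' where YZ: "open Y" "open Z'" "fst ?u0 \<in> Y" "snd ?u0 \<in> Z'" "Y \<times> Z' \<subseteq> ?V"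
    using open_prod_elim[OF is_chartD(2)[OF chart], of ?u0] c(2)
    by (metis imageI mem_Times_iff)
  obtain e where e: "e > 0" "ball (snd ?u0) e \<subseteq> Z'"
    using YZ(2,4) open_contains_ball by blast
  \<comment> \<open>A ball makes the plaques convex, as \<open>flow_chart\<close> demands.\<close>
  define Z where "Z = ball (snd ?u0) e"
  \<comment> \<open>Taking the full preimage of a product contained in the chart image makes the
    image of \<open>U\<close> the entire product.\<close>
  define U where "U = cdom c \<inter> cmap c -` (Y \<times> Z)"
  have sub: "Y \<times> Z \<subseteq> ?V" using YZ(5) e(2) unfolding Z_def by blast
  have U: "open U" "U \<subseteq> cdom c"
    unfolding U_def Z_def
    by (auto intro!: continuous_open_preimage is_chartD[OF chart] open_Times YZ(1))
  have "cmap c ` U = ?V \<inter> (Y \<times> Z)"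
    unfolding U_def
  proof (rule equalityI; rule subsetI)
    fix u assume "u \<in> cmap c ` cdom c \<inter> (Y \<times> Z)"
    then obtain r where "r \<in> cdom c" "u = cmap c r" "u \<in> Y \<times> Z" by (elim IntE imageE)
    then show "u \<in> cmap c ` (cdom c \<inter> cmap c -` (Y \<times> Z))" by (intro image_eqI[of _ _ r] IntI vimageI2) simp_all
  next
    fix u assume "u \<in> cmap c ` (cdom c \<inter> cmap c -` (Y \<times> Z))"
    then obtain r where "r \<in> cdom c" "u = cmap c r" "cmap c r \<in> Y \<times> Z" by (elim imageE IntE vimageE) simp
    then show "u \<in> cmap c ` cdom c \<inter> (Y \<times> Z)" by (intro IntI image_eqI[of _ _ r]) simp_all
  qed
  then have V: "cmap c ` U = Y \<times> Z" using sub by (simp only: inf_absorb2)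
  have u0: "?u0 \<in> cmap c ` U" unfolding V using YZ(3) e(1) by (simp add: Z_def mem_Times_iff)
  interpret flow_chart A c g0 I g h U Y Z ?u0
    by unfold_locales (use assms U V u0 in \<open>auto simp: Z_def\<close>)
  show ?thesis using adapted_frame unfolding cinv_cmap[OF c(2)] .
qed

end
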